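(* Let $D\in\mathbb R\cup\{+\infty\}$. The following are equivalent. (A) Whenever even Borel functions $f_i:E_i\to\mathbb R\cup\{+\infty\}$ satisfy $e^{-f_i}\in L^1(E_i)$ and $\sum_{i=1}^nc_if_i(x_i)\ge\langle x,Qx\rangle$ for all $x=(x_1,\dots,x_n)\in E$, one has $\prod_{i=1}^n\big(\int_{E_i}e^{-f_i}dx_i\big)^{c_i}\le e^D$. (B) Whenever $\mu_i\in\mathcal P(E_i)$, $i=1,\dots,n$, are symmetric, one has $\sum_{i=1}^nc_ih(\mu_i)\le\sup_{\mu\in\Pi(\mu_1,\dots,\mu_n)}\int_E\langle x,Qx\rangle d\mu+D$. Moreover, $D_s(\mathbf c,Q)$ equals the smallest constant $D$ such that the inequality in (B) holds for all symmetric log-concave $\mu_i\in\mathcal P(E_i)$; i.e., symmetric log-concave measures suffice to saturate (B) with its sharp constant.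
   Context: Let $E_i=\mathbb{R}^{d_i}$, $E=\bigoplus_{i=1}^n E_i$, $\pi_i:E\to E_i$ the coordinate projection, $x_i=\pi_i(x)$. Fix a symmetric linear map $Q$ on $E$ and positive reals $\mathbf c=(c_i)_{i=1}^n$. $\mathcal P(E_i)$: Borel probability measures on $E_i$ absolutely continuous w.r.t. Lebesgue with finite second moments; $h(\mu_i)=-\int\rho_i\log\rho_i$ for density $\rho_i$. $\Pi(\mu_1,\dots,\mu_n)$: probability measures $\mu$ on $E$ with $\pi_i\sharp\mu=\mu_i$. A measure $\mu_i$ is symmetric if $\mu_i(B)=\mu_i(-B)$ for all Borel $B$; a function is even if $f(-x)=f(x)$. $D_s(\mathbf c,Q)\in\mathbb R\cup\{+\infty\}$ is the smallest $D$ such that the inequality in (B) holds for all symmetric $\mu_i\in\mathcal P(E_i)$. *)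

theory Defs
  imports "HOL-Probability.Probability"
begin

text \<open>Lebesgue measure on R^m, points represented as extensional functions on {..<m}.\<close>
definition Leb :: "nat \<Rightarrow> (nat \<Rightarrow> real) measure" where
  "Leb m = PiM {..<m} (\<lambda>_. lborel)"

text \<open>E = direct sum of the E_i = R^(d i), i < n; a point x has blocks x i = pi_i x.\<close>
definition Emeas :: "nat \<Rightarrow> (nat \<Rightarrow> nat) \<Rightarrow> (nat \<Rightarrow> nat \<Rightarrow> real) measure" where
  "Emeas n d = PiM {..<n} (\<lambda>i. Leb (d i))"

definition quadform :: "nat \<Rightarrow> (nat \<Rightarrow> nat) \<Rightarrow> (nat \<Rightarrow> nat \<Rightarrow> nat \<Rightarrow> nat \<Rightarrow> real)
    \<Rightarrow> (nat \<Rightarrow> nat \<Rightarrow> real) \<Rightarrow> real" where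
  "quadform n d q x = (\<Sum>i<n. \<Sum>k<d i. \<Sum>j<n. \<Sum>l<d j. q i k j l * x i k * x j l)"

definition negv :: "nat \<Rightarrow> (nat \<Rightarrow> real) \<Rightarrow> (nat \<Rightarrow> real)" where
  "negv m x = restrict (\<lambda>k. - x k) {..<m}"

definition cvx :: "nat \<Rightarrow> real \<Rightarrow> (nat \<Rightarrow> real) \<Rightarrow> (nat \<Rightarrow> real) \<Rightarrow> (nat \<Rightarrow> real)" where
  "cvx m t x y = restrict (\<lambda>k. (1 - t) * x k + t * y k) {..<m}"

definition Pspace :: "nat \<Rightarrow> (nat \<Rightarrow> real) measure \<Rightarrow> bool" where
  "Pspace m \<mu> \<longleftrightarrow> sets \<mu> = sets (Leb m) \<and> prob_space \<mu> \<and> absolutely_continuous (Leb m) \<mu>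
     \<and> (\<integral>\<^sup>+ x. ennreal (\<Sum>k<m. (x k)\<^sup>2) \<partial>\<mu>) < \<infinity>"

definition symmetric_measure :: "nat \<Rightarrow> (nat \<Rightarrow> real) measure \<Rightarrow> bool" where
  "symmetric_measure m \<mu> \<longleftrightarrow>
     (\<forall>B\<in>sets \<mu>. emeasure \<mu> (negv m -` B \<inter> space \<mu>) = emeasure \<mu> B)"

definition log_concave_measure :: "nat \<Rightarrow> (nat \<Rightarrow> real) measure \<Rightarrow> bool" where
  "log_concave_measure m \<mu> \<longleftrightarrow> (\<exists>\<rho>. \<rho> \<in> borel_measurable (Leb m)
     \<and> (\<forall>x\<in>space (Leb m). 0 \<le> \<rho> x)
     \<and> \<mu> = density (Leb m) (\<lambda>x. ennreal (\<rho> x))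
     \<and> (\<forall>x\<in>space (Leb m). \<forall>y\<in>space (Leb m). \<forall>t\<in>{0<..<1}.
          \<rho> x powr (1 - t) * \<rho> y powr t \<le> \<rho> (cvx m t x y)))"

text \<open>Differential entropy h = - int rho log rho, as an extended real
  (positive part minus negative part of rho log rho).\<close>
definition entropy_h :: "nat \<Rightarrow> (nat \<Rightarrow> real) measure \<Rightarrow> ereal" where
  "entropy_h m \<mu> =
     (let \<rho> = (\<lambda>x. enn2real (RN_deriv (Leb m) \<mu> x)) in
       enn2ereal (\<integral>\<^sup>+ x. ennreal (- (\<rho> x * ln (\<rho> x))) \<partial>Leb m)
     - enn2ereal (\<integral>\<^sup>+ x. ennreal (\<rho> x * ln (\<rho> x)) \<partial>Leb m))"

definition couplings :: "nat \<Rightarrow> (nat \<Rightarrow> nat) \<Rightarrow> (nat \<Rightarrow> (nat \<Rightarrow> real) measure)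
    \<Rightarrow> (nat \<Rightarrow> nat \<Rightarrow> real) measure set" where
  "couplings n d \<mu>s = {\<mu>. sets \<mu> = sets (Emeas n d) \<and> prob_space \<mu>
     \<and> (\<forall>i<n. distr \<mu> (Leb (d i)) (\<lambda>x. x i) = \<mu>s i)}"

definition expneg :: "ereal \<Rightarrow> ennreal" where
  "expneg v = ennreal (if v = \<infinity> then 0 else exp (- real_of_ereal v))"

text \<open>Condition (A) with constant D (D in R \<union> {+\<infinity>}; e^{+\<infinity>} = +\<infinity>).\<close>
definition condA :: "nat \<Rightarrow> (nat \<Rightarrow> nat) \<Rightarrow> (nat \<Rightarrow> real) \<Rightarrow> (nat \<Rightarrow> nat \<Rightarrow> nat \<Rightarrow> nat \<Rightarrow> real)
    \<Rightarrow> ereal \<Rightarrow> bool" where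
  "condA n d c q D \<longleftrightarrow> (\<forall>f :: nat \<Rightarrow> (nat \<Rightarrow> real) \<Rightarrow> ereal.
     ((\<forall>i<n. f i \<in> borel_measurable (Leb (d i))
         \<and> (\<forall>x\<in>space (Leb (d i)). f i x \<noteq> -\<infinity> \<and> f i (negv (d i) x) = f i x)
         \<and> (\<integral>\<^sup>+ x. expneg (f i x) \<partial>Leb (d i)) < \<infinity>)
      \<and> (\<forall>x\<in>space (Emeas n d). ereal (quadform n d q x) \<le> (\<Sum>i<n. ereal (c i) * f i (x i))))
     \<longrightarrow> D = \<infinity> \<or>
        (\<Prod>i<n. enn2real (\<integral>\<^sup>+ x. expneg (f i x) \<partial>Leb (d i)) powr c i) \<le> exp (real_of_ereal D))"

definition condB_gen :: "(nat \<Rightarrow> (nat \<Rightarrow> real) measure \<Rightarrow> bool) \<Rightarrow> nat \<Rightarrow> (nat \<Rightarrow> nat) \<Rightarrow> (nat \<Rightarrow> real)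
    \<Rightarrow> (nat \<Rightarrow> nat \<Rightarrow> nat \<Rightarrow> nat \<Rightarrow> real) \<Rightarrow> ereal \<Rightarrow> bool" where
  "condB_gen P n d c q D \<longleftrightarrow> (\<forall>\<mu>s :: nat \<Rightarrow> (nat \<Rightarrow> real) measure.
     (\<forall>i<n. Pspace (d i) (\<mu>s i) \<and> symmetric_measure (d i) (\<mu>s i) \<and> P i (\<mu>s i))
     \<longrightarrow> (\<Sum>i<n. ereal (c i) * entropy_h (d i) (\<mu>s i))
         \<le> (SUP \<mu>\<in>couplings n d \<mu>s. ereal (\<integral>x. quadform n d q x \<partial>\<mu>)) + D)"

definition condB :: "nat \<Rightarrow> (nat \<Rightarrow> nat) \<Rightarrow> (nat \<Rightarrow> real)
    \<Rightarrow> (nat \<Rightarrow> nat \<Rightarrow> nat \<Rightarrow> nat \<Rightarrow> real) \<Rightarrow> ereal \<Rightarrow> bool" where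
  "condB n d = condB_gen (\<lambda>_ _. True) n d"

definition condB_logconcave :: "nat \<Rightarrow> (nat \<Rightarrow> nat) \<Rightarrow> (nat \<Rightarrow> real)
    \<Rightarrow> (nat \<Rightarrow> nat \<Rightarrow> nat \<Rightarrow> nat \<Rightarrow> real) \<Rightarrow> ereal \<Rightarrow> bool" where
  "condB_logconcave n d c q D = condB_gen (\<lambda>i \<mu>. log_concave_measure (d i) \<mu>) n d c q D"

definition Ds :: "nat \<Rightarrow> (nat \<Rightarrow> nat) \<Rightarrow> (nat \<Rightarrow> real) \<Rightarrow> (nat \<Rightarrow> nat \<Rightarrow> nat \<Rightarrow> nat \<Rightarrow> real) \<Rightarrow> ereal" where
  "Ds n d c q = Inf {D. D \<noteq> -\<infinity> \<and> condB n d c q D}"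

end

theory Submission
  imports Defs
begin

text \<open>
  From (A) to (B): round every block to a finite grid. The rounding error in \<open>\<langle>x, Q x\<rangle>\<close> is bounded by a
  sum of functions of the single blocks with small integrals, so finite linear programming duality on
  the grid, together with gluing a discrete coupling by conditionally independent pieces of the
  \<open>\<mu>\<^sub>i\<close>, yields nearly optimal Kantorovich potentials \<open>f\<^sub>i\<close>. Symmetrising them and applying
  Gibbs' inequality \<open>h(\<mu>\<^sub>i) \<le> \<integral> f\<^sub>i d\<mu>\<^sub>i + ln \<integral> e\<^bsup>-f\<^esup>\<close> gives (B).

  From (B) for log-concave measures to (A): if all diagonal blocks of \<open>Q\<close> are positive semidefinite,
  each \<open>f\<^sub>i\<close> (truncated to a cube) may be decreased to the supremum over the other blocks of
  \<open>(\<langle>x, Q x\<rangle> - \<Sum> c\<^sub>j f\<^sub>j(x\<^sub>j)) / c\<^sub>i\<close>, which is convex and even; (B) for the Gibbs measures of these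
  convex functions is the desired bound. If a diagonal block has a negative direction, uniform
  measures on long tubes in that direction violate (B) for every finite constant.
\<close>

section \<open>Finite linear programming duality\<close>

text \<open>The implications form a cycle: (B) gives (B) for log-concave measures, which gives (A),
  which gives (B). So the same constants are admissible in all three conditions, and the claim on
  \<open>Ds\<close> compares infima of equal sets. The marginals have only second moments, which is
  exactly the growth of the form, so a rounding error of order |x| |x - y| is not uniformly small.
  It is small in integral: a small multiple of |x|^2 is traded against a large multiple of |x -
  y|^2. The first of these terms stays in the potentials as quadratic growth, and this growth makes
  exp (- f) integrable, so that (A) applies to them. Duality is used as an alternative at a fixed
  level, with an epsilon to spare. In the other direction, truncation to a cube keeps suprema,
  moments and entropies finite; the limit is taken only at the end, in the partition functions. A
  positive semidefinite diagonal block makes the form convex in that block while the others are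
  frozen, and a supremum of convex functions is convex. That is why semidefiniteness is extracted
  from (B) before any function is convexified.\<close>

text \<open>Bartl's induction on the set of constraints: a point \<open>x0\<close> violating the conclusion for the
  smaller system is used to eliminate the new constraint.\<close>

lemma farkas:
  fixes a :: "'j \<Rightarrow> 'k \<Rightarrow> real" and b :: "'k \<Rightarrow> real"
  assumes "finite J" "finite K"
    and "\<And>x. (\<And>j. j \<in> J \<Longrightarrow> (\<Sum>k\<in>K. a j k * x k) \<le> 0) \<Longrightarrow> (\<Sum>k\<in>K. b k * x k) \<le> 0"
  shows "\<exists>l. (\<forall>j\<in>J. 0 \<le> l j) \<and> (\<forall>k\<in>K. b k = (\<Sum>j\<in>J. l j * a j k))"
  using assms(1,3)
proof (induction J arbitrary: a b rule: finite_induct)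
  case empty
  have "(\<Sum>k\<in>K. b k * b k) \<le> 0" using empty by auto
  moreover have "0 \<le> b k * b k" for k by simp
  ultimately have "\<forall>k\<in>K. b k * b k = 0"
    using sum_nonneg_eq_0_iff[OF assms(2), of "\<lambda>k. b k * b k"] by (simp add: order_antisym sum_nonneg)
  then show ?case by auto
next
  case (insert m J)
  show ?case
  proof (cases "\<forall>x. (\<forall>j\<in>J. (\<Sum>k\<in>K. a j k * x k) \<le> 0) \<longrightarrow> (\<Sum>k\<in>K. b k * x k) \<le> 0")
    case True
    then obtain l where l: "\<forall>j\<in>J. 0 \<le> l j" "\<forall>k\<in>K. b k = (\<Sum>j\<in>J. l j * a j k)"
      using insert.IH[of a b] by blast
    have "(\<Sum>j\<in>insert m J. (l(m := 0)) j * a j k) = (\<Sum>j\<in>J. l j * a j k)" for k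
      using insert.hyps by (auto intro!: sum.cong)
    with l show ?thesis by (intro exI[of _ "l(m := 0)"]) auto
  next
    case False
    then obtain x1 where x1: "\<forall>j\<in>J. (\<Sum>k\<in>K. a j k * x1 k) \<le> 0" "(\<Sum>k\<in>K. b k * x1 k) > 0"
      by force
    have pos: "(\<Sum>k\<in>K. a m k * x1 k) > 0"
      using insert.prems[of x1] x1 by force
    define s where "s = (\<Sum>k\<in>K. a m k * x1 k)"
    define x0 where "x0 = (\<lambda>k. x1 k / s)"
    have scale: "(\<Sum>k\<in>K. e k * x0 k) = (\<Sum>k\<in>K. e k * x1 k) / s" for e
      by (simp add: x0_def sum_divide_distrib)
    have s: "s > 0" using pos s_def by simp
    have x0: "\<forall>j\<in>J. (\<Sum>k\<in>K. a j k * x0 k) \<le> 0" "(\<Sum>k\<in>K. b k * x0 k) > 0" "(\<Sum>k\<in>K. a m k * x0 k) = 1"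
      using x1 s unfolding scale by (auto simp: s_def divide_nonpos_pos)
    define \<alpha> where "\<alpha> j = (\<Sum>k\<in>K. a j k * x0 k)" for j
    define \<beta> where "\<beta> = (\<Sum>k\<in>K. b k * x0 k)"
    \<comment> \<open>\<open>a'\<close> and \<open>b'\<close> are the old functionals composed with
      the projection along \<open>x0\<close> onto the kernel of the new constraint. A projected
      point satisfies the new constraint with equality, so the induction hypothesis applies to
      \<open>a'\<close> and \<open>b'\<close> without it.\<close>
    define a' where "a' j k = a j k - a m k * \<alpha> j" for j k
    define b' where "b' k = b k - a m k * \<beta>" for k
    have shift: "(\<Sum>k\<in>K. (e k - a m k * t) * x k)
        = (\<Sum>k\<in>K. e k * x k) - (\<Sum>k\<in>K. a m k * x k) * t" for e x t
      by (simp add: algebra_simps sum_subtractf sum_distrib_left)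
    have shift2: "(\<Sum>k\<in>K. e k * (x k - t * x0 k)) = (\<Sum>k\<in>K. e k * x k) - t * (\<Sum>k\<in>K. e k * x0 k)" for e x t
      by (simp add: algebra_simps sum_subtractf sum_distrib_left)
    have "(\<Sum>k\<in>K. b' k * x k) \<le> 0" if H: "\<And>j. j \<in> J \<Longrightarrow> (\<Sum>k\<in>K. a' j k * x k) \<le> 0" for x
    proof -
      define y where "y k = x k - (\<Sum>k\<in>K. a m k * x k) * x0 k" for k
      have "(\<Sum>k\<in>K. a j k * y k) \<le> 0" if "j \<in> insert m J" for j
      proof (cases "j = m")
        case True
        then show ?thesis using x0(3) unfolding y_def shift2 by simp
      next
        case False
        then show ?thesis using H[of j] that unfolding y_def shift2 a'_def shift \<alpha>_def by simp
      qed
      then have "(\<Sum>k\<in>K. b k * y k) \<le> 0" using insert.prems[of y] by blast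
      then show ?thesis unfolding y_def shift2 b'_def shift \<beta>_def by simp
    qed
    then obtain l where l: "\<forall>j\<in>J. 0 \<le> l j" "\<forall>k\<in>K. b' k = (\<Sum>j\<in>J. l j * a' j k)"
      using insert.IH[of a' b'] by blast
    \<comment> \<open>The multiplier is forced by collecting the coefficients of \<open>a m\<close>.
      It is nonnegative because \<open>x0\<close> satisfies the old constraints
      (\<open>\<alpha> j \<le> 0\<close>) and violates the conclusion
      (\<open>\<beta> > 0\<close>).\<close>
    define t where "t = \<beta> - (\<Sum>j\<in>J. l j * \<alpha> j)"
    have "(\<Sum>j\<in>J. l j * \<alpha> j) \<le> 0"
      using l(1) x0(1) unfolding \<alpha>_def by (intro sum_nonpos) (simp add: mult_nonneg_nonpos)
    then have t: "t \<ge> 0" using x0(2) by (simp add: t_def \<beta>_def)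
    have "(\<Sum>j\<in>insert m J. (l(m := t)) j * a j k) = t * a m k + (\<Sum>j\<in>J. l j * a j k)" for k
    proof -
      have "(\<Sum>j\<in>J. (l(m := t)) j * a j k) = (\<Sum>j\<in>J. l j * a j k)"
        using insert.hyps by (intro sum.cong) auto
      then show ?thesis using insert.hyps by simp
    qed
    moreover have "b k = t * a m k + (\<Sum>j\<in>J. l j * a j k)" if "k \<in> K" for k
    proof -
      have "b k - a m k * \<beta> = (\<Sum>j\<in>J. l j * a j k) - a m k * (\<Sum>j\<in>J. l j * \<alpha> j)"
        using l(2) that by (simp add: b'_def a'_def algebra_simps sum_subtractf sum_distrib_left)
      then show ?thesis by (simp add: t_def algebra_simps)
    qed
    ultimately show ?thesis using l t by (intro exI[of _ "l(m := t)"]) auto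
  qed
qed

text \<open>Farkas' lemma for the homogenised dual program: coordinate \<open>None\<close> is a
  scale, coordinate \<open>Some (i, a)\<close> the scaled value of the \<open>i\<close>-th potential
  at \<open>a\<close>. A vector violating the implication becomes, after division by its scale, dual
  potentials of value below \<open>r\<close>; if there is none, the multipliers of the cost
  constraints are a coupling of value at least \<open>r\<close>.\<close>

lemma finite_multimarginal_duality:
  fixes p :: "nat \<Rightarrow> 'a \<Rightarrow> real" and cost :: "(nat \<Rightarrow> 'a) \<Rightarrow> real" and r :: real
  assumes fin: "\<And>i. i < n \<Longrightarrow> finite (F i)"
    and p_nonneg: "\<And>i a. i < n \<Longrightarrow> a \<in> F i \<Longrightarrow> 0 \<le> p i a"
    and p_sum: "\<And>i. i < n \<Longrightarrow> (\<Sum>a\<in>F i. p i a) = 1"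
  obtains (primal) l where "\<And>t. t \<in> PiE {..<n} F \<Longrightarrow> 0 \<le> l t"
      "\<And>i a. i < n \<Longrightarrow> a \<in> F i \<Longrightarrow> (\<Sum>t\<in>{t\<in>PiE {..<n} F. t i = a}. l t) = p i a"
      "r \<le> (\<Sum>t\<in>PiE {..<n} F. l t * cost t)"
  | (dual) \<phi> where "\<And>t. t \<in> PiE {..<n} F \<Longrightarrow> cost t \<le> (\<Sum>i<n. \<phi> i (t i))"
      "(\<Sum>i<n. \<Sum>a\<in>F i. \<phi> i a * p i a) < r"
proof -
  define X where "X = PiE {..<n} F"
  define S where "S = Sigma {..<n} F"
  have finX: "finite X" unfolding X_def using fin by (intro finite_PiE) auto
  have finS: "finite S" unfolding S_def using fin by auto
  define K where "K = insert None (Some ` S)"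
  have finK: "finite K" unfolding K_def using finS by auto
  have sumK: "(\<Sum>k\<in>K. g k) = g None + (\<Sum>i<n. \<Sum>a\<in>F i. g (Some (i, a)))" for g :: "_ \<Rightarrow> real"
  proof -
    have "(\<Sum>k\<in>Some ` S. g k) = (\<Sum>s\<in>S. g (Some s))" by (subst sum.reindex) auto
    also have "\<dots> = (\<Sum>i<n. \<Sum>a\<in>F i. g (Some (i, a)))"
      unfolding S_def using fin by (subst sum.Sigma) (auto simp: split_def)
    finally show ?thesis unfolding K_def using finS by (subst sum.insert) auto
  qed
  \<comment> \<open>Row \<open>None\<close> says that the scale is nonnegative, row
    \<open>Some t\<close> that the scaled cost at \<open>t\<close> is at most the sum of the
    potentials along \<open>t\<close>. The functional \<open>B\<close> is the scaled level minus the
    dual objective.\<close>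
  define A :: "(nat \<Rightarrow> 'a) option \<Rightarrow> (nat \<times> 'a) option \<Rightarrow> real" where
    "A j k = (case j of None \<Rightarrow> (if k = None then -1 else 0)
      | Some t \<Rightarrow> (case k of None \<Rightarrow> cost t | Some (i, a) \<Rightarrow> if t i = a then -1 else 0))" for j k
  define B where "B k = (case k of None \<Rightarrow> r | Some (i, a) \<Rightarrow> - p i a)" for k :: "(nat \<times> 'a) option"
  have A_None: "(\<Sum>k\<in>K. A None k * x k) = - x None" for x
    unfolding sumK by (simp add: A_def)
  have A_Some: "(\<Sum>k\<in>K. A (Some t) k * x k) = cost t * x None - (\<Sum>i<n. x (Some (i, t i)))"
    if "t \<in> X" for t x
  proof -
    have "(\<Sum>a\<in>F i. A (Some t) (Some (i, a)) * x (Some (i, a))) = - x (Some (i, t i))" if "i < n" for i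
    proof -
      have "t i \<in> F i" using \<open>t \<in> X\<close> that by (auto simp: X_def)
      then have "(\<Sum>a\<in>F i. A (Some t) (Some (i, a)) * x (Some (i, a)))
          = (\<Sum>a\<in>F i. if t i = a then - x (Some (i, a)) else 0)"
        by (intro sum.cong) (auto simp: A_def)
      then show ?thesis using fin[OF that] \<open>t i \<in> F i\<close> by simp
    qed
    then show ?thesis unfolding sumK by (simp add: A_def sum_negf)
  qed
  have B_sum: "(\<Sum>k\<in>K. B k * x k) = r * x None - (\<Sum>i<n. \<Sum>a\<in>F i. x (Some (i, a)) * p i a)" for x
    unfolding sumK by (simp add: B_def sum_negf mult.commute)
  show thesis
  proof (cases "\<exists>x. (\<forall>j\<in>insert None (Some ` X). (\<Sum>k\<in>K. A j k * x k) \<le> 0) \<and> (\<Sum>k\<in>K. B k * x k) > 0")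
    case True
    then obtain x where x: "\<And>j. j\<in>insert None (Some ` X) \<Longrightarrow> (\<Sum>k\<in>K. A j k * x k) \<le> 0"
      "(\<Sum>k\<in>K. B k * x k) > 0" by auto
    define s where "s = x None"
    have s: "s \<ge> 0" using x(1)[of None] A_None by (simp add: s_def)
    have c: "cost t * s \<le> (\<Sum>i<n. x (Some (i, t i)))" if "t \<in> X" for t
      using x(1)[of "Some t"] A_Some[OF that] that by (simp add: s_def)
    have v: "(\<Sum>i<n. \<Sum>a\<in>F i. x (Some (i, a)) * p i a) < r * s"
      using x(2) unfolding B_sum s_def by simp
    show thesis
    proof (cases "s = 0")
      \<comment> \<open>A vector of scale zero cannot be divided by its scale, but it does not
        exist: the cost constraint at the tuple of minimisers makes the sum of the minima
        nonnegative, hence also the sum of the averages under \<open>p\<close>, against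
        \<open>v\<close>.\<close>
      case True
      have ne: "F i \<noteq> {}" if "i < n" for i using p_sum[OF that] by auto
      have "\<exists>a\<in>F i. \<forall>b\<in>F i. x (Some (i, a)) \<le> x (Some (i, b))" if "i < n" for i
        using ex_is_arg_min_if_finite[OF fin[OF that] ne[OF that], of "\<lambda>a. x (Some (i, a))"]
        by (auto simp: is_arg_min_linorder)
      then obtain a where a: "\<And>i. i < n \<Longrightarrow> a i \<in> F i"
          "\<And>i b. i < n \<Longrightarrow> b \<in> F i \<Longrightarrow> x (Some (i, a i)) \<le> x (Some (i, b))"
        by metis
      have "restrict a {..<n} \<in> X" using a(1) by (auto simp: X_def)
      then have "0 \<le> (\<Sum>i<n. x (Some (i, a i)))" using c[of "restrict a {..<n}"] True by simp
      also have "\<dots> \<le> (\<Sum>i<n. \<Sum>b\<in>F i. x (Some (i, b)) * p i b)"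
      proof (rule sum_mono)
        fix i assume i: "i \<in> {..<n}"
        have "x (Some (i, a i)) = (\<Sum>b\<in>F i. x (Some (i, a i)) * p i b)"
          using p_sum i by (simp flip: sum_distrib_left)
        also have "\<dots> \<le> (\<Sum>b\<in>F i. x (Some (i, b)) * p i b)"
          using a(2) i p_nonneg by (intro sum_mono mult_right_mono) auto
        finally show "x (Some (i, a i)) \<le> (\<Sum>b\<in>F i. x (Some (i, b)) * p i b)" .
      qed
      finally show thesis using v True by simp
    next
      case False
      with s have s: "s > 0" by simp
      show thesis
      proof (rule dual[of "\<lambda>i a. x (Some (i, a)) / s"])
        show "cost t \<le> (\<Sum>i<n. x (Some (i, t i)) / s)" if "t \<in> PiE {..<n} F" for t
          using c[of t] that s by (simp add: X_def field_simps flip: sum_divide_distrib)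
        show "(\<Sum>i<n. \<Sum>a\<in>F i. x (Some (i, a)) / s * p i a) < r"
          using v s by (simp add: field_simps flip: sum_divide_distrib)
      qed
    qed
  next
    case False
    then have "\<exists>l. (\<forall>j\<in>insert None (Some ` X). 0 \<le> l j)
        \<and> (\<forall>k\<in>K. B k = (\<Sum>j\<in>insert None (Some ` X). l j * A j k))"
      using finX finK by (intro farkas) (auto simp: not_less)
    then obtain l where l: "\<And>j. j\<in>insert None (Some ` X) \<Longrightarrow> 0 \<le> l j"
      "\<And>k. k\<in>K \<Longrightarrow> B k = (\<Sum>j\<in>insert None (Some ` X). l j * A j k)" by auto
    have sumJ: "(\<Sum>j\<in>insert None (Some ` X). g j) = g None + (\<Sum>t\<in>X. g (Some t))"
      for g :: "_ \<Rightarrow> real"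
      using finX by (subst sum.insert) (auto simp: sum.reindex)
    show thesis
    proof (rule primal[of "\<lambda>t. l (Some t)"])
      show "0 \<le> l (Some t)" if "t \<in> PiE {..<n} F" for t using l(1) that by (auto simp: X_def)
      show "(\<Sum>t\<in>{t\<in>PiE {..<n} F. t i = a}. l (Some t)) = p i a" if "i < n" "a \<in> F i" for i a
      proof -
        have "Some (i, a) \<in> K" using that by (auto simp: K_def S_def)
        from l(2)[OF this] have "- p i a = (\<Sum>t\<in>X. l (Some t) * (if t i = a then -1 else 0))"
          unfolding sumJ by (simp add: A_def B_def)
        also have "\<dots> = - (\<Sum>t\<in>X. if t i = a then l (Some t) else 0)"
          by (simp add: if_distrib sum_negf[symmetric] cong: if_cong)
        also have "(\<Sum>t\<in>X. if t i = a then l (Some t) else 0) = (\<Sum>t\<in>{t\<in>X. t i = a}. l (Some t))"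
          using finX by (simp add: sum.inter_filter)
        finally show ?thesis by (simp add: X_def)
      qed
      \<comment> \<open>The multiplier of the sign constraint is the slack by which the coupling
        exceeds the level \<open>r\<close>.\<close>
      have "r = - l None + (\<Sum>t\<in>X. l (Some t) * cost t)"
        using l(2)[of None] unfolding sumJ by (simp add: A_def B_def K_def)
      then show "r \<le> (\<Sum>t\<in>PiE {..<n} F. l (Some t) * cost t)"
        using l(1)[of None] by (simp add: X_def)
    qed
  qed
qed

section \<open>Lebesgue measure on extensional functions\<close>

interpretation lborel_product: product_sigma_finite "\<lambda>_::nat. lborel :: real measure"
  by standard

lemma space_Leb: "space (Leb m) = extensional {..<m}"
  by (auto simp: Leb_def space_PiM PiE_def)

lemma sigma_finite_Leb: "sigma_finite_measure (Leb m)"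
  unfolding Leb_def by (rule lborel_product.sigma_finite) simp

lemma Leb_component_measurable [measurable]:
  "k < m \<Longrightarrow> (\<lambda>x. x k) \<in> borel_measurable (Leb m)"
  unfolding Leb_def by measurable

lemma Leb_measurable_restrict:
  assumes "\<And>k. k < m \<Longrightarrow> g k \<in> borel_measurable M"
  shows "(\<lambda>x. restrict (\<lambda>k. g k x) {..<m}) \<in> measurable M (Leb m)"
  unfolding Leb_def using assms by (intro measurable_restrict) auto

lemma negv_measurable [measurable]: "negv m \<in> measurable (Leb m) (Leb m)"
  unfolding negv_def[abs_def] by (rule Leb_measurable_restrict) measurable

lemma negv_space: "negv m x \<in> space (Leb m)"
  by (simp add: negv_def space_Leb)

lemma negv_negv: "x \<in> space (Leb m) \<Longrightarrow> negv m (negv m x) = x"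
  by (auto simp: negv_def space_Leb extensional_def restrict_def fun_eq_iff)

lemma cvx_space: "cvx m t x y \<in> space (Leb m)"
  by (simp add: cvx_def space_Leb)

lemma PiE_sets_Leb: "(\<And>k. k < m \<Longrightarrow> B k \<in> sets borel) \<Longrightarrow> PiE {..<m} B \<in> sets (Leb m)"
  unfolding Leb_def by (intro sets_PiM_I_finite) auto

lemma emeasure_Leb_PiE:
  "(\<And>k. k < m \<Longrightarrow> B k \<in> sets borel) \<Longrightarrow> emeasure (Leb m) (PiE {..<m} B) = (\<Prod>k<m. emeasure lborel (B k))"
  unfolding Leb_def by (intro lborel_product.emeasure_PiM) auto

lemma distr_Leb_negv: "distr (Leb m) (Leb m) (negv m) = Leb m"
proof -
  have "distr (Leb m) (Leb m) (negv m) = PiM {..<m} (\<lambda>_. lborel)"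
  proof (rule lborel_product.PiM_eqI)
    fix B assume B: "\<And>i. i \<in> {..<m} \<Longrightarrow> B i \<in> sets (lborel :: real measure)"
    have B': "uminus -` B k \<in> sets borel" if "k < m" for k
    proof -
      have "uminus -` B k \<inter> space borel \<in> sets borel"
        by (rule measurable_sets[of _ borel borel]) (use B[of k] that in simp_all)
      then show ?thesis by simp
    qed
    have "negv m -` PiE {..<m} B \<inter> space (Leb m) = PiE {..<m} (\<lambda>k. uminus -` B k)"
      by (auto simp: negv_def space_Leb PiE_iff extensional_def)
    moreover have "emeasure lborel (uminus -` B k) = emeasure lborel (B k)" if "k < m" for k
    proof -
      have "emeasure lborel (B k) = emeasure (distr lborel borel uminus) (B k)"
        by (simp add: lborel_distr_uminus)
      also have "\<dots> = emeasure lborel (uminus -` B k)"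
        using B[of k] that by (subst emeasure_distr) simp_all
      finally show ?thesis ..
    qed
    ultimately show "emeasure (distr (Leb m) (Leb m) (negv m)) (PiE {..<m} B) = (\<Prod>i\<in>{..<m}. emeasure lborel (B i))"
      using B B' by (simp add: emeasure_distr PiE_sets_Leb emeasure_Leb_PiE)
  qed (auto simp: Leb_def)
  then show ?thesis by (simp add: Leb_def)
qed

text \<open>On the space of \<open>Leb m\<close> the coordinates beyond \<open>m\<close> are the
  constant \<open>undefined\<close>, so the inclusion into all functions is Borel. This allows
  topological arguments on the whole function type, where a supremum of continuous functions has
  open superlevel sets.\<close>

lemma borel_measurable_Leb_of_borel:
  assumes "f \<in> borel_measurable borel"
  shows "f \<in> borel_measurable (Leb m)"
proof -
  have "(\<lambda>x::nat \<Rightarrow> real. x) \<in> borel_measurable (Leb m)"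
  proof (rule measurable_coordinatewise_then_product)
    fix k
    show "(\<lambda>x. x k) \<in> borel_measurable (Leb m)"
    proof (cases "k < m")
      case False
      then have "(\<lambda>x. x k :: real) \<in> borel_measurable (Leb m) \<longleftrightarrow> (\<lambda>x. undefined :: real) \<in> borel_measurable (Leb m)"
        by (intro measurable_cong) (auto simp: space_Leb extensional_def)
      then show ?thesis by simp
    qed measurable
  qed
  from measurable_compose[OF this assms] show ?thesis by simp
qed

lemma nn_integral_exp_neg_square_finite:
  assumes "a > 0"
  shows "(\<integral>\<^sup>+x. ennreal (exp (- (a * x\<^sup>2))) \<partial>lborel) < \<infinity>"
proof -
  define \<sigma> where "\<sigma> = sqrt (1 / (2 * a))"
  have \<sigma>: "\<sigma> > 0" "2 * \<sigma>\<^sup>2 = 1 / a" using assms by (auto simp: \<sigma>_def)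
  have *: "exp (- (a * x\<^sup>2)) = sqrt (2 * pi * \<sigma>\<^sup>2) * normal_density 0 \<sigma> x" for x
    using \<sigma> by (simp add: normal_density_def)
  have "integrable lborel (\<lambda>x. exp (- (a * x\<^sup>2)))"
    unfolding * using \<sigma> by auto
  then show ?thesis by (simp add: integrable_iff_bounded)
qed

lemma nn_integral_Leb_gaussian_finite:
  assumes "a > 0"
  shows "(\<integral>\<^sup>+x. ennreal (exp (- (a * (\<Sum>k<m. (x k)\<^sup>2)))) \<partial>Leb m) < \<infinity>"
proof -
  have "(\<integral>\<^sup>+x. ennreal (exp (- (a * (\<Sum>k<m. (x k)\<^sup>2)))) \<partial>Leb m)
      = (\<integral>\<^sup>+x. (\<Prod>k<m. ennreal (exp (- (a * (x k)\<^sup>2)))) \<partial>PiM {..<m} (\<lambda>_. lborel))"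
    unfolding Leb_def
    by (intro nn_integral_cong) (simp add: prod_ennreal exp_sum sum_distrib_left sum_negf[symmetric])
  also have "\<dots> = (\<Prod>k<m. \<integral>\<^sup>+x. ennreal (exp (- (a * x\<^sup>2))) \<partial>lborel)"
    by (intro lborel_product.product_nn_integral_prod) auto
  also have "\<dots> < \<infinity>"
    using nn_integral_exp_neg_square_finite[OF assms] by (simp add: power_less_top_ennreal)
  finally show ?thesis .
qed

section \<open>Entropy of measures with a density\<close>

lemma enn2ereal_diff_eq_integral:
  assumes "integrable M u"
  shows "enn2ereal (\<integral>\<^sup>+ x. ennreal (u x) \<partial>M) - enn2ereal (\<integral>\<^sup>+ x. ennreal (- u x) \<partial>M) = ereal (\<integral>x. u x \<partial>M)"
proof -
  have "(\<integral>\<^sup>+ x. ennreal (u x) \<partial>M) \<noteq> \<infinity>" "(\<integral>\<^sup>+ x. ennreal (- u x) \<partial>M) \<noteq> \<infinity>"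
    using assms by (auto simp: real_integrable_def)
  then obtain a b where "a \<ge> 0" "b \<ge> 0" "(\<integral>\<^sup>+ x. ennreal (u x) \<partial>M) = ennreal a"
      "(\<integral>\<^sup>+ x. ennreal (- u x) \<partial>M) = ennreal b" "(\<integral>x. u x \<partial>M) = a - b"
    using real_lebesgue_integral_def[OF assms]
    by (cases "\<integral>\<^sup>+ x. ennreal (u x) \<partial>M"; cases "\<integral>\<^sup>+ x. ennreal (- u x) \<partial>M") auto
  then show ?thesis by simp
qed

lemma entropy_h_density:
  assumes [measurable]: "\<rho> \<in> borel_measurable (Leb m)" and "\<And>x. x \<in> space (Leb m) \<Longrightarrow> 0 \<le> \<rho> x"
    and "prob_space (density (Leb m) (\<lambda>x. ennreal (\<rho> x)))"
  shows "entropy_h m (density (Leb m) (\<lambda>x. ennreal (\<rho> x))) =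
     enn2ereal (\<integral>\<^sup>+ x. ennreal (- (\<rho> x * ln (\<rho> x))) \<partial>Leb m)
     - enn2ereal (\<integral>\<^sup>+ x. ennreal (\<rho> x * ln (\<rho> x)) \<partial>Leb m)"
proof -
  interpret sigma_finite_measure "Leb m" by (rule sigma_finite_Leb)
  let ?N = "density (Leb m) (\<lambda>x. ennreal (\<rho> x))"
  have "AE x in Leb m. ennreal (\<rho> x) = RN_deriv (Leb m) ?N x"
    by (rule RN_deriv_unique) auto
  then have *: "AE x in Leb m. enn2real (RN_deriv (Leb m) ?N x) = \<rho> x"
    using AE_space by eventually_elim (metis assms(2) enn2real_ennreal)
  show ?thesis unfolding entropy_h_def Let_def
    by (intro arg_cong2[where f="\<lambda>a b. enn2ereal a - enn2ereal b"] nn_integral_cong_AE)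
       (use * in \<open>eventually_elim, simp\<close>)+
qed

text \<open>Gibbs' inequality, from \<open>ln u \<le> u - 1\<close> with \<open>u = exp (- f) / (Z \<rho>)\<close>; the integrable upper bound
  for \<open>- \<rho> ln \<rho>\<close> also rules out the junk value of \<open>\<infinity> - \<infinity>\<close> in \<^const>\<open>entropy_h\<close>.\<close>

lemma entropy_h_le:
  assumes P: "Pspace m \<mu>" and f: "f \<in> borel_measurable (Leb m)" "integrable \<mu> f"
    and Z: "(\<integral>\<^sup>+x. ennreal (exp (- f x)) \<partial>Leb m) = ennreal Z" "Z > 0"
  shows "entropy_h m \<mu> \<le> ereal ((\<integral>x. f x \<partial>\<mu>) + ln Z)"
proof -
  interpret L: sigma_finite_measure "Leb m" by (rule sigma_finite_Leb)
  interpret prob_space \<mu> using P by (simp add: Pspace_def)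
  have sets: "sets \<mu> = sets (Leb m)" and ac: "absolutely_continuous (Leb m) \<mu>"
    using P by (auto simp: Pspace_def)
  note [measurable] = f(1)
  define \<rho> where "\<rho> = (\<lambda>x. enn2real (RN_deriv (Leb m) \<mu> x))"
  have [measurable]: "\<rho> \<in> borel_measurable (Leb m)" unfolding \<rho>_def by measurable
  have "AE x in Leb m. RN_deriv (Leb m) \<mu> x \<noteq> \<infinity>"
    by (rule L.RN_deriv_finite) (auto simp: ac sets intro: sigma_finite_measure_axioms)
  then have "AE x in Leb m. RN_deriv (Leb m) \<mu> x = ennreal (\<rho> x)"
    by eventually_elim (simp add: \<rho>_def less_top)
  then have mu: "density (Leb m) (\<lambda>x. ennreal (\<rho> x)) = \<mu>"
    using L.density_RN_deriv[OF ac sets] by (subst density_cong[of _ _ "RN_deriv (Leb m) \<mu>"]) auto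
  have nn: "\<rho> x \<ge> 0" for x by (simp add: \<rho>_def)
  \<comment> \<open>The majorant obtained by multiplying \<open>ln u \<le> u - 1\<close> by the
    density. Its last two terms integrate to 1 - 1 = 0, which leaves the right-hand side of the
    claim.\<close>
  define v where "v = (\<lambda>x. (\<rho> x * f x + \<rho> x * ln Z) + exp (- f x) / Z - \<rho> x)"
  have i1: "integrable (Leb m) (\<lambda>x. \<rho> x * f x)"
    using f(2) nn unfolding mu[symmetric] by (subst (asm) integrable_real_density) auto
  have i2: "integrable (Leb m) \<rho>"
  proof -
    have "integrable \<mu> (\<lambda>_. 1::real)" by simp
    then show ?thesis using nn unfolding mu[symmetric] by (subst (asm) integrable_real_density) auto
  qed
  have i3: "integrable (Leb m) (\<lambda>x. exp (- f x))"
    using Z by (simp add: integrable_iff_bounded)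
  have iv: "integrable (Leb m) v" unfolding v_def using i1 i2 i3 by auto
  have "(\<integral>x. f x \<partial>\<mu>) = (\<integral>x. \<rho> x * f x \<partial>Leb m)"
    using nn by (subst mu[symmetric], subst integral_real_density) auto
  moreover have "1 = (\<integral>x. \<rho> x \<partial>Leb m)"
  proof -
    have "1 = (\<integral>x. (1::real) \<partial>\<mu>)" using prob_space by simp
    then show ?thesis using nn by (subst (asm) mu[symmetric], subst (asm) integral_real_density) auto
  qed
  moreover have "(\<integral>x. exp (- f x) \<partial>Leb m) = Z"
    using Z by (subst integral_eq_nn_integral) auto
  ultimately have v: "(\<integral>x. v x \<partial>Leb m) = (\<integral>x. f x \<partial>\<mu>) + ln Z"
    unfolding v_def using i1 i2 i3 Z(2) by simp
  define u where "u = (\<lambda>x. - (\<rho> x * ln (\<rho> x)))"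
  have [measurable]: "u \<in> borel_measurable (Leb m)" unfolding u_def by measurable
  have uv: "u x \<le> v x" for x
  proof (cases "\<rho> x = 0")
    case False
    with nn[of x] have r: "\<rho> x > 0" by simp
    have "ln (exp (- f x) / (Z * \<rho> x)) \<le> exp (- f x) / (Z * \<rho> x) - 1"
      using r Z(2) by (intro ln_le_minus_one) auto
    also have "ln (exp (- f x) / (Z * \<rho> x)) = - f x - ln Z - ln (\<rho> x)"
      using r Z(2) by (simp add: ln_div ln_mult)
    finally have "\<rho> x * (- f x - ln Z - ln (\<rho> x)) \<le> \<rho> x * (exp (- f x) / (Z * \<rho> x) - 1)"
      using r by (intro mult_left_mono) auto
    also have "\<dots> = exp (- f x) / Z - \<rho> x" using r by (simp add: field_simps)
    finally show ?thesis by (simp add: u_def v_def algebra_simps)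
  qed (use Z in \<open>simp add: u_def v_def\<close>)
  have ent: "entropy_h m \<mu> = enn2ereal (\<integral>\<^sup>+ x. ennreal (u x) \<partial>Leb m) - enn2ereal (\<integral>\<^sup>+ x. ennreal (- u x) \<partial>Leb m)"
    unfolding entropy_h_def Let_def u_def \<rho>_def by simp
  have "(\<integral>\<^sup>+ x. ennreal (u x) \<partial>Leb m) \<le> (\<integral>\<^sup>+ x. ennreal (norm (v x)) \<partial>Leb m)"
    using order_trans[OF uv abs_ge_self] by (intro nn_integral_mono ennreal_leI) simp
  also have "\<dots> < \<infinity>" using iv by (simp add: integrable_iff_bounded)
  finally have fin: "(\<integral>\<^sup>+ x. ennreal (u x) \<partial>Leb m) < \<infinity>" .
  show ?thesis
  proof (cases "(\<integral>\<^sup>+ x. ennreal (- u x) \<partial>Leb m) = \<infinity>")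
    case True
    with fin show ?thesis unfolding ent by (cases "\<integral>\<^sup>+ x. ennreal (u x) \<partial>Leb m") auto
  next
    case False
    have iu: "integrable (Leb m) u"
      using fin False by (simp add: real_integrable_def)
    have "entropy_h m \<mu> = ereal (\<integral>x. u x \<partial>Leb m)"
      unfolding ent by (rule enn2ereal_diff_eq_integral[OF iu])
    also have "\<dots> \<le> ereal (\<integral>x. v x \<partial>Leb m)" using iu iv uv by (simp add: integral_mono)
    finally show ?thesis by (simp add: v)
  qed
qed

section \<open>The quadratic form\<close>

definition coords :: "nat \<Rightarrow> (nat \<Rightarrow> nat) \<Rightarrow> (nat \<times> nat) set" where
  "coords n d = Sigma {..<n} (\<lambda>i. {..<d i})"

definition qnorm :: "nat \<Rightarrow> (nat \<Rightarrow> nat) \<Rightarrow> (nat \<Rightarrow> nat \<Rightarrow> nat \<Rightarrow> nat \<Rightarrow> real) \<Rightarrow> real" where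
  "qnorm n d q = (\<Sum>(i, k)\<in>coords n d. \<Sum>(j, l)\<in>coords n d. \<bar>q i k j l\<bar>)"

lemma finite_coords [simp]: "finite (coords n d)"
  by (simp add: coords_def)

lemma sum_coords: "(\<Sum>(i, k)\<in>coords n d. g i k) = (\<Sum>i<n. \<Sum>k<d i. g i k)"
  unfolding coords_def by (subst sum.Sigma) auto

lemma quadform_coords:
  "quadform n d q x = (\<Sum>(i, k)\<in>coords n d. \<Sum>(j, l)\<in>coords n d. q i k j l * (x i k * x j l))"
  unfolding quadform_def sum_coords by (simp add: mult.assoc)

lemma qnorm_nonneg: "0 \<le> qnorm n d q"
  unfolding qnorm_def by (auto intro!: sum_nonneg simp: split_def)

text \<open>The array \<open>g\<close> is arbitrary, not a product, because the same triangle
  inequality serves the form itself, the cross terms along a line and the difference of the form at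
  two points.\<close>

lemma bilinear_bound:
  assumes "\<And>i k j l. i < n \<Longrightarrow> k < d i \<Longrightarrow> j < n \<Longrightarrow> l < d j \<Longrightarrow> \<bar>g i k j l\<bar> \<le> B"
  shows "\<bar>\<Sum>(i, k)\<in>coords n d. \<Sum>(j, l)\<in>coords n d. q i k j l * g i k j l\<bar> \<le> qnorm n d q * B"
proof -
  have "\<bar>\<Sum>(i, k)\<in>coords n d. \<Sum>(j, l)\<in>coords n d. q i k j l * g i k j l\<bar>
      \<le> (\<Sum>(i, k)\<in>coords n d. \<Sum>(j, l)\<in>coords n d. \<bar>q i k j l * g i k j l\<bar>)"
    by (rule order_trans[OF sum_abs]) (auto intro!: sum_mono order_trans[OF sum_abs] simp: split_def)
  also have "\<dots> \<le> (\<Sum>(i, k)\<in>coords n d. \<Sum>(j, l)\<in>coords n d. \<bar>q i k j l\<bar> * B)"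
    using assms by (auto intro!: sum_mono mult_left_mono simp: abs_mult coords_def)
  also have "\<dots> = qnorm n d q * B"
    by (simp add: qnorm_def sum_distrib_right split_def)
  finally show ?thesis .
qed

lemma quadform_bound:
  assumes "\<And>i k. i < n \<Longrightarrow> k < d i \<Longrightarrow> \<bar>x i k\<bar> \<le> R"
  shows "\<bar>quadform n d q x\<bar> \<le> qnorm n d q * R\<^sup>2"
  unfolding quadform_coords
proof (rule bilinear_bound)
  fix i k j l assume "i < n" "k < d i" "j < n" "l < d j"
  then show "\<bar>x i k * x j l\<bar> \<le> R\<^sup>2"
    using assms[of i k] assms[of j l] unfolding abs_mult power2_eq_square by (intro mult_mono) auto
qed

lemma quadform_cong:
  assumes "\<And>i k. i < n \<Longrightarrow> k < d i \<Longrightarrow> x i k = y i k"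
  shows "quadform n d q x = quadform n d q y"
  unfolding quadform_def using assms by (auto intro!: sum.cong)

lemma quadform_uminus: "quadform n d q (\<lambda>i k. - x i k) = quadform n d q x"
  unfolding quadform_def by simp

text \<open>The convexity defect along a segment is the form of the difference of the endpoints. If
  these differ only in block \<open>i\<close>, its sign is decided by the diagonal block
  \<open>i\<close>.\<close>

lemma quadform_cvx_identity:
  "(1 - t) * quadform n d q u + t * quadform n d q v - quadform n d q (\<lambda>i k. (1 - t) * u i k + t * v i k)
    = t * (1 - t) * quadform n d q (\<lambda>i k. u i k - v i k)"
  unfolding quadform_coords sum_distrib_left sum.distrib[symmetric] sum_subtractf[symmetric]
  by (intro sum.cong refl)
     (auto simp: split_def sum_distrib_left sum.distrib[symmetric] sum_subtractf[symmetric] algebra_simps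
       intro!: sum.cong)

lemma Emeas_proj_measurable [measurable]: "i < n \<Longrightarrow> (\<lambda>x. x i) \<in> measurable (Emeas n d) (Leb (d i))"
  unfolding Emeas_def by (rule measurable_component_singleton) simp

lemma Emeas_component_measurable [measurable]:
  "i < n \<Longrightarrow> k < d i \<Longrightarrow> (\<lambda>x. x i k) \<in> borel_measurable (Emeas n d)"
  by (rule measurable_compose[OF Emeas_proj_measurable Leb_component_measurable])

lemma quadform_measurable [measurable]: "quadform n d q \<in> borel_measurable (Emeas n d)"
  unfolding quadform_def[abs_def] by (intro borel_measurable_sum) auto

lemma space_Emeas: "space (Emeas n d) = PiE {..<n} (\<lambda>i. space (Leb (d i)))"
  by (simp add: Emeas_def space_PiM)

section \<open>Gibbs measures with bounded log-density\<close>

definition cube :: "nat \<Rightarrow> real \<Rightarrow> (nat \<Rightarrow> real) set" where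
  "cube m R = PiE {..<m} (\<lambda>_. {- R..R})"

lemma cube_sets [measurable]: "cube m R \<in> sets (Leb m)"
  unfolding cube_def by (rule PiE_sets_Leb) simp

lemma emeasure_cube_finite: "emeasure (Leb m) (cube m R) < \<infinity>"
  unfolding cube_def by (subst emeasure_Leb_PiE) (auto simp: power_less_top_ennreal emeasure_lborel_Icc_eq)

lemma cubeD: "x \<in> cube m R \<Longrightarrow> k < m \<Longrightarrow> \<bar>x k\<bar> \<le> R"
  by (force simp: cube_def PiE_iff abs_le_iff)

lemma cube_space: "x \<in> cube m R \<Longrightarrow> x \<in> space (Leb m)"
  by (auto simp: cube_def PiE_iff space_Leb)

text \<open>The pair of \<open>A\<close> and \<open>\<phi>\<close> stands for the function that is
  \<open>\<phi>\<close> on \<open>A\<close> and infinite elsewhere; in this way the truncated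
  functions of condition (A) are handled with real values. The same reading applies to
  \<open>convex_pair\<close> and \<open>partition_fun\<close>.\<close>

definition even_bounded :: "nat \<Rightarrow> real \<Rightarrow> real \<Rightarrow> (nat \<Rightarrow> real) set \<Rightarrow> ((nat \<Rightarrow> real) \<Rightarrow> real) \<Rightarrow> bool" where
  "even_bounded m R M A \<phi> \<longleftrightarrow> A \<in> sets (Leb m) \<and> A \<subseteq> cube m R \<and> \<phi> \<in> borel_measurable (Leb m)
     \<and> (\<forall>x\<in>A. \<bar>\<phi> x\<bar> \<le> M \<and> negv m x \<in> A \<and> \<phi> (negv m x) = \<phi> x)"

definition convex_pair :: "nat \<Rightarrow> (nat \<Rightarrow> real) set \<Rightarrow> ((nat \<Rightarrow> real) \<Rightarrow> real) \<Rightarrow> bool" where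
  "convex_pair m A \<phi> \<longleftrightarrow> (\<forall>x\<in>A. \<forall>y\<in>A. \<forall>t\<in>{0<..<1}.
     cvx m t x y \<in> A \<and> \<phi> (cvx m t x y) \<le> (1 - t) * \<phi> x + t * \<phi> y)"

definition partition_fun :: "nat \<Rightarrow> (nat \<Rightarrow> real) set \<Rightarrow> ((nat \<Rightarrow> real) \<Rightarrow> real) \<Rightarrow> real" where
  "partition_fun m A \<phi> = enn2real (\<integral>\<^sup>+x. ennreal (indicator A x * exp (- \<phi> x)) \<partial>Leb m)"

lemma nn_integral_partition_fun:
  assumes "even_bounded m R M A \<phi>"
  shows "(\<integral>\<^sup>+x. ennreal (indicator A x * exp (- \<phi> x)) \<partial>Leb m) = ennreal (partition_fun m A \<phi>)"
proof -
  have A: "A \<subseteq> cube m R" "\<And>x. x \<in> A \<Longrightarrow> \<bar>\<phi> x\<bar> \<le> M"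
    using assms by (auto simp: even_bounded_def)
  have "(\<integral>\<^sup>+x. ennreal (indicator A x * exp (- \<phi> x)) \<partial>Leb m) \<le> (\<integral>\<^sup>+x. ennreal (exp M) * indicator (cube m R) x \<partial>Leb m)"
    using A by (intro nn_integral_mono) (force simp: indicator_def intro!: ennreal_leI)
  also have "\<dots> = ennreal (exp M) * emeasure (Leb m) (cube m R)"
    by (simp add: nn_integral_cmult_indicator)
  also have "\<dots> < \<infinity>" using emeasure_cube_finite[of m R] by (simp add: ennreal_mult_less_top)
  finally show ?thesis by (simp add: partition_fun_def)
qed

lemma partition_fun_pos:
  assumes "even_bounded m R M A \<phi>" and pos: "emeasure (Leb m) A > 0"
  shows "partition_fun m A \<phi> > 0"
proof -
  have A: "A \<in> sets (Leb m)" "\<And>x. x \<in> A \<Longrightarrow> \<bar>\<phi> x\<bar> \<le> M"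
    using assms by (auto simp: even_bounded_def)
  have "0 < ennreal (exp (- M)) * emeasure (Leb m) A" using pos by (simp add: ennreal_zero_less_mult_iff)
  also have "\<dots> = (\<integral>\<^sup>+x. ennreal (exp (- M)) * indicator A x \<partial>Leb m)"
    using A by (simp add: nn_integral_cmult_indicator)
  also have "\<dots> \<le> (\<integral>\<^sup>+x. ennreal (indicator A x * exp (- \<phi> x)) \<partial>Leb m)"
    using A by (intro nn_integral_mono) (force simp: indicator_def intro!: ennreal_leI)
  also have "\<dots> = ennreal (partition_fun m A \<phi>)" by (rule nn_integral_partition_fun[OF assms(1)])
  finally show ?thesis by simp
qed

text \<open>The density is exp (- \<phi>) / Z on \<open>A\<close>: symmetric since the pair is even,
  log-concave since it is convex. Bounded support and a bounded exponent give second moments and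
  integrability at once. The entropy formula is the equality case of Gibbs' inequality, from
  \<open>- \<rho> ln \<rho> = \<rho> (\<phi> + ln Z)\<close>, which holds off \<open>A\<close> as
  well because both sides vanish there.\<close>

lemma gibbs_measure:
  assumes eb: "even_bounded m R M A \<phi>" and cv: "convex_pair m A \<phi>" and pos: "emeasure (Leb m) A > 0"
  obtains \<mu> where "Pspace m \<mu>" "symmetric_measure m \<mu>" "log_concave_measure m \<mu>" "AE x in \<mu>. x \<in> A"
    "integrable \<mu> \<phi>" "entropy_h m \<mu> = ereal ((\<integral>x. \<phi> x \<partial>\<mu>) + ln (partition_fun m A \<phi>))"
proof -
  define Z where "Z = partition_fun m A \<phi>"
  have Z: "Z > 0" unfolding Z_def by (rule partition_fun_pos[OF eb pos])
  have [measurable]: "A \<in> sets (Leb m)" "\<phi> \<in> borel_measurable (Leb m)"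
    and A: "\<And>x. x \<in> A \<Longrightarrow> \<bar>\<phi> x\<bar> \<le> M" "\<And>x. x \<in> A \<Longrightarrow> negv m x \<in> A" "\<And>x. x \<in> A \<Longrightarrow> \<phi> (negv m x) = \<phi> x"
      "A \<subseteq> cube m R"
    using eb by (auto simp: even_bounded_def)
  define \<rho> where "\<rho> = (\<lambda>x. indicator A x * exp (- \<phi> x) / Z)"
  have [measurable]: "\<rho> \<in> borel_measurable (Leb m)" unfolding \<rho>_def by measurable
  have \<rho>0: "\<rho> x \<ge> 0" for x using Z by (simp add: \<rho>_def)
  define \<mu> where "\<mu> = density (Leb m) (\<lambda>x. ennreal (\<rho> x))"
  have sets: "sets \<mu> = sets (Leb m)" and space: "space \<mu> = space (Leb m)" by (auto simp: \<mu>_def)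
  have "(\<integral>\<^sup>+x. ennreal (\<rho> x) \<partial>Leb m) = (\<integral>\<^sup>+x. ennreal (1 / Z) * ennreal (indicator A x * exp (- \<phi> x)) \<partial>Leb m)"
    unfolding \<rho>_def using Z by (intro nn_integral_cong) (simp add: ennreal_mult[symmetric])
  also have "\<dots> = ennreal (1 / Z) * ennreal Z"
    by (subst nn_integral_cmult) (auto simp: nn_integral_partition_fun[OF eb] Z_def)
  also have "\<dots> = 1" using Z by (simp add: ennreal_mult[symmetric])
  finally have int1: "(\<integral>\<^sup>+x. ennreal (\<rho> x) \<partial>Leb m) = 1" .
  then have ps: "prob_space \<mu>"
    by (intro prob_spaceI) (simp add: \<mu>_def emeasure_density cong: nn_integral_cong)
  interpret prob_space \<mu> by fact
  have AEA: "AE x in \<mu>. x \<in> A"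
    unfolding \<mu>_def by (subst AE_density) (auto simp: \<rho>_def indicator_def)
  have "(\<integral>\<^sup>+ x. ennreal (\<Sum>k<m. (x k)\<^sup>2) \<partial>\<mu>) \<le> (\<integral>\<^sup>+ x. ennreal (\<Sum>k<m. R\<^sup>2) \<partial>\<mu>)"
  proof (rule nn_integral_mono_AE, use AEA in eventually_elim)
    fix x assume "x \<in> A"
    with A have "\<bar>x k\<bar> \<le> R" if "k < m" for k using that cubeD by blast
    then show "ennreal (\<Sum>k<m. (x k)\<^sup>2) \<le> ennreal (\<Sum>k<m. R\<^sup>2)"
      by (intro ennreal_leI sum_mono) (metis lessThan_iff abs_le_square_iff abs_ge_self order_trans)
  qed
  also have "\<dots> < \<infinity>" by (simp add: emeasure_space_1)
  finally have P: "Pspace m \<mu>" unfolding Pspace_def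
    using ps by (auto simp: sets \<mu>_def intro!: absolutely_continuousI_density)
  have \<rho>neg: "\<rho> (negv m x) = \<rho> x" if "x \<in> space (Leb m)" for x
    using A(2,3)[of x] A(2)[of "negv m x"] negv_negv[OF that] by (auto simp: \<rho>_def indicator_def)
  have S: "symmetric_measure m \<mu>" unfolding symmetric_measure_def
  proof
    fix B assume "B \<in> sets \<mu>"
    then have [measurable]: "B \<in> sets (Leb m)" by (simp add: sets)
    have "negv m -` B \<inter> space \<mu> \<in> sets \<mu>"
      unfolding space sets by (rule measurable_sets[OF negv_measurable]) simp
    then have "emeasure \<mu> (negv m -` B \<inter> space \<mu>)
        = (\<integral>\<^sup>+x. ennreal (\<rho> x) * indicator (negv m -` B \<inter> space \<mu>) x \<partial>Leb m)"
      unfolding \<mu>_def by (intro emeasure_density) auto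
    also have "\<dots> = (\<integral>\<^sup>+x. ennreal (\<rho> (negv m x)) * indicator B (negv m x) \<partial>Leb m)"
      by (intro nn_integral_cong) (auto simp: \<rho>neg space indicator_def)
    also have "\<dots> = (\<integral>\<^sup>+x. ennreal (\<rho> x) * indicator B x \<partial>distr (Leb m) (Leb m) (negv m))"
      by (subst nn_integral_distr) auto
    also have "\<dots> = emeasure \<mu> B"
      unfolding distr_Leb_negv \<mu>_def by (simp add: emeasure_density)
    finally show "emeasure \<mu> (negv m -` B \<inter> space \<mu>) = emeasure \<mu> B" .
  qed
  have \<rho>A: "\<rho> x = exp (- \<phi> x - ln Z)" if "x \<in> A" for x
    using that Z by (simp add: \<rho>_def exp_diff)
  have LC: "log_concave_measure m \<mu>" unfolding log_concave_measure_def
  proof (intro exI[of _ \<rho>] conjI ballI)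
    fix x y and t :: real assume xy: "x \<in> space (Leb m)" "y \<in> space (Leb m)" and t: "t \<in> {0<..<1}"
    show "\<rho> x powr (1 - t) * \<rho> y powr t \<le> \<rho> (cvx m t x y)"
    proof (cases "x \<in> A \<and> y \<in> A")
      case True
      with cv t have c: "cvx m t x y \<in> A" "\<phi> (cvx m t x y) \<le> (1 - t) * \<phi> x + t * \<phi> y"
        by (auto simp: convex_pair_def)
      have "\<rho> x powr (1 - t) * \<rho> y powr t = exp ((1 - t) * (- \<phi> x - ln Z) + t * (- \<phi> y - ln Z))"
        using True by (simp add: \<rho>A powr_def exp_add)
      also have "\<dots> \<le> exp (- \<phi> (cvx m t x y) - ln Z)"
        using c(2) by (simp add: algebra_simps)
      finally show ?thesis using c by (simp add: \<rho>A)
    next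
      case False
      then have "\<rho> x = 0 \<or> \<rho> y = 0" by (auto simp: \<rho>_def)
      then show ?thesis using \<rho>0 by auto
    qed
  qed (use \<rho>0 in \<open>auto simp: \<mu>_def\<close>)
  have i\<phi>: "integrable \<mu> \<phi>"
    using AEA A(1) by (intro integrable_const_bound[of _ M]) (auto simp: \<mu>_def elim!: eventually_mono)
  have u: "- (\<rho> x * ln (\<rho> x)) = \<rho> x * (\<phi> x + ln Z)" for x
  proof (cases "x \<in> A")
    case True
    then show ?thesis by (simp add: \<rho>A algebra_simps)
  qed (simp add: \<rho>_def)
  have i1: "integrable \<mu> (\<lambda>x. \<phi> x + ln Z)" using i\<phi> by simp
  then have iu: "integrable (Leb m) (\<lambda>x. - (\<rho> x * ln (\<rho> x)))"
    unfolding u \<mu>_def using \<rho>0 by (subst (asm) integrable_real_density) auto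
  have "entropy_h m \<mu> = ereal (\<integral>x. - (\<rho> x * ln (\<rho> x)) \<partial>Leb m)"
    unfolding enn2ereal_diff_eq_integral[OF iu, symmetric] minus_minus unfolding \<mu>_def
    using ps \<rho>0 by (intro entropy_h_density) (auto simp: \<mu>_def)
  also have "(\<integral>x. - (\<rho> x * ln (\<rho> x)) \<partial>Leb m) = (\<integral>x. \<phi> x + ln Z \<partial>\<mu>)"
    unfolding u \<mu>_def using \<rho>0 by (subst integral_real_density) auto
  also have "\<dots> = (\<integral>x. \<phi> x \<partial>\<mu>) + ln Z" using i\<phi> by (simp add: prob_space)
  finally show thesis using that P S LC AEA i\<phi> by (simp add: Z_def)
qed

text \<open>Test the inequality on the Gibbs measures. Every coupling is carried by the product of
  the sets \<open>A i\<close>, so integrating \<open>dom\<close> bounds the transport term by the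
  sum of \<open>c i\<close> times the integral of \<open>\<phi> i\<close>. The same sum occurs in
  the entropies and cancels.\<close>

lemma condB_logconcave_imp_bound:
  assumes B: "condB_logconcave n d c q (ereal D)"
    and eb: "\<And>i. i < n \<Longrightarrow> even_bounded (d i) R M (A i) (\<phi> i)"
    and cv: "\<And>i. i < n \<Longrightarrow> convex_pair (d i) (A i) (\<phi> i)"
    and pos: "\<And>i. i < n \<Longrightarrow> emeasure (Leb (d i)) (A i) > 0"
    and dom: "\<And>x. x \<in> PiE {..<n} A \<Longrightarrow> quadform n d q x \<le> (\<Sum>i<n. c i * \<phi> i (x i))"
  shows "(\<Sum>i<n. c i * ln (partition_fun (d i) (A i) (\<phi> i))) \<le> D"
proof -
  define Q where "Q i \<mu> \<longleftrightarrow> Pspace (d i) \<mu> \<and> symmetric_measure (d i) \<mu> \<and> log_concave_measure (d i) \<mu>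
     \<and> (AE x in \<mu>. x \<in> A i) \<and> integrable \<mu> (\<phi> i)
     \<and> entropy_h (d i) \<mu> = ereal ((\<integral>x. \<phi> i x \<partial>\<mu>) + ln (partition_fun (d i) (A i) (\<phi> i)))" for i \<mu>
  have "\<forall>i\<in>{..<n}. \<exists>\<mu>. Q i \<mu>"
  proof
    fix i assume "i \<in> {..<n}"
    then have i: "i < n" by simp
    show "\<exists>\<mu>. Q i \<mu>" by (rule gibbs_measure[OF eb[OF i] cv[OF i] pos[OF i]]) (auto simp: Q_def)
  qed
  from bchoice[OF this] obtain \<mu>s where "\<forall>i\<in>{..<n}. Q i (\<mu>s i)" ..
  then have \<mu>s: "\<And>i. i < n \<Longrightarrow> Pspace (d i) (\<mu>s i)"
      "\<And>i. i < n \<Longrightarrow> symmetric_measure (d i) (\<mu>s i)"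
      "\<And>i. i < n \<Longrightarrow> log_concave_measure (d i) (\<mu>s i)"
      "\<And>i. i < n \<Longrightarrow> AE x in \<mu>s i. x \<in> A i"
      "\<And>i. i < n \<Longrightarrow> integrable (\<mu>s i) (\<phi> i)"
      "\<And>i. i < n \<Longrightarrow> entropy_h (d i) (\<mu>s i) = ereal ((\<integral>x. \<phi> i x \<partial>\<mu>s i) + ln (partition_fun (d i) (A i) (\<phi> i)))"
    by (simp_all add: Q_def)
  define L where "L = (\<Sum>i<n. c i * (\<integral>x. \<phi> i x \<partial>\<mu>s i))"
  have "(SUP \<mu>\<in>couplings n d \<mu>s. ereal (\<integral>x. quadform n d q x \<partial>\<mu>)) \<le> ereal L"
  proof (rule SUP_least)
    fix \<mu> assume "\<mu> \<in> couplings n d \<mu>s"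
    then have sets[measurable_cong]: "sets \<mu> = sets (Emeas n d)" and ps: "prob_space \<mu>"
      and marg: "\<And>i. i < n \<Longrightarrow> distr \<mu> (Leb (d i)) (\<lambda>x. x i) = \<mu>s i"
      by (auto simp: couplings_def)
    interpret prob_space \<mu> by fact
    have proj: "(\<lambda>x. x i) \<in> measurable \<mu> (Leb (d i))" if "i < n" for i using that by measurable
    have "AE x in \<mu>. x i \<in> A i" if "i < n" for i
      using \<mu>s(4)[OF that] unfolding marg[OF that, symmetric] by (rule AE_distrD[OF proj[OF that]])
    then have "AE x in \<mu>. \<forall>i\<in>{..<n}. x i \<in> A i" by (subst AE_finite_all) auto
    then have AEA: "AE x in \<mu>. x \<in> PiE {..<n} A"
      using AE_space by eventually_elim (auto simp: sets_eq_imp_space_eq[OF sets] space_Emeas PiE_iff)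
    have iq: "integrable \<mu> (quadform n d q)"
    proof (rule integrable_const_bound[of _ "qnorm n d q * R\<^sup>2"])
      show "AE x in \<mu>. norm (quadform n d q x) \<le> qnorm n d q * R\<^sup>2"
        using AEA
      proof eventually_elim
        fix x assume x: "x \<in> PiE {..<n} A"
        have "x i \<in> cube (d i) R" if "i < n" for i
          using x eb[OF that] that by (auto simp: even_bounded_def)
        then show "norm (quadform n d q x) \<le> qnorm n d q * R\<^sup>2"
          by (auto intro!: quadform_bound intro: cubeD)
      qed
    qed measurable
    have i\<phi>: "integrable \<mu> (\<lambda>x. \<phi> i (x i))" "(\<integral>x. \<phi> i (x i) \<partial>\<mu>) = (\<integral>x. \<phi> i x \<partial>\<mu>s i)" if "i < n" for i
    proof -
      have [measurable]: "\<phi> i \<in> borel_measurable (Leb (d i))" using eb[OF that] by (simp add: even_bounded_def)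
      show "integrable \<mu> (\<lambda>x. \<phi> i (x i))"
        using \<mu>s(5)[OF that] unfolding marg[OF that, symmetric] by (subst (asm) integrable_distr_eq[OF proj[OF that]]) auto
      show "(\<integral>x. \<phi> i (x i) \<partial>\<mu>) = (\<integral>x. \<phi> i x \<partial>\<mu>s i)"
        unfolding marg[OF that, symmetric] by (subst integral_distr[OF proj[OF that]]) auto
    qed
    have "(\<integral>x. quadform n d q x \<partial>\<mu>) \<le> (\<integral>x. (\<Sum>i<n. c i * \<phi> i (x i)) \<partial>\<mu>)"
      using AEA dom i\<phi> by (intro integral_mono_AE iq) (auto elim: eventually_mono)
    also have "\<dots> = L" unfolding L_def using i\<phi> by (subst Bochner_Integration.integral_sum) auto
    finally show "ereal (\<integral>x. quadform n d q x \<partial>\<mu>) \<le> ereal L" by simp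
  qed
  moreover have "(\<Sum>i<n. ereal (c i) * entropy_h (d i) (\<mu>s i))
       \<le> (SUP \<mu>\<in>couplings n d \<mu>s. ereal (\<integral>x. quadform n d q x \<partial>\<mu>)) + ereal D"
    using B \<mu>s(1-3) unfolding condB_logconcave_def condB_gen_def by auto
  ultimately have "(\<Sum>i<n. ereal (c i) * entropy_h (d i) (\<mu>s i)) \<le> ereal L + ereal D"
    by (meson add_right_mono order_trans)
  also have "(\<Sum>i<n. ereal (c i) * entropy_h (d i) (\<mu>s i))
      = ereal (L + (\<Sum>i<n. c i * ln (partition_fun (d i) (A i) (\<phi> i))))"
    by (simp add: \<mu>s(6) L_def sum.distrib[symmetric] algebra_simps flip: sum_ereal)
  finally show ?thesis by simp
qed

section \<open>Convexification of dominating functions\<close>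

lemma even_bounded_mono: "even_bounded m R M A \<phi> \<Longrightarrow> M \<le> M' \<Longrightarrow> even_bounded m R M' A \<phi>"
  by (force simp: even_bounded_def)

lemma negv_cube: "x \<in> cube m R \<Longrightarrow> negv m x \<in> cube m R"
  by (force simp: cube_def negv_def PiE_iff)

lemma cvx_cube:
  assumes "x \<in> cube m R" "y \<in> cube m R" "t \<in> {0<..<1}"
  shows "cvx m t x y \<in> cube m R"
proof -
  have "(1 - t) * x k + t * y k \<in> {- R..R}" if "k < m" for k
  proof -
    have "x k \<in> {- R..R}" "y k \<in> {- R..R}" using assms(1,2) that by (auto simp: cube_def PiE_iff)
    moreover have "convex {- R..R}" by (rule convex_real_interval)
    ultimately show ?thesis using assms(3) by (auto simp: convex_alt)
  qed
  then show ?thesis by (auto simp: cube_def cvx_def)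
qed

text \<open>\<open>g\<close> is the c-transform of the other potentials: the least function of block
  \<open>i\<close> that still dominates the form together with them. Being least puts it below
  \<open>\<phi> i\<close> on \<open>A i\<close>; it is defined beyond \<open>A i\<close>, so the
  domain can grow to the whole cube, which is convex and symmetric.\<close>

lemma convexify_coordinate:
  fixes c :: "nat \<Rightarrow> real"
  assumes i: "i < n" and ci: "c i > 0"
    and eb: "\<And>j. j < n \<Longrightarrow> even_bounded (d j) R M (A j) (\<phi> j)"
    and ne: "\<And>j. j < n \<Longrightarrow> A j \<noteq> {}"
    and dom: "\<And>x. x \<in> PiE {..<n} A \<Longrightarrow> quadform n d q x \<le> (\<Sum>j<n. c j * \<phi> j (x j))"
    and psd: "\<And>z. 0 \<le> quadform n d q (\<lambda>j k. if j = i then z k else 0)"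
  obtains g M' where "even_bounded (d i) R M' (cube (d i) R) g" "convex_pair (d i) (cube (d i) R) g"
    "\<And>x. x \<in> PiE {..<n} (A(i := cube (d i) R)) \<Longrightarrow> quadform n d q x \<le> (\<Sum>j<n. c j * (\<phi>(i := g)) j (x j))"
    "\<And>x. x \<in> A i \<Longrightarrow> g x \<le> \<phi> i x"
proof -
  define S where "S = PiE {..<n} A"
  have S_ne: "S \<noteq> {}" using ne by (auto simp: S_def PiE_eq_empty_iff)
  define rest where "rest y = (\<Sum>j\<in>{..<n} - {i}. c j * \<phi> j (y j))" for y :: "nat \<Rightarrow> nat \<Rightarrow> real"
  define h where "h y x = (quadform n d q (y(i := x)) - rest y) / c i" for y x
  define g where "g x = (SUP y\<in>S. h y x)" for x
  define C where "C = (\<Sum>j\<in>{..<n} - {i}. \<bar>c j\<bar> * M)"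
  have split: "(\<Sum>j<n. c j * f j) = c i * f i + (\<Sum>j\<in>{..<n} - {i}. c j * f j)" for f
    using i by (intro sum.remove) auto
  have SD: "y j \<in> A j" "y j \<in> cube (d j) R" "\<bar>\<phi> j (y j)\<bar> \<le> M" if "y \<in> S" "j < n" for y j
    using that eb[OF that(2)] by (auto simp: S_def even_bounded_def)
  have rest: "\<bar>rest y\<bar> \<le> C" if "y \<in> S" for y
    unfolding rest_def C_def using SD[OF that]
    by (intro order_trans[OF sum_abs] sum_mono) (auto simp: abs_mult intro!: mult_left_mono)
  have hb: "\<bar>h y x\<bar> \<le> (qnorm n d q * r\<^sup>2 + C) / c i"
    if y: "y \<in> S" and r: "R \<le> r" "\<And>k. k < d i \<Longrightarrow> \<bar>x k\<bar> \<le> r" for x y r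
  proof -
    have "\<bar>quadform n d q (y(i := x))\<bar> \<le> qnorm n d q * r\<^sup>2"
    proof (rule quadform_bound)
      fix j k assume jk: "j < n" "k < d j"
      then have "\<bar>y j k\<bar> \<le> R" using cubeD[OF SD(2)[OF y]] by simp
      then show "\<bar>(y(i := x)) j k\<bar> \<le> r" using r jk by auto
    qed
    then show ?thesis using rest[OF y] ci by (simp add: h_def divide_right_mono)
  qed
  \<comment> \<open>A real supremum means something only for bounded families, and measurability,
    evenness and convexity of \<open>g\<close> are argued at every \<open>x\<close>, also outside
    the cube. Hence a radius depending on \<open>x\<close>.\<close>
  have bdd: "bdd_above ((\<lambda>y. h y x) ` S)" for x
  proof (rule bdd_aboveI2)
    fix y assume y: "y \<in> S"
    have "\<bar>h y x\<bar> \<le> (qnorm n d q * (\<bar>R\<bar> + (\<Sum>k<d i. \<bar>x k\<bar>))\<^sup>2 + C) / c i"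
    proof (rule hb[OF y])
      show "\<bar>x k\<bar> \<le> \<bar>R\<bar> + (\<Sum>k<d i. \<bar>x k\<bar>)" if "k < d i" for k
        using member_le_sum[of k "{..<d i}" "\<lambda>k. \<bar>x k\<bar>"] that by simp
      show "R \<le> \<bar>R\<bar> + (\<Sum>k<d i. \<bar>x k\<bar>)"
        using sum_nonneg[of "{..<d i}" "\<lambda>k. \<bar>x k\<bar>"] by linarith
    qed
    then show "h y x \<le> (qnorm n d q * (\<bar>R\<bar> + (\<Sum>k<d i. \<bar>x k\<bar>))\<^sup>2 + C) / c i" by simp
  qed
  have upper: "h y x \<le> g x" if "y \<in> S" for x y
    unfolding g_def by (rule cSUP_upper[OF that bdd])
  have least: "g x \<le> b" if "\<And>y. y \<in> S \<Longrightarrow> h y x \<le> b" for x b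
    unfolding g_def using S_ne that by (rule cSUP_least)
  have cont: "continuous_on UNIV (h y)" for y
  proof -
    have "continuous_on UNIV (\<lambda>x. (y(i := x)) j k)" for j k
      by (cases "j = i") (auto intro: continuous_on_product_coordinates)
    then show ?thesis
      unfolding h_def[abs_def] quadform_def
      by (intro continuous_on_divide continuous_on_diff continuous_on_sum continuous_on_mult
          continuous_on_const) (use ci in auto)
  qed
  \<comment> \<open>The index set \<open>S\<close> is in general uncountable, so countable suprema
    do not suffice; instead \<open>g\<close> is lower semicontinuous and its superlevel sets are
    unions of open sets.\<close>
  have gm: "g \<in> borel_measurable (Leb (d i))"
  proof (rule borel_measurable_Leb_of_borel, subst borel_measurable_iff_greater, rule allI)
    fix a
    have "{w \<in> space borel. a < g w} = (\<Union>y\<in>S. h y -` {a<..})"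
      unfolding g_def using less_cSUP_iff[OF S_ne bdd] by auto
    also have "open \<dots>"
      using cont open_vimage[OF open_greaterThan] by auto
    finally show "{w \<in> space borel. a < g w} \<in> sets borel" by auto
  qed
  define M' where "M' = (qnorm n d q * R\<^sup>2 + C) / c i"
  have hM: "\<bar>h y x\<bar> \<le> M'" if "x \<in> cube (d i) R" "y \<in> S" for x y
    unfolding M'_def using that by (intro hb) (auto intro: cubeD)
  have gM: "\<bar>g x\<bar> \<le> M'" if "x \<in> cube (d i) R" for x
  proof -
    obtain y where "y \<in> S" using S_ne by auto
    then have "- M' \<le> g x" using upper[of y x] hM[OF that, of y] by linarith
    moreover have "g x \<le> M'" using hM[OF that] by (intro least) (auto simp: abs_le_iff)
    ultimately show ?thesis by simp
  qed
  \<comment> \<open>Negating all blocks leaves the form and \<open>rest\<close> unchanged and maps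
    \<open>S\<close> to itself. One inequality at all points is enough, since \<open>negv\<close> is
    an involution on the space.\<close>
  have le_neg: "g (negv (d i) x) \<le> g x" for x
  proof (rule least)
    fix y assume y: "y \<in> S"
    define y' where "y' = restrict (\<lambda>j. negv (d j) (y j)) {..<n}"
    have neg: "negv (d j) (y j) \<in> A j" "\<phi> j (negv (d j) (y j)) = \<phi> j (y j)" if "j < n" for j
      using SD(1)[OF y that] eb[OF that] by (auto simp: even_bounded_def)
    have y': "y' \<in> S" using neg by (auto simp: y'_def S_def)
    have "quadform n d q (y(i := negv (d i) x)) = quadform n d q (\<lambda>j k. - (y'(i := x)) j k)"
      by (rule quadform_cong) (auto simp: y'_def negv_def)
    also have "\<dots> = quadform n d q (y'(i := x))" by (rule quadform_uminus)
    moreover have "rest y = rest y'"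
      unfolding rest_def y'_def using neg by (intro sum.cong) auto
    ultimately have "h y (negv (d i) x) = h y' x" by (simp add: h_def)
    then show "h y (negv (d i) x) \<le> g x" using upper[OF y'] by simp
  qed
  have even: "g (negv (d i) x) = g x" if "x \<in> space (Leb (d i))" for x
    using le_neg[of x] le_neg[of "negv (d i) x"] negv_negv[OF that] by simp
  have conv: "g (cvx (d i) t x x') \<le> (1 - t) * g x + t * g x'" if t: "t \<in> {0<..<1}" for t x x'
  proof (rule least)
    fix y assume y: "y \<in> S"
    let ?u = "y(i := x)" and ?v = "y(i := x')"
    have "quadform n d q (y(i := cvx (d i) t x x')) = quadform n d q (\<lambda>j k. (1 - t) * ?u j k + t * ?v j k)"
      by (rule quadform_cong) (auto simp: cvx_def algebra_simps)
    also have "\<dots> = (1 - t) * quadform n d q ?u + t * quadform n d q ?v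
        - t * (1 - t) * quadform n d q (\<lambda>j k. ?u j k - ?v j k)"
      using quadform_cvx_identity[of t n d q ?u ?v] by simp
    also have "\<dots> \<le> (1 - t) * quadform n d q ?u + t * quadform n d q ?v"
    proof -
      have "quadform n d q (\<lambda>j k. ?u j k - ?v j k) = quadform n d q (\<lambda>j k. if j = i then x k - x' k else 0)"
        by (rule quadform_cong) auto
      then show ?thesis using psd[of "\<lambda>k. x k - x' k"] t by simp
    qed
    finally have "quadform n d q (y(i := cvx (d i) t x x')) \<le> (1 - t) * quadform n d q ?u + t * quadform n d q ?v" .
    moreover have ch: "c i * h y w = quadform n d q (y(i := w)) - rest y" for w using ci by (simp add: h_def)
    ultimately have "c i * h y (cvx (d i) t x x') \<le> (1 - t) * (c i * h y x) + t * (c i * h y x')"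
      unfolding ch by (simp add: algebra_simps)
    then have "c i * h y (cvx (d i) t x x') \<le> c i * ((1 - t) * h y x + t * h y x')"
      by (simp add: algebra_simps)
    then have "h y (cvx (d i) t x x') \<le> (1 - t) * h y x + t * h y x'" using ci by simp
    also have "\<dots> \<le> (1 - t) * g x + t * g x'"
      using upper[OF y] t by (intro add_mono mult_left_mono) auto
    finally show "h y (cvx (d i) t x x') \<le> (1 - t) * g x + t * g x'" .
  qed
  show thesis
  proof (rule that[of M' g])
    show "even_bounded (d i) R M' (cube (d i) R) g"
      unfolding even_bounded_def using gm gM even negv_cube cube_space by auto
    show "convex_pair (d i) (cube (d i) R) g"
      unfolding convex_pair_def using conv cvx_cube by auto
  next
    fix x assume x: "x \<in> PiE {..<n} (A(i := cube (d i) R))"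
    obtain a where a: "a \<in> A i" using ne[OF i] by auto
    have y: "x(i := a) \<in> S" using x a i by (force simp: S_def PiE_iff extensional_def)
    have "rest (x(i := a)) = rest x" unfolding rest_def by (intro sum.cong) auto
    then have "quadform n d q x - rest x \<le> c i * g (x i)"
      using upper[OF y, of "x i"] ci by (simp add: h_def field_simps)
    then show "quadform n d q x \<le> (\<Sum>j<n. c j * (\<phi>(i := g)) j (x j))"
      unfolding split by (simp add: rest_def)
  next
    fix x assume x: "x \<in> A i"
    show "g x \<le> \<phi> i x"
    proof (rule least)
      fix y assume y: "y \<in> S"
      have "y(i := x) \<in> PiE {..<n} A" using x y i by (force simp: S_def PiE_iff extensional_def)
      from dom[OF this] have "quadform n d q (y(i := x)) \<le> c i * \<phi> i x + rest y"
        unfolding split by (simp add: rest_def)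
      then show "h y x \<le> \<phi> i x" using ci by (simp add: h_def field_simps)
    qed
  qed
qed

text \<open>The blocks are treated one at a time because each supremum must use the potentials
  already replaced: this keeps the domination alive. Later steps leave earlier blocks untouched, so
  their convexity persists. \<open>A' m\<close> records that the first \<open>m\<close> domains have
  become cubes.\<close>

lemma convexify:
  fixes c :: "nat \<Rightarrow> real"
  assumes c: "\<And>i. i < n \<Longrightarrow> c i > 0"
    and eb: "\<And>j. j < n \<Longrightarrow> even_bounded (d j) R M (A j) (\<phi> j)"
    and ne: "\<And>j. j < n \<Longrightarrow> A j \<noteq> {}"
    and dom: "\<And>x. x \<in> PiE {..<n} A \<Longrightarrow> quadform n d q x \<le> (\<Sum>j<n. c j * \<phi> j (x j))"
    and psd: "\<And>i z. i < n \<Longrightarrow> 0 \<le> quadform n d q (\<lambda>j k. if j = i then z k else 0)"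
  obtains g M' where "\<And>i. i < n \<Longrightarrow> even_bounded (d i) R M' (cube (d i) R) (g i)"
    "\<And>i. i < n \<Longrightarrow> convex_pair (d i) (cube (d i) R) (g i)"
    "\<And>x. x \<in> PiE {..<n} (\<lambda>i. cube (d i) R) \<Longrightarrow> quadform n d q x \<le> (\<Sum>j<n. c j * g j (x j))"
    "\<And>i x. i < n \<Longrightarrow> x \<in> A i \<Longrightarrow> g i x \<le> \<phi> i x"
proof -
  define A' where "A' m = (\<lambda>j. if j < m then cube (d j) R else A j)" for m
  have sub: "A j \<subseteq> cube (d j) R" if "j < n" for j using eb[OF that] by (auto simp: even_bounded_def)
  define Inv where "Inv m g M' \<longleftrightarrow> (\<forall>j<n. even_bounded (d j) R M' (A' m j) (g j))
     \<and> (\<forall>j<m. convex_pair (d j) (cube (d j) R) (g j))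
     \<and> (\<forall>x\<in>PiE {..<n} (A' m). quadform n d q x \<le> (\<Sum>j<n. c j * g j (x j)))
     \<and> (\<forall>j<n. \<forall>x\<in>A j. g j x \<le> \<phi> j x)" for m g M'
  have "\<exists>g M'. Inv m g M'" if "m \<le> n" for m
    using that
  proof (induction m)
    case 0
    then show ?case using eb dom by (intro exI[of _ \<phi>] exI[of _ M]) (auto simp: A'_def Inv_def)
  next
    case (Suc m)
    then obtain g M1 where "Inv m g M1" by auto
    then have g: "\<And>j. j < n \<Longrightarrow> even_bounded (d j) R M1 (A' m j) (g j)"
      "\<And>j. j < m \<Longrightarrow> convex_pair (d j) (cube (d j) R) (g j)"
      "\<And>x. x \<in> PiE {..<n} (A' m) \<Longrightarrow> quadform n d q x \<le> (\<Sum>j<n. c j * g j (x j))"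
      "\<And>j x. j < n \<Longrightarrow> x \<in> A j \<Longrightarrow> g j x \<le> \<phi> j x" by (simp_all add: Inv_def)
    have m: "m < n" using Suc by simp
    have ne': "A' m j \<noteq> {}" if "j < n" for j using ne[OF that] sub[OF that] by (auto simp: A'_def)
    have A'm: "(A' m)(m := cube (d m) R) = A' (Suc m)" by (auto simp: A'_def fun_eq_iff less_Suc_eq)
    obtain g' M2 where g': "even_bounded (d m) R M2 (cube (d m) R) g'" "convex_pair (d m) (cube (d m) R) g'"
      "\<And>x. x \<in> PiE {..<n} (A' (Suc m)) \<Longrightarrow> quadform n d q x \<le> (\<Sum>j<n. c j * (g(m := g')) j (x j))"
      "\<And>x. x \<in> A' m m \<Longrightarrow> g' x \<le> g m x"
      by (rule convexify_coordinate[OF m c[OF m] g(1) ne' g(3) psd[OF m], unfolded A'm];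
          (assumption | (rule that, assumption, assumption, blast+)))
    show ?case unfolding Inv_def
    proof (intro exI[of _ "g(m := g')"] exI[of _ "max M1 M2"] conjI allI impI ballI)
      show "even_bounded (d j) R (max M1 M2) (A' (Suc m) j) ((g(m := g')) j)" if "j < n" for j
        using even_bounded_mono[OF g(1)[OF that], of "max M1 M2"] even_bounded_mono[OF g'(1), of "max M1 M2"]
        by (auto simp: A'_def less_Suc_eq)
      show "convex_pair (d j) (cube (d j) R) ((g(m := g')) j)" if "j < Suc m" for j
        using g(2)[of j] g'(2) that by (auto simp: less_Suc_eq)
      show "(g(m := g')) j x \<le> \<phi> j x" if "j < n" "x \<in> A j" for j x
        using g(4)[OF that] g'(4)[of x] that by (auto simp: A'_def)
    qed (rule g'(3))
  qed
  from this[of n] obtain g M' where "Inv n g M'" by auto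
  then have g: "\<And>j. j < n \<Longrightarrow> even_bounded (d j) R M' (A' n j) (g j)"
      "\<And>j. j < n \<Longrightarrow> convex_pair (d j) (cube (d j) R) (g j)"
      "\<And>x. x \<in> PiE {..<n} (A' n) \<Longrightarrow> quadform n d q x \<le> (\<Sum>j<n. c j * g j (x j))"
      "\<And>j x. j < n \<Longrightarrow> x \<in> A j \<Longrightarrow> g j x \<le> \<phi> j x" by (simp_all add: Inv_def)
  have "PiE {..<n} (A' n) = PiE {..<n} (\<lambda>i. cube (d i) R)" by (intro PiE_cong) (auto simp: A'_def)
  with g show thesis by (intro that[of M' g]) (auto simp: A'_def)
qed

section \<open>Log-concave measures suffice\<close>

lemma quadform_scale: "quadform n d q (\<lambda>j k. s * x j k) = s\<^sup>2 * quadform n d q x"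
  unfolding quadform_def sum_distrib_left by (intro sum.cong refl) (simp add: power2_eq_square)

text \<open>In \<open>s\<close> the form is a quadratic polynomial with negative leading
  coefficient, and its maximum is bounded by completing the square. The bound does not depend on
  \<open>s\<close>: moving along \<open>V\<close> is free, however far.\<close>

lemma quadform_line_bound:
  assumes V: "\<And>j k. j < n \<Longrightarrow> k < d j \<Longrightarrow> \<bar>V j k\<bar> \<le> v"
    and Y: "\<And>j k. j < n \<Longrightarrow> k < d j \<Longrightarrow> \<bar>Y j k\<bar> \<le> 1"
    and neg: "quadform n d q V < 0"
  shows "quadform n d q (\<lambda>j k. s * V j k + Y j k)
    \<le> (2 * v * qnorm n d q)\<^sup>2 / (4 * - quadform n d q V) + qnorm n d q"
proof -
  define X where "X = (\<Sum>(i, k)\<in>coords n d. \<Sum>(j, l)\<in>coords n d. q i k j l * (V i k * Y j l + Y i k * V j l))"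
  have id: "quadform n d q (\<lambda>j k. s * V j k + Y j k) = s\<^sup>2 * quadform n d q V + s * X + quadform n d q Y"
    unfolding quadform_coords X_def sum_distrib_left sum.distrib[symmetric]
    by (intro sum.cong refl)
       (auto simp: split_def sum_distrib_left sum.distrib[symmetric] algebra_simps power2_eq_square intro!: sum.cong)
  have X: "\<bar>X\<bar> \<le> qnorm n d q * (2 * v)" unfolding X_def
  proof (rule bilinear_bound)
    fix i k j l assume H: "i < n" "k < d i" "j < n" "l < d j"
    have "\<bar>V i k\<bar> * \<bar>Y j l\<bar> \<le> v * 1" "\<bar>Y i k\<bar> * \<bar>V j l\<bar> \<le> 1 * v"
      using V Y H by (intro mult_mono; force intro: order_trans[OF abs_ge_zero])+
    then show "\<bar>V i k * Y j l + Y i k * V j l\<bar> \<le> 2 * v"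
      using abs_triangle_ineq[of "V i k * Y j l" "Y i k * V j l"] by (simp add: abs_mult)
  qed
  have qY: "quadform n d q Y \<le> qnorm n d q" using quadform_bound[of n d Y 1 q] Y by simp
  define l where "l = - quadform n d q V"
  define b where "b = 2 * v * qnorm n d q"
  have l: "l > 0" using neg by (simp add: l_def)
  have "s * X \<le> \<bar>s\<bar> * \<bar>X\<bar>" by (metis abs_ge_self abs_mult)
  also have "\<dots> \<le> \<bar>s\<bar> * b" using X by (intro mult_left_mono) (auto simp: b_def algebra_simps)
  finally have sX: "s * X \<le> \<bar>s\<bar> * b" .
  have "0 \<le> (2 * l * \<bar>s\<bar> - b)\<^sup>2" by simp
  then have "(\<bar>s\<bar> * b - l * s\<^sup>2) * (4 * l) \<le> b\<^sup>2"
    by (simp add: power2_eq_square algebra_simps)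
  then have "\<bar>s\<bar> * b - l * s\<^sup>2 \<le> b\<^sup>2 / (4 * l)" using l by (simp add: pos_le_divide_eq)
  then have "s\<^sup>2 * quadform n d q V + s * X \<le> b\<^sup>2 / (4 * l)" using sX by (simp add: l_def algebra_simps)
  with qY show ?thesis unfolding id b_def l_def by simp
qed

text \<open>With the normalisation \<open>v h = 1\<close> used below, coordinate \<open>h\<close> is
  the parameter along the line spanned by \<open>v\<close>, and the remaining condition bounds the
  deviation from the line. The set is convex and symmetric, so constants on it are admissible
  potentials.\<close>

definition tube :: "nat \<Rightarrow> (nat \<Rightarrow> real) \<Rightarrow> nat \<Rightarrow> nat \<Rightarrow> (nat \<Rightarrow> real) set" where
  "tube m v h N = {x \<in> space (Leb m). \<bar>x h\<bar> \<le> 2 * real N \<and> (\<forall>k<m. \<bar>x k - v k * x h\<bar> \<le> 1)}"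

lemma tube_sets: "h < m \<Longrightarrow> tube m v h N \<in> sets (Leb m)"
proof -
  assume h [measurable]: "h < m"
  have "{x \<in> space (Leb m). \<forall>k\<in>{..<m}. \<bar>x k - v k * x h\<bar> \<le> 1} \<in> sets (Leb m)"
  proof (rule sets.sets_Collect_finite_All)
    fix k assume "k \<in> {..<m}"
    then have [measurable]: "k < m" by simp
    show "{x \<in> space (Leb m). \<bar>x k - v k * x h\<bar> \<le> 1} \<in> sets (Leb m)" by measurable
  qed simp
  moreover have "{x \<in> space (Leb m). \<bar>x h\<bar> \<le> 2 * real N} \<in> sets (Leb m)" by measurable
  ultimately have "{x \<in> space (Leb m). \<bar>x h\<bar> \<le> 2 * real N \<and> (\<forall>k\<in>{..<m}. \<bar>x k - v k * x h\<bar> \<le> 1)} \<in> sets (Leb m)"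
    by (intro sets.sets_Collect_conj)
  then show ?thesis by (simp add: tube_def)
qed

text \<open>A tube of length \<open>4 N\<close> around the line spanned by \<open>v\<close> contains \<open>N\<close> disjoint translates of a
  fixed small cube.\<close>

lemma tube_volume:
  fixes v :: "nat \<Rightarrow> real"
  assumes h: "h < m" "v h = 1"
  defines "\<delta> \<equiv> 1 / (1 + (\<Sum>k<m. \<bar>v k\<bar>))"
  shows "ennreal (real N * (2 * \<delta>) ^ m) \<le> emeasure (Leb m) (tube m v h N)"
proof -
  have vk: "\<bar>v k\<bar> \<le> (\<Sum>k<m. \<bar>v k\<bar>)" if "k < m" for k
    using member_le_sum[of k "{..<m}" "\<lambda>k. \<bar>v k\<bar>"] that by simp
  have S1: "(\<Sum>k<m. \<bar>v k\<bar>) \<ge> 1" using vk[OF h(1)] h by simp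
  \<comment> \<open>\<open>\<delta> \<le> 1 / 2\<close> keeps apart cubes whose centres
    \<open>2 * s * v\<close> differ by at least 2 in coordinate \<open>h\<close>;
    \<open>\<delta> * (1 + \<bar>v k\<bar>) \<le> 1\<close> keeps each cube within distance 1 of the
    line.\<close>
  then have \<delta>: "\<delta> > 0" "\<delta> \<le> 1 / 2" by (auto simp: \<delta>_def field_simps)
  have \<delta>v: "\<delta> * (1 + \<bar>v k\<bar>) \<le> 1" if "k < m" for k
    using vk[OF that] S1 by (simp add: \<delta>_def field_simps)
  define Q where "Q s = PiE {..<m} (\<lambda>k. {2 * real s * v k - \<delta>..2 * real s * v k + \<delta>})" for s :: nat
  have Qm: "Q s \<in> sets (Leb m)" for s unfolding Q_def by (rule PiE_sets_Leb) simp
  have QD: "\<bar>x k - 2 * real s * v k\<bar> \<le> \<delta>" if "x \<in> Q s" "k < m" for x s k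
  proof -
    have "x k \<in> {2 * real s * v k - \<delta>..2 * real s * v k + \<delta>}" using that by (auto simp: Q_def PiE_iff)
    then show ?thesis by (auto simp: abs_le_iff)
  qed
  have Qh: "\<bar>x h - 2 * real s\<bar> \<le> \<delta>" if "x \<in> Q s" for x s using QD[OF that h(1)] h(2) by simp
  have "disjoint_family_on Q {..<N}"
  unfolding disjoint_family_on_def
  proof (intro ballI impI)
    fix s s' :: nat assume "s \<noteq> s'"
    show "Q s \<inter> Q s' = {}"
    proof (rule ccontr)
      assume "Q s \<inter> Q s' \<noteq> {}"
      then obtain x where "x \<in> Q s" "x \<in> Q s'" by auto
      from Qh[OF this(1)] Qh[OF this(2)] have "\<bar>2 * real s - 2 * real s'\<bar> \<le> 1" using \<delta> by linarith
      with \<open>s \<noteq> s'\<close> show False by linarith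
    qed
  qed
  then have "(\<Sum>s<N. emeasure (Leb m) (Q s)) = emeasure (Leb m) (\<Union>s<N. Q s)"
    using Qm by (intro sum_emeasure) auto
  also have "\<dots> \<le> emeasure (Leb m) (tube m v h N)"
  proof (rule emeasure_mono)
    show "(\<Union>s<N. Q s) \<subseteq> tube m v h N"
    proof safe
      fix s x assume s: "s < N" and x: "x \<in> Q s"
      have "x \<in> space (Leb m)" using x by (auto simp: Q_def PiE_iff space_Leb)
      moreover have "\<bar>x h\<bar> \<le> 2 * real N" using Qh[OF x] s \<delta> by linarith
      moreover have "\<bar>x k - v k * x h\<bar> \<le> 1" if k: "k < m" for k
      proof -
        have "x k - v k * x h = (x k - 2 * real s * v k) - v k * (x h - 2 * real s)"
          by (simp add: algebra_simps)
        also have "\<bar>\<dots>\<bar> \<le> \<bar>x k - 2 * real s * v k\<bar> + \<bar>v k * (x h - 2 * real s)\<bar>" by simp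
        also have "\<dots> \<le> \<delta> + \<bar>v k\<bar> * \<delta>"
          unfolding abs_mult using QD[OF x k] Qh[OF x] by (intro add_mono mult_left_mono) auto
        also have "\<dots> \<le> 1" using \<delta>v[OF k] by (simp add: algebra_simps)
        finally show ?thesis .
      qed
      ultimately show "x \<in> tube m v h N" by (simp add: tube_def)
    qed
  qed (use tube_sets[OF h(1)] in auto)
  also have "emeasure (Leb m) (Q s) = ennreal ((2 * \<delta>) ^ m)" for s
    unfolding Q_def using \<delta> by (subst emeasure_Leb_PiE) (auto simp: ennreal_power)
  then have "(\<Sum>s<N. emeasure (Leb m) (Q s)) = ennreal (real N * (2 * \<delta>) ^ m)"
    using \<delta> by (simp add: ennreal_mult ennreal_of_nat_eq_real_of_nat)
  finally show ?thesis .
qed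

lemma emeasure_cube_pos: "R > 0 \<Longrightarrow> emeasure (Leb m) (cube m R) > 0"
  unfolding cube_def by (subst emeasure_Leb_PiE) (simp_all add: ennreal_power)

text \<open>Along the tube the form stays below a constant \<open>b\<close> independent of the
  length, while the logarithm of the volume grows like ln N. Since \<open>c i > 0\<close>, the left
  side of the bound for constant potentials exceeds any \<open>D\<close>.\<close>

lemma condB_logconcave_imp_psd:
  assumes B: "condB_logconcave n d c q (ereal D)" and c: "\<And>i. i < n \<Longrightarrow> c i > 0" and i: "i < n"
  shows "0 \<le> quadform n d q (\<lambda>j k. if j = i then z k else 0)"
proof (rule ccontr)
  assume "\<not> ?thesis"
  then have neg: "quadform n d q (\<lambda>j k. if j = i then z k else 0) < 0" by simp
  have "\<exists>h<d i. z h \<noteq> 0"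
  proof (rule ccontr)
    assume "\<not> ?thesis"
    then have "quadform n d q (\<lambda>j k. if j = i then z k else 0) = quadform n d q (\<lambda>j k. 0)"
      by (intro quadform_cong) auto
    with neg show False by (simp add: quadform_def)
  qed
  then obtain h where h: "h < d i" "z h \<noteq> 0" by auto
  define v where "v k = z k / z h" for k
  have vh: "v h = 1" using h by (simp add: v_def)
  define V where "V j k = (if j = i then v k else 0)" for j k :: nat
  have "(\<lambda>j k. if j = i then z k else 0) = (\<lambda>j k. z h * V j k)"
    using h by (auto simp: V_def v_def fun_eq_iff)
  with neg have negV: "quadform n d q V < 0" by (simp add: quadform_scale mult_less_0_iff)
  define w where "w = (\<Sum>k<d i. \<bar>v k\<bar>)"
  have vw: "\<bar>v k\<bar> \<le> w" if "k < d i" for k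
    using member_le_sum[of k "{..<d i}" "\<lambda>k. \<bar>v k\<bar>"] that by (simp add: w_def)
  have w0: "w \<ge> 0" by (simp add: w_def sum_nonneg)
  define b where "b = (2 * w * qnorm n d q)\<^sup>2 / (4 * - quadform n d q V) + qnorm n d q"
  define \<delta> where "\<delta> = 1 / (1 + w)"
  have \<delta>: "\<delta> > 0" using w0 by (simp add: \<delta>_def)
  \<comment> \<open>Constant potentials: block \<open>i\<close> alone pays for the form, and the
    factor \<open>c i\<close> turns \<open>b / c i\<close> into the bound \<open>b\<close> of
    \<open>quadform_line_bound\<close>.\<close>
  define \<phi> :: "nat \<Rightarrow> (nat \<Rightarrow> real) \<Rightarrow> real" where "\<phi> j x = (if j = i then b / c i else 0)" for j x
  have \<phi>m: "\<phi> j \<in> borel_measurable (Leb (d j))" for j by (simp add: \<phi>_def[abs_def])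
  define C where "C = (\<Sum>j\<in>{..<n} - {i}. c j * ln (partition_fun (d j) (cube (d j) 1) (\<phi> j)))"
  have main: "C + c i * (- (b / c i) + ln (real N * (2 * \<delta>) ^ d i)) \<le> D" if N: "N \<ge> 1" for N :: nat
  proof -
    define K where "K = tube (d i) v h N"
    define A where "A j = (if j = i then K else cube (d j) 1)" for j
    define R where "R = 1 + w * (2 * real N)"
    have R1: "R \<ge> 1" using w0 by (simp add: R_def)
    have KR: "x \<in> cube (d i) R" if "x \<in> K" for x
    proof -
      have "\<bar>x k\<bar> \<le> R" if k: "k < d i" for k
      proof -
        have "\<bar>x k\<bar> \<le> \<bar>x k - v k * x h\<bar> + \<bar>v k\<bar> * \<bar>x h\<bar>"
          by (simp flip: abs_mult)
        also have "\<dots> \<le> 1 + w * (2 * real N)"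
          using \<open>x \<in> K\<close> k vw[OF k] w0 by (intro add_mono mult_mono) (auto simp: K_def tube_def)
        finally show ?thesis by (simp add: R_def)
      qed
      then show ?thesis using \<open>x \<in> K\<close> by (auto simp: K_def tube_def cube_def PiE_iff space_Leb abs_le_iff minus_le_iff)
    qed
    have eb: "even_bounded (d j) R \<bar>b / c i\<bar> (A j) (\<phi> j)" if "j < n" for j
    proof (cases "j = i")
      case True
      have "negv (d i) x \<in> K" if "x \<in> K" for x
      proof -
        have "\<bar>- x k + v k * x h\<bar> = \<bar>x k - v k * x h\<bar>" for k by simp
        then show ?thesis using that h(1) by (auto simp: K_def tube_def negv_space) (simp_all add: negv_def)
      qed
      then show ?thesis using True KR tube_sets[OF h(1)] \<phi>m[of i] by (auto simp: even_bounded_def A_def K_def) (auto simp: \<phi>_def)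
    next
      case False
      have "cube (d j) 1 \<subseteq> cube (d j) R" using R1 by (force simp: cube_def PiE_iff)
      with False show ?thesis using \<phi>m[of j] by (auto simp: even_bounded_def A_def negv_cube) (auto simp: \<phi>_def)
    qed
    have cv: "convex_pair (d j) (A j) (\<phi> j)" if "j < n" for j
    proof (cases "j = i")
      case True
      have "cvx (d i) t x y \<in> K" if "x \<in> K" "y \<in> K" "t \<in> {0<..<1}" for x y t
      proof -
        have conv: "\<bar>(1 - t) * a + t * e\<bar> \<le> r" if "\<bar>a\<bar> \<le> r" "\<bar>e\<bar> \<le> r" for a e r :: real
        proof -
          have "\<bar>(1 - t) * a + t * e\<bar> \<le> (1 - t) * \<bar>a\<bar> + t * \<bar>e\<bar>"
            using \<open>t \<in> {0<..<1}\<close> abs_triangle_ineq[of "(1 - t) * a" "t * e"] by (simp add: abs_mult)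
          also have "\<dots> \<le> (1 - t) * r + t * r"
            using \<open>t \<in> {0<..<1}\<close> that by (intro add_mono mult_left_mono) auto
          finally show ?thesis by (simp add: algebra_simps)
        qed
        have "\<bar>((1 - t) * x k + t * y k) - v k * ((1 - t) * x h + t * y h)\<bar> \<le> 1" if "k < d i" for k
          using conv[of "x k - v k * x h" 1 "y k - v k * y h"] \<open>x \<in> K\<close> \<open>y \<in> K\<close> that
          by (simp add: K_def tube_def algebra_simps)
        moreover have "\<bar>(1 - t) * x h + t * y h\<bar> \<le> 2 * real N"
          using conv[of "x h" "2 * real N" "y h"] \<open>x \<in> K\<close> \<open>y \<in> K\<close> by (simp add: K_def tube_def)
        ultimately show ?thesis using h(1) cvx_space[of "d i" t x y]
          by (simp add: K_def tube_def) (simp add: cvx_def)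
      qed
      then show ?thesis using True by (auto simp: convex_pair_def A_def \<phi>_def left_diff_distrib diff_divide_distrib)
    next
      case False
      then show ?thesis by (auto simp: convex_pair_def A_def \<phi>_def cvx_cube)
    qed
    have vol: "ennreal (real N * (2 * \<delta>) ^ d i) \<le> emeasure (Leb (d i)) K"
      unfolding K_def \<delta>_def w_def using h(1) vh by (rule tube_volume)
    have volp: "real N * (2 * \<delta>) ^ d i > 0" using N \<delta> by simp
    have posK: "emeasure (Leb (d i)) K > 0" using vol volp by (metis ennreal_less_zero_iff order_less_le_trans)
    have pos: "emeasure (Leb (d j)) (A j) > 0" if "j < n" for j
      using posK emeasure_cube_pos[of 1 "d j"] by (auto simp: A_def)
    have dom: "quadform n d q x \<le> (\<Sum>j<n. c j * \<phi> j (x j))" if x: "x \<in> PiE {..<n} A" for x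
    proof -
      have xA: "x j \<in> A j" if "j < n" for j using x that by auto
      \<comment> \<open>Split off the component along \<open>V\<close> with parameter
        \<open>x i h\<close>. In block \<open>i\<close> the remainder is the deviation from the
        line, at most 1 in the tube; in the other blocks \<open>V\<close> vanishes and the unit cube
        gives the same bound.\<close>
      define Y where "Y j k = x j k - x i h * V j k" for j k
      have "quadform n d q (\<lambda>j k. x i h * V j k + Y j k) \<le> b" unfolding b_def
      proof (rule quadform_line_bound[OF _ _ negV])
        show "\<bar>V j k\<bar> \<le> w" if "j < n" "k < d j" for j k using vw that w0 by (auto simp: V_def)
        show "\<bar>Y j k\<bar> \<le> 1" if "j < n" "k < d j" for j k
          using xA[OF that(1)] that(2) cubeD[of "x j" "d j" 1 k]
          by (auto simp: Y_def V_def A_def K_def tube_def mult.commute split: if_splits)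
      qed
      also have "b = (\<Sum>j<n. if j = i then b else 0)" using i by simp
      also have "\<dots> = (\<Sum>j<n. c j * \<phi> j (x j))"
        using c[OF i] by (intro sum.cong) (auto simp: \<phi>_def)
      finally show ?thesis by (simp add: Y_def)
    qed
    have "(\<Sum>j<n. c j * ln (partition_fun (d j) (A j) (\<phi> j))) \<le> D"
      by (rule condB_logconcave_imp_bound[OF B eb cv pos dom])
    also have "(\<Sum>j<n. c j * ln (partition_fun (d j) (A j) (\<phi> j)))
        = c i * ln (partition_fun (d i) K (\<phi> i)) + C"
      unfolding C_def using i by (subst sum.remove[of _ i]) (auto simp: A_def intro!: sum.cong)
    finally have le: "c i * ln (partition_fun (d i) K (\<phi> i)) + C \<le> D" .
    have K: "even_bounded (d i) R \<bar>b / c i\<bar> K (\<phi> i)" using eb[OF i] by (simp add: A_def)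
    have "ennreal (exp (- (b / c i)) * (real N * (2 * \<delta>) ^ d i)) \<le> ennreal (exp (- (b / c i))) * emeasure (Leb (d i)) K"
      using vol volp by (subst ennreal_mult) (auto intro!: mult_left_mono)
    also have "\<dots> = (\<integral>\<^sup>+x. ennreal (exp (- (b / c i))) * indicator K x \<partial>Leb (d i))"
      using tube_sets[OF h(1)] by (simp add: nn_integral_cmult_indicator K_def)
    also have "\<dots> = (\<integral>\<^sup>+x. ennreal (indicator K x * exp (- \<phi> i x)) \<partial>Leb (d i))"
      by (intro nn_integral_cong) (auto simp: \<phi>_def indicator_def)
    also have "\<dots> = ennreal (partition_fun (d i) K (\<phi> i))" by (rule nn_integral_partition_fun[OF K])
    finally have "exp (- (b / c i)) * (real N * (2 * \<delta>) ^ d i) \<le> partition_fun (d i) K (\<phi> i)"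
      using partition_fun_pos[OF K posK] by simp
    then have "ln (exp (- (b / c i)) * (real N * (2 * \<delta>) ^ d i)) \<le> ln (partition_fun (d i) K (\<phi> i))"
      using volp by (intro ln_mono) auto
    also have "ln (exp (- (b / c i)) * (real N * (2 * \<delta>) ^ d i)) = - (b / c i) + ln (real N * (2 * \<delta>) ^ d i)"
      using volp by (simp only: ln_mult_pos[OF exp_gt_zero] ln_exp)
    finally have "c i * (- (b / c i) + ln (real N * (2 * \<delta>) ^ d i)) \<le> c i * ln (partition_fun (d i) K (\<phi> i))"
      using c[OF i] by (intro mult_left_mono) auto
    with le show ?thesis by simp
  qed
  \<comment> \<open>The volume at which the inequality \<open>main\<close> becomes an equality; any
    larger volume contradicts it.\<close>
  define T where "T = exp ((D - C) / c i + b / c i)"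
  obtain N :: nat where N: "real N > T / (2 * \<delta>) ^ d i" using reals_Archimedean2 by blast
  have T: "T < real N * (2 * \<delta>) ^ d i" using N \<delta> by (simp add: field_simps)
  have T0: "T > 0" by (simp add: T_def)
  have "real N > 0" using T0 \<delta> N by (meson divide_pos_pos order_less_trans zero_less_power mult_pos_pos zero_less_numeral)
  then have "N \<ge> 1" by simp
  have "ln T < ln (real N * (2 * \<delta>) ^ d i)" using T T0 by simp
  then have "(D - C) / c i < - (b / c i) + ln (real N * (2 * \<delta>) ^ d i)" by (simp add: T_def)
  then have "D - C < c i * (- (b / c i) + ln (real N * (2 * \<delta>) ^ d i))"
    using c[OF i] by (simp add: pos_divide_less_eq mult.commute)
  with main[OF \<open>N \<ge> 1\<close>] show False by simp
qed

section \<open>Truncation and passage to the limit\<close>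

lemma partition_fun_eq_0:
  assumes [measurable]: "A \<in> sets (Leb m)" and "emeasure (Leb m) A = 0"
  shows "partition_fun m A \<phi> = 0"
proof -
  have "AE x in Leb m. x \<notin> A" using assms by (intro AE_not_in) (auto simp: null_sets_def)
  then have "(\<integral>\<^sup>+x. ennreal (indicator A x * exp (- \<phi> x)) \<partial>Leb m) = (\<integral>\<^sup>+x. 0 \<partial>Leb m)"
    by (intro nn_integral_cong_AE) (auto elim!: eventually_mono)
  then show ?thesis by (simp add: partition_fun_def)
qed

lemma partition_fun_mono:
  assumes "even_bounded m R M B \<psi>" "A \<subseteq> B" "\<And>x. x \<in> A \<Longrightarrow> \<psi> x \<le> \<phi> x"
  shows "partition_fun m A \<phi> \<le> partition_fun m B \<psi>"
  unfolding partition_fun_def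
proof (rule enn2real_mono)
  show "(\<integral>\<^sup>+x. ennreal (indicator A x * exp (- \<phi> x)) \<partial>Leb m) \<le> (\<integral>\<^sup>+x. ennreal (indicator B x * exp (- \<psi> x)) \<partial>Leb m)"
    using assms(2,3) by (intro nn_integral_mono ennreal_leI) (auto simp: indicator_def)
  show "(\<integral>\<^sup>+x. ennreal (indicator B x * exp (- \<psi> x)) \<partial>Leb m) < top"
    by (simp add: nn_integral_partition_fun[OF assms(1)])
qed

text \<open>The convexified functions live on larger sets and lie below \<open>\<phi>\<close> on
  \<open>A\<close>, so their partition functions are larger and it suffices to bound those. Positive
  partition functions make the sets \<open>A j\<close> nonempty, so no supremum is taken over the
  empty set.\<close>

lemma condB_logconcave_imp_bound_bounded:
  assumes B: "condB_logconcave n d c q (ereal D)" and c: "\<And>i. i < n \<Longrightarrow> c i > 0"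
    and eb: "\<And>j. j < n \<Longrightarrow> even_bounded (d j) R M (A j) (\<phi> j)"
    and pos: "\<And>j. j < n \<Longrightarrow> partition_fun (d j) (A j) (\<phi> j) > 0"
    and dom: "\<And>x. x \<in> PiE {..<n} A \<Longrightarrow> quadform n d q x \<le> (\<Sum>j<n. c j * \<phi> j (x j))"
  shows "(\<Prod>i<n. partition_fun (d i) (A i) (\<phi> i) powr c i) \<le> exp D"
proof -
  have Am: "A j \<in> sets (Leb (d j))" and sub: "A j \<subseteq> cube (d j) R" if "j < n" for j
    using eb[OF that] by (auto simp: even_bounded_def)
  have posA: "emeasure (Leb (d j)) (A j) > 0" if "j < n" for j
    using partition_fun_eq_0[OF Am[OF that], of "\<phi> j"] pos[OF that] by (auto simp: zero_less_iff_neq_zero)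
  have ne: "A j \<noteq> {}" if "j < n" for j using posA[OF that] by auto
  obtain g M' where g: "\<And>i. i < n \<Longrightarrow> even_bounded (d i) R M' (cube (d i) R) (g i)"
    "\<And>i. i < n \<Longrightarrow> convex_pair (d i) (cube (d i) R) (g i)"
    "\<And>x. x \<in> PiE {..<n} (\<lambda>i. cube (d i) R) \<Longrightarrow> quadform n d q x \<le> (\<Sum>j<n. c j * g j (x j))"
    "\<And>i x. i < n \<Longrightarrow> x \<in> A i \<Longrightarrow> g i x \<le> \<phi> i x"
    by (rule convexify[OF c eb ne dom condB_logconcave_imp_psd[OF B c]];
        (assumption | (rule that, blast, blast, blast, blast)))
  have posc: "emeasure (Leb (d j)) (cube (d j) R) > 0" if "j < n" for j
    using posA[OF that] sub[OF that] by (meson cube_sets emeasure_mono order_less_le_trans)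
  define Z where "Z i = partition_fun (d i) (cube (d i) R) (g i)" for i
  have Z: "Z i > 0" if "i < n" for i
    unfolding Z_def using g(1)[OF that] posc[OF that] by (rule partition_fun_pos)
  have "(\<Prod>i<n. partition_fun (d i) (A i) (\<phi> i) powr c i) \<le> (\<Prod>i<n. Z i powr c i)"
  proof (intro prod_mono conjI powr_mono2)
    fix i assume "i \<in> {..<n}"
    then have i: "i < n" by simp
    show "partition_fun (d i) (A i) (\<phi> i) \<le> Z i"
      unfolding Z_def using g(1)[OF i] sub[OF i] g(4)[OF i] by (rule partition_fun_mono)
  qed (use c pos in \<open>auto simp: less_imp_le\<close>)
  also have "\<dots> = (\<Prod>i<n. exp (c i * ln (Z i)))"
    using Z by (intro prod.cong) (auto simp: powr_def less_imp_neq[THEN not_sym])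
  also have "\<dots> = exp (\<Sum>i<n. c i * ln (Z i))" by (simp add: exp_sum)
  also have "\<dots> \<le> exp D"
    unfolding Z_def using condB_logconcave_imp_bound[OF B g(1,2) posc g(3)] by simp
  finally show ?thesis .
qed

text \<open>Monotone convergence: the truncated sets increase to the set where \<open>f\<close> is
  finite, and where \<open>f\<close> is infinite \<open>expneg\<close> vanishes.\<close>

lemma partition_fun_truncation_tendsto:
  assumes [measurable]: "f \<in> borel_measurable (Leb m)"
    and fin: "(\<integral>\<^sup>+ x. expneg (f x) \<partial>Leb m) < \<infinity>"
    and minf: "\<And>x. x \<in> space (Leb m) \<Longrightarrow> f x \<noteq> -\<infinity>"
  shows "(\<lambda>N. partition_fun m {x \<in> cube m (real N). \<bar>f x\<bar> \<le> ereal (real N)} (\<lambda>x. real_of_ereal (f x)))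
    \<longlonglongrightarrow> enn2real (\<integral>\<^sup>+ x. expneg (f x) \<partial>Leb m)"
proof -
  define A where "A N = {x \<in> cube m (real N). \<bar>f x\<bar> \<le> ereal (real N)}" for N :: nat
  have A_alt: "A N = cube m (real N) \<inter> {x \<in> space (Leb m). \<bar>f x\<bar> \<le> ereal (real N)}" for N
    using cube_space by (auto simp: A_def)
  have [measurable]: "A N \<in> sets (Leb m)" for N unfolding A_alt by measurable
  let ?u = "\<lambda>N x. ennreal (indicator (A N) x * exp (- real_of_ereal (f x)))"
  have mono: "A N \<subseteq> A N'" if "N \<le> N'" for N N'
  proof -
    have "cube m (real N) \<subseteq> cube m (real N')" using that by (force simp: cube_def PiE_iff)
    moreover have "ereal (real N) \<le> ereal (real N')" using that by simp
    ultimately show ?thesis unfolding A_def by (auto intro: order_trans)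
  qed
  \<comment> \<open>The indicator of the space appears because \<open>nn_integral_LIMSEQ\<close>
    asks for convergence at every point of the type, and the truncated sets contain no point outside
    the space.\<close>
  have "(\<lambda>N. \<integral>\<^sup>+x. ?u N x \<partial>Leb m) \<longlonglongrightarrow> (\<integral>\<^sup>+ x. expneg (f x) * indicator (space (Leb m)) x \<partial>Leb m)"
  proof (rule nn_integral_LIMSEQ)
    show "incseq ?u"
    proof (intro incseq_SucI le_funI ennreal_leI mult_right_mono)
      fix N x show "indicat_real (A N) x \<le> indicat_real (A (Suc N)) x"
        using mono[of N "Suc N"] by (auto simp: indicator_def)
    qed simp
  next
    fix x
    show "(\<lambda>N. ?u N x) \<longlonglongrightarrow> expneg (f x) * indicator (space (Leb m)) x"
    proof (cases "f x = \<infinity> \<or> x \<notin> space (Leb m)")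
      case True
      then have "x \<notin> A N" for N using cube_space by (auto simp: A_def)
      then show ?thesis using True by (auto simp: expneg_def)
    next
      case False
      then have x: "x \<in> space (Leb m)" by simp
      from False minf[OF x] obtain r where r: "f x = ereal r" by (cases "f x") auto
      obtain N0 :: nat where N0: "real N0 > \<bar>r\<bar> + (\<Sum>k<m. \<bar>x k\<bar>)" using reals_Archimedean2 by blast
      have sumnn: "0 \<le> (\<Sum>k<m. \<bar>x k\<bar>)" by (simp add: sum_nonneg)
      have "\<bar>x k\<bar> \<le> real N0" if "k < m" for k
        using member_le_sum[of k "{..<m}" "\<lambda>k. \<bar>x k\<bar>"] that N0 by simp
      then have "x \<in> cube m (real N0)" using x by (force simp: cube_def PiE_iff space_Leb abs_le_iff)
      moreover have "\<bar>r\<bar> \<le> real N0" using N0 sumnn by linarith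
      ultimately have "x \<in> A N0" by (simp add: A_def r)
      then have "x \<in> A N" if "N \<ge> N0" for N using mono[OF that] by auto
      then have "\<forall>\<^sub>F N in sequentially. ?u N x = expneg (f x) * indicator (space (Leb m)) x"
        unfolding eventually_sequentially by (intro exI[of _ N0]) (auto simp: r x expneg_def)
      then show ?thesis by (rule tendsto_eventually)
    qed
  qed measurable
  then have "(\<lambda>N. \<integral>\<^sup>+x. ?u N x \<partial>Leb m) \<longlonglongrightarrow> (\<integral>\<^sup>+ x. expneg (f x) \<partial>Leb m)"
    by (simp cong: nn_integral_cong)
  then have "(\<lambda>N. \<integral>\<^sup>+x. ?u N x \<partial>Leb m) \<longlonglongrightarrow> ennreal (enn2real (\<integral>\<^sup>+ x. expneg (f x) \<partial>Leb m))"
    using fin by simp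
  from tendsto_enn2real[OF this enn2real_nonneg] show ?thesis
    unfolding partition_fun_def A_def .
qed

text \<open>Cutting to a cube and to \<open>\<bar>f\<bar> \<le> N\<close> preserves evenness and can
  only remove points from the domination hypothesis; on what remains all values are real.\<close>

lemma condB_logconcave_imp_condA:
  assumes B: "condB_logconcave n d c q D" and c: "\<forall>i<n. 0 < c i" and D: "D \<noteq> -\<infinity>"
  shows "condA n d c q D"
proof (cases D)
  case (real D')
  show ?thesis unfolding condA_def
  proof (intro allI impI, elim conjE, rule disjI2)
    fix f :: "nat \<Rightarrow> (nat \<Rightarrow> real) \<Rightarrow> ereal"
    assume f: "\<forall>i<n. f i \<in> borel_measurable (Leb (d i))
         \<and> (\<forall>x\<in>space (Leb (d i)). f i x \<noteq> -\<infinity> \<and> f i (negv (d i) x) = f i x)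
         \<and> (\<integral>\<^sup>+ x. expneg (f i x) \<partial>Leb (d i)) < \<infinity>"
      and dom: "\<forall>x\<in>space (Emeas n d). ereal (quadform n d q x) \<le> (\<Sum>i<n. ereal (c i) * f i (x i))"
    define Z where "Z i = enn2real (\<integral>\<^sup>+ x. expneg (f i x) \<partial>Leb (d i))" for i
    define A where "A N i = {x \<in> cube (d i) (real N). \<bar>f i x\<bar> \<le> ereal (real N)}" for N :: nat and i
    define \<phi> where "\<phi> i x = real_of_ereal (f i x)" for i x
    have lim: "(\<lambda>N. partition_fun (d i) (A N i) (\<phi> i)) \<longlonglongrightarrow> Z i" if "i < n" for i
      unfolding A_def \<phi>_def[abs_def] Z_def using f that by (intro partition_fun_truncation_tendsto) auto
    have "(\<Prod>i<n. Z i powr c i) \<le> exp D'"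
    proof (cases "\<forall>i<n. Z i > 0")
      \<comment> \<open>The bounded case needs positive partition functions. A vanishing
        \<open>Z i\<close> is harmless, since \<open>0 powr c i = 0\<close> makes the whole product
        zero.\<close>
      case False
      then obtain i where "i < n" "Z i = 0" unfolding Z_def by (metis enn2real_nonneg order_le_less)
      then have "(\<Prod>i<n. Z i powr c i) = 0" by (intro prod_zero) auto
      also have "0 \<le> exp D'" by simp
      finally show ?thesis .
    next
      case True
      have "\<forall>\<^sub>F N in sequentially. \<forall>i\<in>{..<n}. partition_fun (d i) (A N i) (\<phi> i) > 0"
        using True lim by (intro eventually_ball_finite ballI order_tendstoD(1)) auto
      then have "\<forall>\<^sub>F N in sequentially. (\<Prod>i<n. partition_fun (d i) (A N i) (\<phi> i) powr c i) \<le> exp D'"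
      proof eventually_elim
        fix N assume pos: "\<forall>i\<in>{..<n}. partition_fun (d i) (A N i) (\<phi> i) > 0"
        show "(\<Prod>i<n. partition_fun (d i) (A N i) (\<phi> i) powr c i) \<le> exp D'"
        proof (rule condB_logconcave_imp_bound_bounded)
          show "condB_logconcave n d c q (ereal D')" using B real by simp
          show "even_bounded (d i) (real N) (real N) (A N i) (\<phi> i)" if i: "i < n" for i
          proof -
            have [measurable]: "f i \<in> borel_measurable (Leb (d i))" using f i by auto
            have "A N i = cube (d i) (real N) \<inter> {x \<in> space (Leb (d i)). \<bar>f i x\<bar> \<le> ereal (real N)}"
              using cube_space by (auto simp: A_def)
            then have "A N i \<in> sets (Leb (d i))" by simp
            moreover have "\<phi> i \<in> borel_measurable (Leb (d i))" unfolding \<phi>_def[abs_def] by measurable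
            moreover have "\<bar>\<phi> i x\<bar> \<le> real N" if "x \<in> A N i" for x
              using that unfolding A_def \<phi>_def by (cases "f i x") auto
            moreover have "f i (negv (d i) x) = f i x" if "x \<in> A N i" for x
              using f i that cube_space by (auto simp: A_def)
            ultimately show ?thesis
              unfolding even_bounded_def using negv_cube by (auto simp: A_def \<phi>_def)
          qed
          show "quadform n d q x \<le> (\<Sum>i<n. c i * \<phi> i (x i))" if x: "x \<in> PiE {..<n} (A N)" for x
          proof -
            have xA: "x i \<in> A N i" if "i < n" for i using x that by auto
            have "x \<in> space (Emeas n d)"
              using x cube_space by (auto simp: space_Emeas PiE_iff A_def)
            then have "ereal (quadform n d q x) \<le> (\<Sum>i<n. ereal (c i) * f i (x i))" using dom by auto
            also have "\<dots> = (\<Sum>i<n. ereal (c i * \<phi> i (x i)))"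
            proof (rule sum.cong[OF refl])
              fix i assume "i \<in> {..<n}"
              then have "\<bar>f i (x i)\<bar> \<le> ereal (real N)" using xA[of i] by (simp add: A_def)
              then show "ereal (c i) * f i (x i) = ereal (c i * \<phi> i (x i))"
                unfolding \<phi>_def by (cases "f i (x i)") auto
            qed
            finally show ?thesis by simp
          qed
        qed (use c pos in auto)
      qed
      moreover have "(\<lambda>N. \<Prod>i<n. partition_fun (d i) (A N i) (\<phi> i) powr c i) \<longlonglongrightarrow> (\<Prod>i<n. Z i powr c i)"
        using True lim by (intro tendsto_prod tendsto_powr tendsto_const) auto
      ultimately show ?thesis
        by (intro tendsto_upperbound[of _ _ sequentially]) auto
    qed
    then show "(\<Prod>i<n. enn2real (\<integral>\<^sup>+ x. expneg (f i x) \<partial>Leb (d i)) powr c i) \<le> exp (real_of_ereal D)"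
      by (simp add: Z_def real)
  qed
qed (use D in \<open>auto simp: condA_def\<close>)

section \<open>Gluing a discrete coupling\<close>

text \<open>The coupling has a density with respect to the product of the \<open>\<mu>s i\<close>:
  with weight \<open>l t\<close> it restricts each factor to its cell \<open>S i (t i)\<close> and
  renormalises by \<open>p i (t i)\<close>. Summing \<open>l\<close> over the tuples with
  \<open>t i = a\<close> returns \<open>p i a\<close>, so the pieces of \<open>\<mu>s i\<close>
  reassemble to \<open>\<mu>s i\<close>.\<close>

lemma glue_coupling:
  fixes \<mu>s :: "nat \<Rightarrow> (nat \<Rightarrow> real) measure" and T :: "nat \<Rightarrow> (nat \<Rightarrow> real) \<Rightarrow> 'a"
  assumes n: "n > 0"
    and ps: "\<And>i. i < n \<Longrightarrow> prob_space (\<mu>s i)" and sets: "\<And>i. i < n \<Longrightarrow> sets (\<mu>s i) = sets (Leb (d i))"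
    and fin: "\<And>i. i < n \<Longrightarrow> finite (F i)"
    and TF: "\<And>i x. i < n \<Longrightarrow> x \<in> space (Leb (d i)) \<Longrightarrow> T i x \<in> F i"
    and Tm: "\<And>i a. i < n \<Longrightarrow> a \<in> F i \<Longrightarrow> {x \<in> space (Leb (d i)). T i x = a} \<in> sets (Leb (d i))"
    and l0: "\<And>t. t \<in> PiE {..<n} F \<Longrightarrow> 0 \<le> l t"
    and marg: "\<And>i a. i < n \<Longrightarrow> a \<in> F i \<Longrightarrow>
      (\<Sum>t\<in>{t\<in>PiE {..<n} F. t i = a}. l t) = measure (\<mu>s i) {x \<in> space (Leb (d i)). T i x = a}"
  obtains \<mu> where "\<mu> \<in> couplings n d \<mu>s"
    "\<And>g :: (nat \<Rightarrow> 'a) \<Rightarrow> real. integrable \<mu> (\<lambda>x. g (\<lambda>i\<in>{..<n}. T i (x i)))"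
    "\<And>g :: (nat \<Rightarrow> 'a) \<Rightarrow> real. (\<integral>x. g (\<lambda>i\<in>{..<n}. T i (x i)) \<partial>\<mu>) = (\<Sum>t\<in>PiE {..<n} F. l t * g t)"
proof -
  \<comment> \<open>\<open>product_sigma_finite\<close> wants a sigma-finite measure at every
    natural index, while \<open>\<mu>s\<close> is controlled only below \<open>n\<close>;
    \<open>\<mu>s 0\<close> fills the gap, which \<open>n > 0\<close> permits.\<close>
  define N where "N i = (if i < n then \<mu>s i else \<mu>s 0)" for i
  interpret N: prob_space "N i" for i using ps n by (auto simp: N_def)
  interpret NP: product_sigma_finite N by standard
  define P where "P = PiM {..<n} N"
  define S where "S i a = {x \<in> space (Leb (d i)). T i x = a}" for i a
  define p where "p i a = measure (\<mu>s i) (S i a)" for i a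
  define X where "X = PiE {..<n} F"
  have finX: "finite X" unfolding X_def using fin by (intro finite_PiE) auto
  have setsP: "sets P = sets (Emeas n d)"
    unfolding P_def Emeas_def by (intro sets_PiM_cong) (auto simp: N_def sets)
  have Sm: "S i a \<in> sets (Leb (d i))" if "i < n" "a \<in> F i" for i a
    unfolding S_def using that by (rule Tm)
  have projP: "(\<lambda>x. x i) \<in> measurable P (N i)" if "i < n" for i
    unfolding P_def using that by (intro measurable_component_singleton) auto
  have XF: "t i \<in> F i" if "t \<in> X" "i < n" for t i using that by (auto simp: X_def)
  define W where "W t x = (\<Prod>i<n. ennreal (1 / p i (t i)) * indicator (S i (t i)) (x i))" for t x
  have SB_N: "S i (t i) \<inter> B \<in> sets (N i)" if "t \<in> X" "i < n" "B \<in> sets (Leb (d i))" for t i B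
    using Sm[OF that(2) XF[OF that(1,2)]] that by (simp add: N_def sets)
  have Pm: "(\<lambda>x. \<Prod>i<n. ennreal (1 / p i (t i)) * indicator (S i (t i) \<inter> B i) (x i)) \<in> borel_measurable P"
    if "t \<in> X" "\<And>i. i < n \<Longrightarrow> B i \<in> sets (Leb (d i))" for t B
  proof (intro borel_measurable_prod_ennreal borel_measurable_times_ennreal borel_measurable_const)
    fix i assume "i \<in> {..<n}"
    then have i: "i < n" by simp
    from measurable_compose[OF projP[OF i] borel_measurable_indicator[OF SB_N[OF that(1) i that(2)[OF i]]]]
    show "(\<lambda>x. indicator (S i (t i) \<inter> B i) (x i) :: ennreal) \<in> borel_measurable P" .
  qed
  have Sspace: "S j a \<inter> space (Leb (d j)) = S j a" for j a by (auto simp: S_def)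
  have Wm: "W t \<in> borel_measurable P" if "t \<in> X" for t
    using Pm[OF that, of "\<lambda>i. space (Leb (d i))"] by (simp add: W_def[abs_def] Sspace)
  define \<mu> where "\<mu> = density P (\<lambda>x. \<Sum>t\<in>X. ennreal (l t) * W t x)"
  have sets\<mu>: "sets \<mu> = sets (Emeas n d)" by (simp add: \<mu>_def setsP)
  note space\<mu> = sets_eq_imp_space_eq[OF sets\<mu>]
  have box: "emeasure \<mu> (PiE {..<n} B) = ennreal (\<Sum>t\<in>X. l t * (\<Prod>i<n. measure (\<mu>s i) (S i (t i) \<inter> B i) / p i (t i)))"
    if B: "\<And>i. i < n \<Longrightarrow> B i \<in> sets (Leb (d i))" for B
  proof -
    have BN: "B i \<in> sets (N i)" if "i < n" for i using B[OF that] that by (simp add: N_def sets)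
    have BP: "PiE {..<n} B \<in> sets P" unfolding P_def using BN by (intro sets_PiM_I_finite) auto
    have dens: "(\<lambda>x. \<Sum>t\<in>X. ennreal (l t) * W t x) \<in> borel_measurable P"
      using Wm by (intro borel_measurable_sum borel_measurable_times_ennreal borel_measurable_const) auto
    have "emeasure \<mu> (PiE {..<n} B) = (\<integral>\<^sup>+x. (\<Sum>t\<in>X. ennreal (l t) * W t x) * indicator (PiE {..<n} B) x \<partial>P)"
      unfolding \<mu>_def using dens BP by (rule emeasure_density)
    also have "\<dots> = (\<integral>\<^sup>+x. (\<Sum>t\<in>X. ennreal (l t) * (\<Prod>i<n. ennreal (1 / p i (t i)) * indicator (S i (t i) \<inter> B i) (x i))) \<partial>P)"
    proof (rule nn_integral_cong)
      fix x assume "x \<in> space P"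
      then have x: "x \<in> extensional {..<n}" by (simp add: P_def space_PiM PiE_iff)
      have "indicator (PiE {..<n} B) x = (\<Prod>i<n. indicator (B i) (x i) :: ennreal)"
      proof (cases "x \<in> PiE {..<n} B")
        case True
        then show ?thesis by (auto simp: PiE_iff intro!: prod.neutral[symmetric])
      next
        case False
        then obtain i where "i < n" "x i \<notin> B i" using x by (auto simp: PiE_iff)
        then have "(\<Prod>i<n. indicator (B i) (x i) :: ennreal) = 0"
          by (intro prod_zero) (auto intro!: bexI[of _ i])
        then show ?thesis using False by simp
      qed
      then show "(\<Sum>t\<in>X. ennreal (l t) * W t x) * indicator (PiE {..<n} B) x
          = (\<Sum>t\<in>X. ennreal (l t) * (\<Prod>i<n. ennreal (1 / p i (t i)) * indicator (S i (t i) \<inter> B i) (x i)))"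
        by (simp add: W_def sum_distrib_right prod.distrib indicator_inter_arith mult.assoc)
    qed
    also have "\<dots> = (\<Sum>t\<in>X. ennreal (l t) * (\<integral>\<^sup>+x. (\<Prod>i<n. ennreal (1 / p i (t i)) * indicator (S i (t i) \<inter> B i) (x i)) \<partial>P))"
      using Pm B by (subst nn_integral_sum)
        (auto intro!: sum.cong nn_integral_cmult borel_measurable_times_ennreal)
    also have "\<dots> = (\<Sum>t\<in>X. ennreal (l t) * ennreal (\<Prod>i<n. measure (\<mu>s i) (S i (t i) \<inter> B i) / p i (t i)))"
    proof (rule sum.cong[OF refl])
      fix t assume t: "t \<in> X"
      note SB = SB_N[OF t _ B]
      have "(\<integral>\<^sup>+x. (\<Prod>i<n. ennreal (1 / p i (t i)) * indicator (S i (t i) \<inter> B i) (x i)) \<partial>P)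
          = (\<Prod>i<n. \<integral>\<^sup>+x. ennreal (1 / p i (t i)) * indicator (S i (t i) \<inter> B i) x \<partial>N i)"
        unfolding P_def using SB
        by (intro NP.product_nn_integral_prod borel_measurable_times_ennreal borel_measurable_const borel_measurable_indicator) auto
      also have "\<dots> = (\<Prod>i<n. ennreal (measure (\<mu>s i) (S i (t i) \<inter> B i) / p i (t i)))"
      proof (rule prod.cong[OF refl])
        fix i assume "i \<in> {..<n}"
        then have i: "i < n" by simp
        have "(\<integral>\<^sup>+x. ennreal (1 / p i (t i)) * indicator (S i (t i) \<inter> B i) x \<partial>N i)
            = ennreal (1 / p i (t i)) * emeasure (N i) (S i (t i) \<inter> B i)"
          using SB[OF i i] by (rule nn_integral_cmult_indicator)
        also have "\<dots> = ennreal (measure (\<mu>s i) (S i (t i) \<inter> B i) / p i (t i))"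
          unfolding N.emeasure_eq_measure using i by (simp add: N_def p_def ennreal_mult[symmetric])
        finally show "(\<integral>\<^sup>+x. ennreal (1 / p i (t i)) * indicator (S i (t i) \<inter> B i) x \<partial>N i)
            = ennreal (measure (\<mu>s i) (S i (t i) \<inter> B i) / p i (t i))" .
      qed
      also have "\<dots> = ennreal (\<Prod>i<n. measure (\<mu>s i) (S i (t i) \<inter> B i) / p i (t i))"
        by (intro prod_ennreal) (simp add: p_def)
      finally show "ennreal (l t) * (\<integral>\<^sup>+x. (\<Prod>i<n. ennreal (1 / p i (t i)) * indicator (S i (t i) \<inter> B i) (x i)) \<partial>P)
        = ennreal (l t) * ennreal (\<Prod>i<n. measure (\<mu>s i) (S i (t i) \<inter> B i) / p i (t i))" by simp
    qed
    also have "\<dots> = (\<Sum>t\<in>X. ennreal (l t * (\<Prod>i<n. measure (\<mu>s i) (S i (t i) \<inter> B i) / p i (t i))))"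
      using l0 by (intro sum.cong refl) (simp add: X_def ennreal_mult p_def prod_nonneg)
    also have "\<dots> = ennreal (\<Sum>t\<in>X. l t * (\<Prod>i<n. measure (\<mu>s i) (S i (t i) \<inter> B i) / p i (t i)))"
      using l0 by (intro sum_ennreal) (auto simp: X_def p_def intro!: mult_nonneg_nonneg prod_nonneg)
    finally show ?thesis .
  qed
  \<comment> \<open>On a null cell the weight in \<open>W\<close> is \<open>1 / 0 = 0\<close>. No
    mass is lost thereby, because \<open>l\<close> vanishes on every tuple that meets a null
    cell.\<close>
  have ppos: "p i (t i) > 0" if t: "t \<in> X" and i: "i < n" and lt: "l t \<noteq> 0" for t i
  proof -
    have "0 < l t" using l0[of t] t lt by (simp add: X_def)
    also have "l t \<le> (\<Sum>t\<in>{t'\<in>X. t' i = t i}. l t)"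
      using t finX l0 by (intro member_le_sum) (auto simp: X_def)
    also have "\<dots> = p i (t i)" using marg[OF i XF[OF t i]] by (simp add: X_def p_def S_def)
    finally show ?thesis .
  qed
  have marginal: "emeasure \<mu> (PiE {..<n} (\<lambda>j. if j = i then B else space (Leb (d j)))) = emeasure (\<mu>s i) B"
    if i: "i < n" and B: "B \<in> sets (Leb (d i))" for i B
  proof -
    interpret M: prob_space "\<mu>s i" using ps[OF i] .
    let ?m = "\<lambda>a. measure (\<mu>s i) (S i a \<inter> B)"
    have "emeasure \<mu> (PiE {..<n} (\<lambda>j. if j = i then B else space (Leb (d j))))
        = ennreal (\<Sum>t\<in>X. l t * (\<Prod>j<n. measure (\<mu>s j) (S j (t j) \<inter> (if j = i then B else space (Leb (d j)))) / p j (t j)))"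
      using B by (intro box) auto
    also have "(\<Sum>t\<in>X. l t * (\<Prod>j<n. measure (\<mu>s j) (S j (t j) \<inter> (if j = i then B else space (Leb (d j)))) / p j (t j)))
        = (\<Sum>t\<in>X. l t * (?m (t i) / p i (t i)))"
    proof (rule sum.cong[OF refl])
      fix t assume t: "t \<in> X"
      show "l t * (\<Prod>j<n. measure (\<mu>s j) (S j (t j) \<inter> (if j = i then B else space (Leb (d j)))) / p j (t j))
          = l t * (?m (t i) / p i (t i))"
      proof (cases "l t = 0")
        case False
        have "(\<Prod>j<n. measure (\<mu>s j) (S j (t j) \<inter> (if j = i then B else space (Leb (d j)))) / p j (t j))
            = (\<Prod>j<n. if j = i then ?m (t i) / p i (t i) else 1)"
        proof (rule prod.cong[OF refl])
          fix j assume "j \<in> {..<n}"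
          then have "p j (t j) > 0" using ppos[OF t _ False] by simp
          then show "measure (\<mu>s j) (S j (t j) \<inter> (if j = i then B else space (Leb (d j)))) / p j (t j)
            = (if j = i then ?m (t i) / p i (t i) else 1)"
            by (auto simp: Sspace p_def)
        qed
        also have "\<dots> = ?m (t i) / p i (t i)" using i by simp
        finally show ?thesis by simp
      qed simp
    qed
    also have "\<dots> = (\<Sum>a\<in>F i. \<Sum>t\<in>{t\<in>X. t i = a}. l t * (?m (t i) / p i (t i)))"
      using finX fin[OF i] XF[OF _ i] by (intro sum.group[symmetric]) auto
    also have "\<dots> = (\<Sum>a\<in>F i. p i a * (?m a / p i a))"
    proof (rule sum.cong[OF refl])
      fix a assume a: "a \<in> F i"
      have "(\<Sum>t\<in>{t\<in>X. t i = a}. l t * (?m (t i) / p i (t i))) = (\<Sum>t\<in>{t\<in>X. t i = a}. l t) * (?m a / p i a)"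
        unfolding sum_distrib_right by (rule sum.cong) auto
      then show "(\<Sum>t\<in>{t\<in>X. t i = a}. l t * (?m (t i) / p i (t i))) = p i a * (?m a / p i a)"
        using marg[OF i a] by (simp add: X_def p_def S_def)
    qed
    also have "\<dots> = (\<Sum>a\<in>F i. ?m a)"
    proof (rule sum.cong[OF refl])
      fix a assume a: "a \<in> F i"
      have "?m a \<le> p i a" unfolding p_def
        using Sm[OF i a] by (intro M.finite_measure_mono) (auto simp: sets[OF i])
      then show "p i a * (?m a / p i a) = ?m a" by (cases "p i a = 0") (auto simp: order_antisym)
    qed
    also have "\<dots> = measure (\<mu>s i) (\<Union>a\<in>F i. S i a \<inter> B)"
      using Sm[OF i] B fin[OF i] sets[OF i]
      by (intro M.finite_measure_finite_Union[symmetric]) (auto simp: disjoint_family_on_def S_def)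
    also have "(\<Union>a\<in>F i. S i a \<inter> B) = B"
      using TF[OF i] sets.sets_into_space[OF B] by (auto simp: S_def)
    finally show ?thesis by (simp add: M.emeasure_eq_measure)
  qed
  have sp: "PiE {..<n} (\<lambda>j. if j = i then space (Leb (d i)) else space (Leb (d j))) = space \<mu>" for i
    unfolding space\<mu> space_Emeas by (intro PiE_cong) auto
  have "emeasure \<mu> (space \<mu>) = emeasure (\<mu>s 0) (space (Leb (d 0)))"
    using marginal[OF n, of "space (Leb (d 0))"] unfolding sp[of 0] by simp
  also have "\<dots> = 1"
    using prob_space.emeasure_space_1[OF ps[OF n]] sets_eq_imp_space_eq[OF sets[OF n]] by simp
  finally interpret M: prob_space \<mu> by (rule prob_spaceI)
  have coupling: "\<mu> \<in> couplings n d \<mu>s"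
    unfolding couplings_def
  proof (intro CollectI conjI allI impI)
    fix i assume i: "i < n"
    show "distr \<mu> (Leb (d i)) (\<lambda>x. x i) = \<mu>s i"
    proof (rule measure_eqI)
      fix B assume "B \<in> sets (distr \<mu> (Leb (d i)) (\<lambda>x. x i))"
      then have B: "B \<in> sets (Leb (d i))" by simp
      have "(\<lambda>x. x i) -` B \<inter> space \<mu> = PiE {..<n} (\<lambda>j. if j = i then B else space (Leb (d j)))"
      proof (rule set_eqI)
        fix x
        have Bs: "x i \<in> B \<Longrightarrow> x i \<in> space (Leb (d i))" using sets.sets_into_space[OF B] by auto
        have "(x i \<in> B \<and> (\<forall>j<n. x j \<in> space (Leb (d j)))) \<longleftrightarrow> (\<forall>j<n. x j \<in> (if j = i then B else space (Leb (d j))))"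
          using i Bs by metis
        moreover have "x \<in> space \<mu> \<longleftrightarrow> (\<forall>j<n. x j \<in> space (Leb (d j))) \<and> x \<in> extensional {..<n}"
          by (simp only: space\<mu> space_Emeas PiE_iff Ball_def lessThan_iff)
        moreover have "x \<in> PiE {..<n} (\<lambda>j. if j = i then B else space (Leb (d j)))
            \<longleftrightarrow> (\<forall>j<n. x j \<in> (if j = i then B else space (Leb (d j)))) \<and> x \<in> extensional {..<n}"
          by (simp only: PiE_iff Ball_def lessThan_iff)
        ultimately show "x \<in> (\<lambda>x. x i) -` B \<inter> space \<mu> \<longleftrightarrow> x \<in> PiE {..<n} (\<lambda>j. if j = i then B else space (Leb (d j)))"
          by (simp only: vimage_eq Int_iff) blast
      qed
      moreover have "(\<lambda>x. x i) \<in> measurable \<mu> (Leb (d i))"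
        using Emeas_proj_measurable[OF i] by (simp add: measurable_cong_sets[OF sets\<mu> refl])
      ultimately show "emeasure (distr \<mu> (Leb (d i)) (\<lambda>x. x i)) B = emeasure (\<mu>s i) B"
        using marginal[OF i B] B by (simp add: emeasure_distr)
    qed (simp add: sets[OF i])
  qed (use sets\<mu> M.prob_space_axioms in auto)
  \<comment> \<open>The boxes of cells. Since \<open>\<mu>\<close> gives the box of \<open>t\<close>
    the mass \<open>l t\<close>, the tuple of the \<open>T i (x i)\<close> has law \<open>l\<close>
    under \<open>\<mu>\<close>, and integrals of its functions are finite sums.\<close>
  define Q where "Q t = PiE {..<n} (\<lambda>i. S i (t i))" for t
  have Qm: "Q t \<in> sets \<mu>" if "t \<in> X" for t
    unfolding Q_def sets\<mu> Emeas_def using Sm XF[OF that] by (intro sets_PiM_I_finite) auto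
  have Ql: "measure \<mu> (Q t) = l t" if t: "t \<in> X" for t
  proof -
    have "emeasure \<mu> (Q t) = ennreal (\<Sum>t'\<in>X. l t' * (\<Prod>i<n. measure (\<mu>s i) (S i (t' i) \<inter> S i (t i)) / p i (t' i)))"
      unfolding Q_def using Sm XF[OF t] by (intro box) auto
    also have "(\<Sum>t'\<in>X. l t' * (\<Prod>i<n. measure (\<mu>s i) (S i (t' i) \<inter> S i (t i)) / p i (t' i)))
        = (\<Sum>t'\<in>X. if t' = t then l t else 0)"
    proof (rule sum.cong[OF refl])
      fix t' assume t': "t' \<in> X"
      show "l t' * (\<Prod>i<n. measure (\<mu>s i) (S i (t' i) \<inter> S i (t i)) / p i (t' i)) = (if t' = t then l t else 0)"
      proof (cases "t' = t")
        case True
        have "l t * (\<Prod>i<n. p i (t i) / p i (t i)) = l t"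
        proof (cases "l t = 0")
          case False
          then have "(\<Prod>i<n. p i (t i) / p i (t i)) = 1"
            using ppos[OF t] by (intro prod.neutral) force
          then show ?thesis by simp
        qed simp
        then show ?thesis using True by (simp add: p_def)
      next
        case False
        then obtain i where i: "i < n" "t' i \<noteq> t i" using t t' unfolding X_def by (meson PiE_ext lessThan_iff)
        then have "S i (t' i) \<inter> S i (t i) = {}" by (auto simp: S_def)
        then have "(\<Prod>i<n. measure (\<mu>s i) (S i (t' i) \<inter> S i (t i)) / p i (t' i)) = 0"
          using i by (intro prod_zero) (auto intro!: bexI[of _ i])
        then show ?thesis using False by simp
      qed
    qed
    also have "\<dots> = l t" using finX t by simp
    finally show ?thesis using l0[of t] t by (simp add: M.emeasure_eq_measure X_def)
  qed
  have gT: "g (\<lambda>i\<in>{..<n}. T i (x i)) = (\<Sum>t\<in>X. g t * indicator (Q t) x)" if x: "x \<in> space \<mu>" for x and g :: "(nat \<Rightarrow> 'a) \<Rightarrow> real"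
  proof -
    let ?t = "\<lambda>i\<in>{..<n}. T i (x i)"
    have xs: "x i \<in> space (Leb (d i))" if "i < n" for i using x that unfolding space\<mu> space_Emeas by auto
    have tX: "?t \<in> X" using TF xs by (auto simp: X_def)
    have "x \<in> Q t \<longleftrightarrow> t = ?t" if "t \<in> X" for t
    proof
      assume "x \<in> Q t"
      then have "T i (x i) = t i" if "i < n" for i using that by (auto simp: Q_def S_def PiE_iff)
      then show "t = ?t" using that by (intro PiE_ext[OF that[unfolded X_def] tX[unfolded X_def]]) auto
    next
      assume "t = ?t"
      then show "x \<in> Q t" using xs x unfolding space\<mu> space_Emeas by (auto simp: Q_def S_def PiE_iff)
    qed
    then have "(\<Sum>t\<in>X. g t * indicator (Q t) x) = (\<Sum>t\<in>X. if t = ?t then g t else 0)"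
      by (intro sum.cong) (auto simp: indicator_def)
    then show ?thesis using finX tX by simp
  qed
  show thesis
  proof (rule that[OF coupling])
    fix g :: "(nat \<Rightarrow> 'a) \<Rightarrow> real"
    have int: "integrable \<mu> (\<lambda>x. g t * indicator (Q t) x)" if "t \<in> X" for t
      using Qm[OF that] by (simp add: M.emeasure_eq_measure)
    show "integrable \<mu> (\<lambda>x. g (\<lambda>i\<in>{..<n}. T i (x i)))"
      using int by (subst Bochner_Integration.integrable_cong[OF refl gT]) auto
    have "(\<integral>x. g (\<lambda>i\<in>{..<n}. T i (x i)) \<partial>\<mu>) = (\<integral>x. (\<Sum>t\<in>X. g t * indicator (Q t) x) \<partial>\<mu>)"
      by (rule Bochner_Integration.integral_cong[OF refl gT])
    also have "\<dots> = (\<Sum>t\<in>X. \<integral>x. g t * indicator (Q t) x \<partial>\<mu>)"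
      using int by (intro Bochner_Integration.integral_sum)
    also have "\<dots> = (\<Sum>t\<in>X. l t * g t)"
      using Qm Ql sets.sets_into_space[OF Qm] by (intro sum.cong) (auto simp: Int_absorb1 Int_absorb2)
    finally show "(\<integral>x. g (\<lambda>i\<in>{..<n}. T i (x i)) \<partial>\<mu>) = (\<Sum>t\<in>PiE {..<n} F. l t * g t)"
      by (simp add: X_def)
  qed
qed

section \<open>Discretisation\<close>

text \<open>Mesh \<open>1 / N\<close> inside the window from \<open>- N\<close> to \<open>N\<close>,
  the value 0 outside: finitely many values in all, and outside the window the squared error is just
  \<open>s\<^sup>2\<close>, which a second moment controls. For \<open>N = 0\<close> division by
  zero gives 0.\<close>

definition rnd :: "nat \<Rightarrow> real \<Rightarrow> real" where
  "rnd N s = (if \<bar>s\<bar> \<le> real N then of_int \<lfloor>real N * s\<rfloor> / real N else 0)"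

definition rndv :: "nat \<Rightarrow> nat \<Rightarrow> (nat \<Rightarrow> real) \<Rightarrow> nat \<Rightarrow> real" where
  "rndv N m x = restrict (\<lambda>k. rnd N (x k)) {..<m}"

definition grid :: "nat \<Rightarrow> nat \<Rightarrow> (nat \<Rightarrow> real) set" where
  "grid N m = PiE {..<m} (\<lambda>_. insert 0 ((\<lambda>z. of_int z / real N) ` {- int (N * N)..int (N * N)}))"

lemma rnd_measurable [measurable]: "rnd N \<in> borel_measurable borel"
proof -
  have "(\<lambda>s. of_int \<lfloor>real N * s\<rfloor> :: real) \<in> borel_measurable borel"
    by (rule measurable_compose[OF _ borel_measurable_real_floor]) simp
  moreover have "{s. \<bar>s\<bar> \<le> real N} = {- real N..real N}" by auto
  ultimately show ?thesis
    unfolding rnd_def[abs_def] by (intro measurable_If borel_measurable_divide borel_measurable_const) auto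
qed

lemma rnd_error: "\<bar>s\<bar> \<le> real N \<Longrightarrow> \<bar>s - rnd N s\<bar> \<le> 1 / real N"
proof (cases "N = 0")
  case False
  assume s: "\<bar>s\<bar> \<le> real N"
  have "\<bar>real N * s - of_int \<lfloor>real N * s\<rfloor>\<bar> \<le> 1" by linarith
  moreover have "s - rnd N s = (real N * s - of_int \<lfloor>real N * s\<rfloor>) / real N"
    using s False by (simp add: rnd_def field_simps)
  ultimately show ?thesis using False by (simp add: abs_divide divide_right_mono)
qed (simp add: rnd_def)

text \<open>A majorant independent of \<open>N\<close> and integrable under finite second moments,
  as dominated convergence requires.\<close>

lemma rnd_error_square_le: "(s - rnd N s)\<^sup>2 \<le> s\<^sup>2 + 1"
proof (cases "\<bar>s\<bar> \<le> real N")
  case True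
  have "1 / real N \<le> 1" by (cases "N = 0") auto
  with rnd_error[OF True] have "\<bar>s - rnd N s\<bar> \<le> 1" by linarith
  then have "(s - rnd N s)\<^sup>2 \<le> 1" by (simp add: abs_square_le_1)
  then show ?thesis by (simp add: add_increasing)
qed (simp add: rnd_def)

lemma rnd_tendsto: "(\<lambda>N. s - rnd N s) \<longlonglongrightarrow> 0"
proof (rule Lim_null_comparison)
  show "(\<lambda>N. 1 / real N) \<longlonglongrightarrow> 0" by (rule lim_1_over_n)
  obtain N0 :: nat where "\<bar>s\<bar> < real N0" using reals_Archimedean2 by blast
  then show "\<forall>\<^sub>F N in sequentially. norm (s - rnd N s) \<le> 1 / real N"
    unfolding eventually_sequentially using rnd_error by (intro exI[of _ N0]) auto
qed

lemma finite_grid: "finite (grid N m)"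
  unfolding grid_def by (intro finite_PiE) auto

lemma rndv_grid: "rndv N m x \<in> grid N m"
proof -
  have "rnd N s \<in> insert 0 ((\<lambda>z. of_int z / real N) ` {- int (N * N)..int (N * N)})" for s
  proof (cases "\<bar>s\<bar> \<le> real N")
    case True
    then have "\<bar>real N * s\<bar> \<le> real N * real N" by (simp add: abs_mult mult_left_mono)
    then have "- real (N * N) \<le> real N * s" "real N * s \<le> real (N * N)" by (auto simp: abs_le_iff)
    then have "\<lfloor>real N * s\<rfloor> \<in> {- int (N * N)..int (N * N)}"
      by (auto simp: le_floor_iff floor_le_iff)
    from imageI[OF this, of "\<lambda>z. of_int z / real N"]
    have "of_int \<lfloor>real N * s\<rfloor> / real N \<in> (\<lambda>z. of_int z / real N) ` {- int (N * N)..int (N * N)}" .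
    then show ?thesis using True unfolding rnd_def by (simp del: of_nat_mult)
  qed (simp add: rnd_def)
  then show ?thesis unfolding rndv_def grid_def by auto
qed

lemma rndv_measurable: "rndv N m \<in> measurable (Leb m) (Leb m)"
  unfolding rndv_def[abs_def] by (rule Leb_measurable_restrict) measurable

lemma rndv_level_sets:
  assumes "a \<in> grid N m"
  shows "{x \<in> space (Leb m). rndv N m x = a} \<in> sets (Leb m)"
proof -
  have "{a} = PiE {..<m} (\<lambda>k. {a k})"
    using PiE_singleton[of a "{..<m}"] assms by (simp add: grid_def PiE_iff)
  then have "{a} \<in> sets (Leb m)" by (simp add: PiE_sets_Leb)
  then have "rndv N m -` {a} \<inter> space (Leb m) \<in> sets (Leb m)" by (rule measurable_sets[OF rndv_measurable])
  moreover have "rndv N m -` {a} \<inter> space (Leb m) = {x \<in> space (Leb m). rndv N m x = a}" by auto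
  ultimately show ?thesis by simp
qed

lemma Pspace_square_integrable:
  assumes P: "Pspace m \<mu>" and k: "k < m"
  shows "integrable \<mu> (\<lambda>x. (x k)\<^sup>2)"
proof (rule integrableI_bounded)
  have sets: "sets \<mu> = sets (Leb m)" using P by (simp add: Pspace_def)
  show "(\<lambda>x. (x k)\<^sup>2) \<in> borel_measurable \<mu>"
    using Leb_component_measurable[OF k] by (simp add: measurable_cong_sets[OF sets refl])
  have "(\<integral>\<^sup>+x. ennreal (norm ((x k)\<^sup>2)) \<partial>\<mu>) \<le> (\<integral>\<^sup>+x. ennreal (\<Sum>k<m. (x k)\<^sup>2) \<partial>\<mu>)"
  proof (intro nn_integral_mono ennreal_leI)
    fix x :: "nat \<Rightarrow> real"
    show "norm ((x k)\<^sup>2) \<le> (\<Sum>k<m. (x k)\<^sup>2)"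
      using k member_le_sum[of k "{..<m}" "\<lambda>k. (x k)\<^sup>2"] by simp
  qed
  then show "(\<integral>\<^sup>+x. ennreal (norm ((x k)\<^sup>2)) \<partial>\<mu>) < \<infinity>"
    using P by (auto simp: Pspace_def intro: order_le_less_trans)
qed

lemma rnd_error_integrable:
  assumes P: "Pspace m \<mu>" and k: "k < m"
  shows "integrable \<mu> (\<lambda>x. (x k - rnd N (x k))\<^sup>2)"
    and "(\<lambda>N. \<integral>x. (x k - rnd N (x k))\<^sup>2 \<partial>\<mu>) \<longlonglongrightarrow> 0"
proof -
  have sets: "sets \<mu> = sets (Leb m)" using P by (simp add: Pspace_def)
  interpret prob_space \<mu> using P by (simp add: Pspace_def)
  have [measurable]: "(\<lambda>x. x k) \<in> borel_measurable \<mu>"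
    using Leb_component_measurable[OF k] by (simp add: measurable_cong_sets[OF sets refl])
  have w: "integrable \<mu> (\<lambda>x. (x k)\<^sup>2 + 1)" using Pspace_square_integrable[OF P k] by simp
  show "integrable \<mu> (\<lambda>x. (x k - rnd N (x k))\<^sup>2)"
  proof (rule Bochner_Integration.integrable_bound[OF w])
    show "AE x in \<mu>. norm ((x k - rnd N (x k))\<^sup>2) \<le> norm ((x k)\<^sup>2 + 1)"
      using rnd_error_square_le by auto
  qed measurable
  have "(\<lambda>N. \<integral>x. (x k - rnd N (x k))\<^sup>2 \<partial>\<mu>) \<longlonglongrightarrow> (\<integral>x. 0 \<partial>\<mu>)"
  proof (rule integral_dominated_convergence[OF _ _ w])
    show "AE x in \<mu>. (\<lambda>N. (x k - rnd N (x k))\<^sup>2) \<longlonglongrightarrow> 0"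
      using tendsto_power[OF rnd_tendsto, where n = 2] by auto
    show "AE x in \<mu>. norm ((x k - rnd N (x k))\<^sup>2) \<le> (x k)\<^sup>2 + 1" for N
      using rnd_error_square_le by auto
  qed measurable
  then show "(\<lambda>N. \<integral>x. (x k - rnd N (x k))\<^sup>2 \<partial>\<mu>) \<longlonglongrightarrow> 0" by simp
qed

text \<open>The error of replacing \<open>x\<close> by \<open>y\<close> in the quadratic form is bounded by a sum of functions of
  the single blocks, so it can be absorbed into the dual potentials.\<close>

lemma quadform_diff_bound:
  assumes \<eta>: "\<eta> > 0"
  shows "\<bar>quadform n d q x - quadform n d q y\<bar>
    \<le> 2 * qnorm n d q * (\<Sum>i<n. \<Sum>k<d i. \<eta> * (x i k)\<^sup>2 + (1 + 1 / \<eta>) * (x i k - y i k)\<^sup>2)"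
proof -
  define w where "w i k = \<eta> * (x i k)\<^sup>2 + (1 + 1 / \<eta>) * (x i k - y i k)\<^sup>2" for i k
  define W where "W = (\<Sum>(i, k)\<in>coords n d. w i k)"
  have w0: "w i k \<ge> 0" for i k using \<eta> by (simp add: w_def)
  have wW: "w i k \<le> W" if "i < n" "k < d i" for i k
    using member_le_sum[of "(i, k)" "coords n d" "\<lambda>(i, k). w i k"] w0 that by (auto simp: W_def coords_def)
  have amgm: "\<bar>a * z\<bar> \<le> (\<eta> * a\<^sup>2 + z\<^sup>2 / \<eta>) / 2" for a z :: real
  proof -
    have "0 \<le> (\<eta> * \<bar>a\<bar> - \<bar>z\<bar>)\<^sup>2 / \<eta>" using \<eta> by simp
    also have "\<dots> = \<eta> * a\<^sup>2 + z\<^sup>2 / \<eta> - 2 * \<bar>a * z\<bar>"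
      using \<eta> by (simp add: power2_eq_square field_simps abs_mult)
    finally show ?thesis by simp
  qed
  have amgm1: "\<bar>a * z\<bar> \<le> (a\<^sup>2 + z\<^sup>2) / 2" for a z :: real
  proof -
    have "0 \<le> (\<bar>a\<bar> - \<bar>z\<bar>)\<^sup>2" by simp
    then show ?thesis by (simp add: power2_eq_square algebra_simps abs_mult)
  qed
  have "quadform n d q x - quadform n d q y
      = (\<Sum>(i, k)\<in>coords n d. \<Sum>(j, l)\<in>coords n d. q i k j l * (x i k * x j l - y i k * y j l))"
    unfolding quadform_coords sum_subtractf[symmetric]
    by (intro sum.cong refl) (auto simp: split_def sum_subtractf[symmetric] algebra_simps intro!: sum.cong)
  also have "\<bar>\<dots>\<bar> \<le> qnorm n d q * (2 * W)"
  proof (rule bilinear_bound)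
    fix i k j l assume H: "i < n" "k < d i" "j < n" "l < d j"
    define a b za zb where "a = x i k" and "b = x j l" and "za = x i k - y i k" and "zb = x j l - y j l"
    have "x i k * x j l - y i k * y j l = a * zb + b * za - za * zb"
      \<comment> \<open>The expansion is around \<open>x\<close>, not \<open>y\<close>, so the
        weight \<open>\<eta>\<close> falls on \<open>x\<close>, whose second moment is fixed. The
        mixed terms give \<open>1 / \<eta>\<close> and the product of the two errors gives the
        additional 1.\<close>
      by (simp add: a_def b_def za_def zb_def algebra_simps)
    also have "\<bar>\<dots>\<bar> \<le> \<bar>a * zb\<bar> + \<bar>b * za\<bar> + \<bar>za * zb\<bar>" by linarith
    also have "\<dots> \<le> (\<eta> * a\<^sup>2 + zb\<^sup>2 / \<eta>) / 2 + (\<eta> * b\<^sup>2 + za\<^sup>2 / \<eta>) / 2 + (za\<^sup>2 + zb\<^sup>2) / 2"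
      by (intro add_mono amgm amgm1)
    also have "\<dots> = (w i k + w j l) / 2"
      by (simp add: w_def a_def b_def za_def zb_def algebra_simps add_divide_distrib)
    also have "\<dots> \<le> 2 * W" using wW[OF H(1,2)] wW[OF H(3,4)] w0[of i k] by simp
    finally show "\<bar>x i k * x j l - y i k * y j l\<bar> \<le> 2 * W" .
  qed
  finally show ?thesis by (simp add: W_def w_def sum_coords mult_ac)
qed

section \<open>Approximate Kantorovich duality\<close>

text \<open>The grid potentials plus the rounding error \<open>e\<close> dominate the form
  everywhere. The quadratic lower bound in the conclusion comes from \<open>e\<close>; it is what
  later makes the exponentials integrable.\<close>

lemma kantorovich_duality_approx:
  assumes n: "n > 0" and P: "\<And>i. i < n \<Longrightarrow> Pspace (d i) (\<mu>s i)"
    and r: "\<And>\<mu>. \<mu> \<in> couplings n d \<mu>s \<Longrightarrow> (\<integral>x. quadform n d q x \<partial>\<mu>) \<le> r"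
    and \<epsilon>: "\<epsilon> > 0"
  obtains f :: "nat \<Rightarrow> (nat \<Rightarrow> real) \<Rightarrow> real" and a b where
    "\<And>i. i < n \<Longrightarrow> f i \<in> borel_measurable (Leb (d i))"
    "\<And>i. i < n \<Longrightarrow> integrable (\<mu>s i) (f i)"
    "a > 0" "\<And>i x. i < n \<Longrightarrow> x \<in> space (Leb (d i)) \<Longrightarrow> a * (\<Sum>k<d i. (x k)\<^sup>2) - b \<le> f i x"
    "\<And>x. x \<in> space (Emeas n d) \<Longrightarrow> quadform n d q x \<le> (\<Sum>i<n. f i (x i))"
    "(\<Sum>i<n. \<integral>x. f i x \<partial>\<mu>s i) \<le> r + \<epsilon>"
proof -
  \<comment> \<open>The added 1 keeps \<open>K\<close> positive even if the form vanishes, so the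
    potentials always grow quadratically.\<close>
  define K where "K = 2 * qnorm n d q + 1"
  have K: "K > 0" using qnorm_nonneg[of n d q] by (simp add: K_def)
  define m2 where "m2 = (\<Sum>i<n. \<Sum>k<d i. \<integral>x. (x k)\<^sup>2 \<partial>\<mu>s i)"
  have m2: "m2 \<ge> 0" by (simp add: m2_def sum_nonneg)
  \<comment> \<open>With this choice the second-moment part of the error is at most
    \<open>\<epsilon> / 6\<close>. Only then is \<open>N\<close> chosen, so that the rounding part,
    inflated by \<open>1 / \<eta>\<close>, stays below another
    \<open>\<epsilon> / 6\<close>.\<close>
  define \<eta> where "\<eta> = \<epsilon> / (6 * K * (1 + m2))"
  have \<eta>: "\<eta> > 0" using \<epsilon> K m2 by (simp add: \<eta>_def)
  have \<eta>2: "K * (\<eta> * m2) \<le> \<epsilon> / 6"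
  proof -
    have "K * (\<eta> * m2) \<le> K * (\<eta> * (1 + m2))" using K \<eta> by simp
    also have "\<dots> = \<epsilon> / 6"
    proof -
      have "1 + m2 \<noteq> 0" using m2 by simp
      then show ?thesis using K by (simp add: \<eta>_def)
    qed
    finally show ?thesis .
  qed
  define e2 where "e2 N = (\<Sum>i<n. \<Sum>k<d i. \<integral>x. (x k - rnd N (x k))\<^sup>2 \<partial>\<mu>s i)" for N
  have "(\<lambda>N. K * ((1 + 1 / \<eta>) * e2 N)) \<longlonglongrightarrow> K * ((1 + 1 / \<eta>) * (\<Sum>i<n. \<Sum>k<d i. 0))"
    unfolding e2_def using rnd_error_integrable(2)[OF P]
    by (intro tendsto_mult tendsto_const tendsto_sum) auto
  then have "\<forall>\<^sub>F N in sequentially. K * ((1 + 1 / \<eta>) * e2 N) < \<epsilon> / 6"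
    using \<epsilon> by (intro order_tendstoD(2)) auto
  then obtain N where N: "K * ((1 + 1 / \<eta>) * e2 N) < \<epsilon> / 6"
    by (auto simp: eventually_sequentially)
  define e where "e i x = K * (\<Sum>k<d i. \<eta> * (x k)\<^sup>2 + (1 + 1 / \<eta>) * (x k - rnd N (x k))\<^sup>2)" for i and x :: "nat \<Rightarrow> real"
  have em: "e i \<in> borel_measurable (Leb (d i))" for i
    unfolding e_def[abs_def] by (intro borel_measurable_times borel_measurable_sum borel_measurable_const) measurable
  have ei: "integrable (\<mu>s i) (e i)" if "i < n" for i
    unfolding e_def[abs_def] using Pspace_square_integrable[OF P[OF that]] rnd_error_integrable(1)[OF P[OF that]]
    by (intro integrable_mult_right Bochner_Integration.integrable_sum Bochner_Integration.integrable_add) auto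
  have "(\<Sum>i<n. \<integral>x. e i x \<partial>\<mu>s i) = K * (\<eta> * m2) + K * ((1 + 1 / \<eta>) * e2 N)"
  proof -
    have "(\<integral>x. e i x \<partial>\<mu>s i) = K * (\<Sum>k<d i. \<eta> * (\<integral>x. (x k)\<^sup>2 \<partial>\<mu>s i) + (1 + 1 / \<eta>) * (\<integral>x. (x k - rnd N (x k))\<^sup>2 \<partial>\<mu>s i))"
      if "i < n" for i
      unfolding e_def using Pspace_square_integrable[OF P[OF that]] rnd_error_integrable(1)[OF P[OF that]]
      by (simp add: Bochner_Integration.integral_sum Bochner_Integration.integral_add)
    then show ?thesis
      by (simp add: m2_def e2_def sum_distrib_left sum.distrib distrib_left)
  qed
  then have eint: "(\<Sum>i<n. \<integral>x. e i x \<partial>\<mu>s i) \<le> \<epsilon> / 3" using \<eta>2 N by linarith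
  define F where "F i = grid N (d i)" for i
  define T where "T i = rndv N (d i)" for i
  define S where "S i a = {x \<in> space (Leb (d i)). T i x = a}" for i a
  have Sm: "S i a \<in> sets (Leb (d i))" if "a \<in> F i" for i a
    using rndv_level_sets[of a N "d i"] that by (simp add: S_def F_def T_def)
  have TF: "T i x \<in> F i" for i x unfolding T_def F_def by (rule rndv_grid)
  define p where "p i a = measure (\<mu>s i) (S i a)" for i a
  have finF: "finite (F i)" for i unfolding F_def by (rule finite_grid)
  have ps: "prob_space (\<mu>s i)" and sets: "sets (\<mu>s i) = sets (Leb (d i))" if "i < n" for i
    using P[OF that] by (auto simp: Pspace_def)
  have sum_int: "integrable (\<mu>s i) (\<lambda>x. \<psi> (T i x))" "(\<integral>x. \<psi> (T i x) \<partial>\<mu>s i) = (\<Sum>a\<in>F i. \<psi> a * p i a)"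
    if i: "i < n" for i and \<psi> :: "(nat \<Rightarrow> real) \<Rightarrow> real"
  proof -
    interpret M: prob_space "\<mu>s i" by (rule ps[OF i])
    have eq: "\<psi> (T i x) = (\<Sum>a\<in>F i. \<psi> a * indicator (S i a) x)" if "x \<in> space (\<mu>s i)" for x
    proof -
      have "(\<Sum>a\<in>F i. \<psi> a * indicator (S i a) x) = (\<Sum>a\<in>F i. if a = T i x then \<psi> a else 0)"
        using that sets_eq_imp_space_eq[OF sets[OF i]] by (intro sum.cong) (auto simp: S_def indicator_def)
      then show ?thesis using finF TF by simp
    qed
    have int: "integrable (\<mu>s i) (\<lambda>x. \<psi> a * indicator (S i a) x)" if "a \<in> F i" for a
      using Sm[OF that] sets[OF i] by (simp add: M.emeasure_eq_measure)
    show "integrable (\<mu>s i) (\<lambda>x. \<psi> (T i x))"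
      using int by (subst Bochner_Integration.integrable_cong[OF refl eq]) auto
    have "(\<integral>x. \<psi> (T i x) \<partial>\<mu>s i) = (\<integral>x. (\<Sum>a\<in>F i. \<psi> a * indicator (S i a) x) \<partial>\<mu>s i)"
      by (rule Bochner_Integration.integral_cong[OF refl eq])
    also have "\<dots> = (\<Sum>a\<in>F i. \<integral>x. \<psi> a * indicator (S i a) x \<partial>\<mu>s i)"
      using int by (intro Bochner_Integration.integral_sum)
    also have "\<dots> = (\<Sum>a\<in>F i. \<psi> a * p i a)"
    proof (rule sum.cong[OF refl])
      fix a assume "a \<in> F i"
      then have "S i a \<in> sets (\<mu>s i)" using Sm sets[OF i] by simp
      then have "S i a \<inter> space (\<mu>s i) = S i a" by (rule sets.Int_space_eq2)
      then show "(\<integral>x. \<psi> a * indicator (S i a) x \<partial>\<mu>s i) = \<psi> a * p i a" by (simp add: p_def)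
    qed
    finally show "(\<integral>x. \<psi> (T i x) \<partial>\<mu>s i) = (\<Sum>a\<in>F i. \<psi> a * p i a)" .
  qed
  have psum: "(\<Sum>a\<in>F i. p i a) = 1" if i: "i < n" for i
    using sum_int(2)[OF i, of "\<lambda>_. 1"] prob_space.prob_space[OF ps[OF i]] by simp
  have p0: "p i a \<ge> 0" for i a by (simp add: p_def)
  have qT: "\<bar>quadform n d q x - quadform n d q (\<lambda>i\<in>{..<n}. T i (x i))\<bar> \<le> (\<Sum>i<n. e i (x i))" for x
  proof -
    have "quadform n d q (\<lambda>i\<in>{..<n}. T i (x i)) = quadform n d q (\<lambda>i k. rnd N (x i k))"
      by (rule quadform_cong) (simp add: T_def rndv_def)
    then have "\<bar>quadform n d q x - quadform n d q (\<lambda>i\<in>{..<n}. T i (x i))\<bar>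
        \<le> 2 * qnorm n d q * (\<Sum>i<n. \<Sum>k<d i. \<eta> * (x i k)\<^sup>2 + (1 + 1 / \<eta>) * (x i k - rnd N (x i k))\<^sup>2)"
      using quadform_diff_bound[OF \<eta>, of n d q x "\<lambda>i k. rnd N (x i k)"] by simp
    also have "\<dots> \<le> K * (\<Sum>i<n. \<Sum>k<d i. \<eta> * (x i k)\<^sup>2 + (1 + 1 / \<eta>) * (x i k - rnd N (x i k))\<^sup>2)"
      using \<eta> by (intro mult_right_mono sum_nonneg) (auto simp: K_def)
    also have "\<dots> = (\<Sum>i<n. e i (x i))" by (simp add: e_def sum_distrib_left)
    finally show ?thesis .
  qed
  show thesis
  \<comment> \<open>A discrete coupling reaching this level would glue to a coupling of value at
    least \<open>r + \<epsilon> / 3\<close>, because rounding costs at most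
    \<open>\<epsilon> / 3\<close>. So the dual case holds, and adding \<open>e\<close> to its
    potentials raises their value by at most \<open>\<epsilon> / 3\<close>.\<close>
  proof (rule finite_multimarginal_duality[of n F p "r + 2 * \<epsilon> / 3" "quadform n d q"])
    fix l
    assume l: "\<And>t. t \<in> PiE {..<n} F \<Longrightarrow> 0 \<le> l t"
      "\<And>i a. i < n \<Longrightarrow> a \<in> F i \<Longrightarrow> (\<Sum>t\<in>{t\<in>PiE {..<n} F. t i = a}. l t) = p i a"
      "r + 2 * \<epsilon> / 3 \<le> (\<Sum>t\<in>PiE {..<n} F. l t * quadform n d q t)"
    obtain \<mu> where mu: "\<mu> \<in> couplings n d \<mu>s"
      and int: "\<And>g :: (nat \<Rightarrow> nat \<Rightarrow> real) \<Rightarrow> real. integrable \<mu> (\<lambda>x. g (\<lambda>i\<in>{..<n}. T i (x i)))"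
      and val: "\<And>g :: (nat \<Rightarrow> nat \<Rightarrow> real) \<Rightarrow> real. (\<integral>x. g (\<lambda>i\<in>{..<n}. T i (x i)) \<partial>\<mu>) = (\<Sum>t\<in>PiE {..<n} F. l t * g t)"
    proof (rule glue_coupling[OF n, where \<mu>s = \<mu>s and T = T and F = F and l = l and d = d])
      show "(\<Sum>t\<in>{t\<in>PiE {..<n} F. t i = a}. l t) = measure (\<mu>s i) {x \<in> space (Leb (d i)). T i x = a}"
        if "i < n" "a \<in> F i" for i a using l(2)[OF that] by (simp add: p_def S_def)
      show "{x \<in> space (Leb (d i)). T i x = a} \<in> sets (Leb (d i))" if "i < n" "a \<in> F i" for i a
        using Sm[OF that(2)] by (simp add: S_def)
    qed (use ps sets finF TF l(1) in auto)
    have sets\<mu>: "sets \<mu> = sets (Emeas n d)" and marg: "\<And>i. i < n \<Longrightarrow> distr \<mu> (Leb (d i)) (\<lambda>x. x i) = \<mu>s i"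
      using mu by (auto simp: couplings_def)
    have proj: "(\<lambda>x. x i) \<in> measurable \<mu> (Leb (d i))" if "i < n" for i
      using Emeas_proj_measurable[OF that] by (simp add: measurable_cong_sets[OF sets\<mu> refl])
    have e\<mu>: "integrable \<mu> (\<lambda>x. e i (x i))" "(\<integral>x. e i (x i) \<partial>\<mu>) = (\<integral>x. e i x \<partial>\<mu>s i)" if "i < n" for i
    proof -
      show "integrable \<mu> (\<lambda>x. e i (x i))"
        using ei[OF that] unfolding marg[OF that, symmetric] by (subst (asm) integrable_distr_eq[OF proj[OF that] em]) auto
      show "(\<integral>x. e i (x i) \<partial>\<mu>) = (\<integral>x. e i x \<partial>\<mu>s i)"
        unfolding marg[OF that, symmetric] by (subst integral_distr[OF proj[OF that] em]) auto
    qed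
    let ?Q = "\<lambda>x. quadform n d q (\<lambda>i\<in>{..<n}. T i (x i))"
    have iE: "integrable \<mu> (\<lambda>x. \<Sum>i<n. e i (x i))" using e\<mu>(1) by (intro Bochner_Integration.integrable_sum) auto
    have qm: "quadform n d q \<in> borel_measurable \<mu>"
      using quadform_measurable by (simp add: measurable_cong_sets[OF sets\<mu> refl])
    \<comment> \<open>The form is bounded by its value at the rounded point, which takes finitely
      many values, plus the integrable \<open>e\<close>. Without integrability the Bochner integral
      would be the default 0 and could not be compared.\<close>
    have iq: "integrable \<mu> (quadform n d q)"
    proof (rule Bochner_Integration.integrable_bound[OF Bochner_Integration.integrable_add[OF integrable_abs[OF int[of "quadform n d q"]] iE] qm])
      show "AE x in \<mu>. norm (quadform n d q x) \<le> norm (\<bar>?Q x\<bar> + (\<Sum>i<n. e i (x i)))"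
      proof (rule AE_I2)
        fix x show "norm (quadform n d q x) \<le> norm (\<bar>?Q x\<bar> + (\<Sum>i<n. e i (x i)))"
          using qT[of x] unfolding real_norm_def by linarith
      qed
    qed
    have "r + 2 * \<epsilon> / 3 \<le> (\<integral>x. ?Q x \<partial>\<mu>)" using l(3) val[of "quadform n d q"] by simp
    also have "\<dots> \<le> (\<integral>x. quadform n d q x + (\<Sum>i<n. e i (x i)) \<partial>\<mu>)"
    proof (rule integral_mono[OF int Bochner_Integration.integrable_add[OF iq iE]])
      fix x show "?Q x \<le> quadform n d q x + (\<Sum>i<n. e i (x i))" using qT[of x] by linarith
    qed
    also have "\<dots> = (\<integral>x. quadform n d q x \<partial>\<mu>) + (\<Sum>i<n. \<integral>x. e i x \<partial>\<mu>s i)"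
      using iq iE e\<mu> by (simp add: Bochner_Integration.integral_sum)
    also have "\<dots> \<le> r + \<epsilon> / 3" using r[OF mu] eint by simp
    finally show thesis using \<epsilon> by simp
  next
    fix \<phi>
    assume \<phi>: "\<And>t. t \<in> PiE {..<n} F \<Longrightarrow> quadform n d q t \<le> (\<Sum>i<n. \<phi> i (t i))"
      "(\<Sum>i<n. \<Sum>a\<in>F i. \<phi> i a * p i a) < r + 2 * \<epsilon> / 3"
    \<comment> \<open>A potential on a finite grid is bounded; \<open>b\<close> is one lower bound
      for all blocks, to be subtracted from the growth supplied by \<open>e\<close>.\<close>
    define b where "b = (\<Sum>i<n. \<Sum>a\<in>F i. \<bar>\<phi> i a\<bar>)"
    have \<phi>b: "- b \<le> \<phi> i a" if "i < n" "a \<in> F i" for i a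
    proof -
      have "\<bar>\<phi> i a\<bar> \<le> (\<Sum>a\<in>F i. \<bar>\<phi> i a\<bar>)"
        using member_le_sum[of a "F i" "\<lambda>a. \<bar>\<phi> i a\<bar>"] finF that by simp
      also have "\<dots> \<le> b" unfolding b_def
        using member_le_sum[of i "{..<n}" "\<lambda>i. \<Sum>a\<in>F i. \<bar>\<phi> i a\<bar>"] that by (simp add: sum_nonneg)
      finally show ?thesis by linarith
    qed
    show thesis
    proof (rule that[of "\<lambda>i x. \<phi> i (T i x) + e i x" "K * \<eta>" b])
      fix i assume i: "i < n"
      have "(\<lambda>x. \<phi> i (T i x)) \<in> borel_measurable (\<mu>s i)"
        using sum_int(1)[OF i] by (rule borel_measurable_integrable)
      then show "(\<lambda>x. \<phi> i (T i x) + e i x) \<in> borel_measurable (Leb (d i))"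
        using em[of i] by (simp add: measurable_cong_sets[OF sets[OF i] refl])
      show "integrable (\<mu>s i) (\<lambda>x. \<phi> i (T i x) + e i x)"
        using sum_int(1)[OF i] ei[OF i] by (rule Bochner_Integration.integrable_add)
    next
      show "K * \<eta> > 0" using K \<eta> by simp
    next
      fix i and x :: "nat \<Rightarrow> real" assume i: "i < n"
      have "K * \<eta> * (\<Sum>k<d i. (x k)\<^sup>2) = K * (\<Sum>k<d i. \<eta> * (x k)\<^sup>2)"
        by (simp add: sum_distrib_left mult.assoc)
      also have "\<dots> \<le> e i x" unfolding e_def using K \<eta> by (intro mult_left_mono sum_mono) auto
      finally show "K * \<eta> * (\<Sum>k<d i. (x k)\<^sup>2) - b \<le> \<phi> i (T i x) + e i x"
        using \<phi>b[OF i TF[of i x]] by simp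
    next
      fix x
      have "(\<lambda>i\<in>{..<n}. T i (x i)) \<in> PiE {..<n} F" using TF by auto
      from \<phi>(1)[OF this] have "quadform n d q (\<lambda>i\<in>{..<n}. T i (x i)) \<le> (\<Sum>i<n. \<phi> i (T i (x i)))" by simp
      then show "quadform n d q x \<le> (\<Sum>i<n. \<phi> i (T i (x i)) + e i (x i))"
        using qT[of x] by (simp add: sum.distrib)
    next
      have "(\<Sum>i<n. \<integral>x. \<phi> i (T i x) + e i x \<partial>\<mu>s i) = (\<Sum>i<n. \<Sum>a\<in>F i. \<phi> i a * p i a) + (\<Sum>i<n. \<integral>x. e i x \<partial>\<mu>s i)"
        using sum_int ei by (simp add: Bochner_Integration.integral_add sum.distrib)
      then show "(\<Sum>i<n. \<integral>x. \<phi> i (T i x) + e i x \<partial>\<mu>s i) \<le> r + \<epsilon>" using \<phi>(2) eint by simp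
    qed
  qed (use finF p0 psum in auto)
qed

section \<open>The functional inequality implies the entropy inequality\<close>

lemma distr_symmetric_measure:
  assumes sets: "sets \<mu> = sets (Leb m)" and sym: "symmetric_measure m \<mu>"
  shows "distr \<mu> (Leb m) (negv m) = \<mu>"
proof (rule measure_eqI)
  have m: "negv m \<in> measurable \<mu> (Leb m)"
    using negv_measurable by (simp add: measurable_cong_sets[OF sets refl])
  fix B assume "B \<in> sets (distr \<mu> (Leb m) (negv m))"
  then have "B \<in> sets (Leb m)" by simp
  then show "emeasure (distr \<mu> (Leb m) (negv m)) B = emeasure \<mu> B"
    using sym sets by (simp add: emeasure_distr[OF m] symmetric_measure_def)
qed (simp add: sets)

text \<open>Without blocks, (A) reads 1 \<le> exp D, the space is a single point, and the point mass
  on it is a coupling of value 0.\<close>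

lemma condA_imp_condB_0:
  assumes A: "condA 0 d c q D" and D: "D \<noteq> -\<infinity>"
  shows "condB 0 d c q D"
  unfolding condB_def condB_gen_def
proof (intro allI impI)
  fix \<mu>s :: "nat \<Rightarrow> (nat \<Rightarrow> real) measure"
  have "D = \<infinity> \<or> 1 \<le> exp (real_of_ereal D)"
    using A unfolding condA_def by (auto simp: quadform_def)
  with D have D0: "0 \<le> D" by (cases D) auto
  define \<mu> where "\<mu> = return (Emeas 0 d) (\<lambda>_. undefined)"
  have "\<mu> \<in> couplings 0 d \<mu>s"
    unfolding couplings_def \<mu>_def by (auto simp: space_Emeas intro!: prob_space_return)
  then have "ereal (\<integral>x. quadform 0 d q x \<partial>\<mu>) \<le> (SUP \<mu>\<in>couplings 0 d \<mu>s. ereal (\<integral>x. quadform 0 d q x \<partial>\<mu>))"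
    by (rule SUP_upper)
  then have "0 \<le> (SUP \<mu>\<in>couplings 0 d \<mu>s. ereal (\<integral>x. quadform 0 d q x \<partial>\<mu>))"
    by (simp add: quadform_def zero_ereal_def)
  with D0 show "(\<Sum>i<0. ereal (c i) * entropy_h (d i) (\<mu>s i))
      \<le> (SUP \<mu>\<in>couplings 0 d \<mu>s. ereal (\<integral>x. quadform 0 d q x \<partial>\<mu>)) + D"
    by (simp add: add_nonneg_nonneg)
qed

text \<open>The form is invariant under negation, so domination may be averaged over
  \<open>x\<close> and its negative; symmetric marginals leave the integrals unchanged. Gibbs'
  inequality is then applied block by block, and the weights \<open>c i\<close> turn the logarithms
  of the \<open>Z i\<close> into the product bounded in (A).\<close>

lemma condA_entropy_bound:
  assumes n: "n > 0" and A: "condA n d c q (ereal D)" and c: "\<And>i. i < n \<Longrightarrow> 0 < c i"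
    and P: "\<And>i. i < n \<Longrightarrow> Pspace (d i) (\<mu>s i)" and sym: "\<And>i. i < n \<Longrightarrow> symmetric_measure (d i) (\<mu>s i)"
    and r: "\<And>\<mu>. \<mu> \<in> couplings n d \<mu>s \<Longrightarrow> (\<integral>x. quadform n d q x \<partial>\<mu>) \<le> r"
    and \<epsilon>: "\<epsilon> > 0"
  shows "(\<Sum>i<n. ereal (c i) * entropy_h (d i) (\<mu>s i)) \<le> ereal (r + \<epsilon> + D)"
proof -
  obtain f :: "nat \<Rightarrow> (nat \<Rightarrow> real) \<Rightarrow> real" and a b where
    fm: "\<And>i. i < n \<Longrightarrow> f i \<in> borel_measurable (Leb (d i))"
    and fi: "\<And>i. i < n \<Longrightarrow> integrable (\<mu>s i) (f i)"
    and a: "a > 0" and fl: "\<And>i x. i < n \<Longrightarrow> x \<in> space (Leb (d i)) \<Longrightarrow> a * (\<Sum>k<d i. (x k)\<^sup>2) - b \<le> f i x"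
    and fq: "\<And>x. x \<in> space (Emeas n d) \<Longrightarrow> quadform n d q x \<le> (\<Sum>i<n. f i (x i))"
    and fr: "(\<Sum>i<n. \<integral>x. f i x \<partial>\<mu>s i) \<le> r + \<epsilon>"
    by (rule kantorovich_duality_approx[OF n P r \<epsilon>]; (assumption | (rule that, blast+)))
  \<comment> \<open>The factor 2 averages and \<open>c i\<close> converts: (A) dominates by the sum
    of \<open>c i * g i\<close>, the transport potentials by the plain sum of
    \<open>f i\<close>.\<close>
  define g where "g i x = (f i x + f i (negv (d i) x)) / (2 * c i)" for i x
  have gm: "g i \<in> borel_measurable (Leb (d i))" if "i < n" for i
    unfolding g_def[abs_def] using fm[OF that] measurable_compose[OF negv_measurable fm[OF that]]
    by (intro borel_measurable_divide borel_measurable_add) auto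
  have sets: "sets (\<mu>s i) = sets (Leb (d i))" if "i < n" for i using P[OF that] by (simp add: Pspace_def)
  have negm: "negv (d i) \<in> measurable (\<mu>s i) (Leb (d i))" if "i < n" for i
    using negv_measurable by (simp add: measurable_cong_sets[OF sets[OF that] refl])
  have fn: "integrable (\<mu>s i) (\<lambda>x. f i (negv (d i) x))" "(\<integral>x. f i (negv (d i) x) \<partial>\<mu>s i) = (\<integral>x. f i x \<partial>\<mu>s i)" if i: "i < n" for i
  proof -
    note D = distr_symmetric_measure[OF sets[OF i] sym[OF i]]
    show "integrable (\<mu>s i) (\<lambda>x. f i (negv (d i) x))"
      using fi[OF i] integrable_distr_eq[OF negm[OF i] fm[OF i]] by (simp add: D)
    show "(\<integral>x. f i (negv (d i) x) \<partial>\<mu>s i) = (\<integral>x. f i x \<partial>\<mu>s i)"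
      using integral_distr[OF negm[OF i] fm[OF i]] by (simp add: D)
  qed
  have gi: "integrable (\<mu>s i) (g i)" if "i < n" for i
    unfolding g_def[abs_def] using fi[OF that] fn(1)[OF that] by (intro integrable_divide_zero) auto
  have gint: "c i * (\<integral>x. g i x \<partial>\<mu>s i) = (\<integral>x. f i x \<partial>\<mu>s i)" if "i < n" for i
  proof -
    have "(\<integral>x. g i x \<partial>\<mu>s i) = ((\<integral>x. f i x \<partial>\<mu>s i) + (\<integral>x. f i x \<partial>\<mu>s i)) / (2 * c i)"
      unfolding g_def using fi[OF that] fn[OF that] by simp
    then show ?thesis using c[OF that] by simp
  qed
  define Z where "Z i = enn2real (\<integral>\<^sup>+x. ennreal (exp (- g i x)) \<partial>Leb (d i))" for i
  have Zfin: "(\<integral>\<^sup>+x. ennreal (exp (- g i x)) \<partial>Leb (d i)) < \<infinity>" if i: "i < n" for i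
  proof -
    have two_nz: "(2::real) \<noteq> 0" by simp
    have gl: "(a * (\<Sum>k<d i. (x k)\<^sup>2) - b) / c i \<le> g i x" if x: "x \<in> space (Leb (d i))" for x
    proof -
      have "(\<Sum>k<d i. (negv (d i) x k)\<^sup>2) = (\<Sum>k<d i. (x k)\<^sup>2)" by (simp add: negv_def)
      then have "a * (\<Sum>k<d i. (x k)\<^sup>2) - b \<le> f i (negv (d i) x)"
        using fl[OF i negv_space[of "d i" x]] by simp
      then have "2 * (a * (\<Sum>k<d i. (x k)\<^sup>2) - b) \<le> f i x + f i (negv (d i) x)" using fl[OF i x] by simp
      then have "2 * (a * (\<Sum>k<d i. (x k)\<^sup>2) - b) / (2 * c i) \<le> g i x"
        unfolding g_def using c[OF i] by (intro divide_right_mono) auto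
      then show ?thesis unfolding mult_divide_mult_cancel_left[OF two_nz] .
    qed
    have "(\<integral>\<^sup>+x. ennreal (exp (- g i x)) \<partial>Leb (d i))
        \<le> (\<integral>\<^sup>+x. ennreal (exp (b / c i)) * ennreal (exp (- (a / c i * (\<Sum>k<d i. (x k)\<^sup>2)))) \<partial>Leb (d i))"
    proof (rule nn_integral_mono)
      fix x assume "x \<in> space (Leb (d i))"
      from gl[OF this] have "exp (- g i x) \<le> exp (b / c i + - (a / c i * (\<Sum>k<d i. (x k)\<^sup>2)))"
        by (simp add: diff_divide_distrib)
      then have "ennreal (exp (- g i x)) \<le> ennreal (exp (b / c i) * exp (- (a / c i * (\<Sum>k<d i. (x k)\<^sup>2))))"
        unfolding exp_add by (rule ennreal_leI)
      then show "ennreal (exp (- g i x)) \<le> ennreal (exp (b / c i)) * ennreal (exp (- (a / c i * (\<Sum>k<d i. (x k)\<^sup>2))))"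
        unfolding ennreal_mult[OF exp_ge_zero exp_ge_zero] .
    qed
    also have "\<dots> = ennreal (exp (b / c i)) * (\<integral>\<^sup>+x. ennreal (exp (- (a / c i * (\<Sum>k<d i. (x k)\<^sup>2)))) \<partial>Leb (d i))"
    proof (rule nn_integral_cmult)
      have "(\<lambda>x. \<Sum>k<d i. (x k)\<^sup>2) \<in> borel_measurable (Leb (d i))"
        by (intro borel_measurable_sum borel_measurable_power) (auto intro: Leb_component_measurable)
      then show "(\<lambda>x. ennreal (exp (- (a / c i * (\<Sum>k<d i. (x k)\<^sup>2))))) \<in> borel_measurable (Leb (d i))" by simp
    qed
    also have "\<dots> < \<infinity>"
      using nn_integral_Leb_gaussian_finite[of "a / c i" "d i"] a c[OF i] by (simp add: ennreal_mult_less_top)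
    finally show ?thesis .
  qed
  then have Zeq: "(\<integral>\<^sup>+x. ennreal (exp (- g i x)) \<partial>Leb (d i)) = ennreal (Z i)" if "i < n" for i
    using that by (simp add: Z_def)
  have Zpos: "Z i > 0" if i: "i < n" for i
  proof (rule ccontr)
    assume "\<not> Z i > 0"
    then have "(\<integral>\<^sup>+x. ennreal (exp (- g i x)) \<partial>Leb (d i)) = 0" using Zeq[OF i] by (simp add: ennreal_neg)
    then have "AE x in Leb (d i). ennreal (exp (- g i x)) = 0"
      using gm[OF i] by (subst (asm) nn_integral_0_iff_AE) auto
    then have "AE x in Leb (d i). False" by (rule AE_mp) simp
    then have "emeasure (Leb (d i)) (space (Leb (d i))) = 0" by (simp add: AE_iff_measurable[OF _ refl])
    moreover have "emeasure (Leb (d i)) (cube (d i) 1) \<le> emeasure (Leb (d i)) (space (Leb (d i)))"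
      by (rule emeasure_space)
    ultimately show False using emeasure_cube_pos[of 1 "d i"] by simp
  qed
  have ex: "expneg (ereal v) = ennreal (exp (- v))" for v by (simp add: expneg_def)
  have "(\<Prod>i<n. Z i powr c i) \<le> exp D"
  proof -
    have "(\<forall>i<n. (\<lambda>x. ereal (g i x)) \<in> borel_measurable (Leb (d i))
         \<and> (\<forall>x\<in>space (Leb (d i)). ereal (g i x) \<noteq> -\<infinity> \<and> ereal (g i (negv (d i) x)) = ereal (g i x))
         \<and> (\<integral>\<^sup>+ x. expneg (ereal (g i x)) \<partial>Leb (d i)) < \<infinity>)
      \<and> (\<forall>x\<in>space (Emeas n d). ereal (quadform n d q x) \<le> (\<Sum>i<n. ereal (c i) * ereal (g i (x i))))"
    proof (intro conjI allI impI ballI)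
      fix i assume i: "i < n"
      show "(\<lambda>x. ereal (g i x)) \<in> borel_measurable (Leb (d i))" using gm[OF i] by simp
      show "(\<integral>\<^sup>+ x. expneg (ereal (g i x)) \<partial>Leb (d i)) < \<infinity>" using Zfin[OF i] by (simp add: ex)
      fix x assume x: "x \<in> space (Leb (d i))"
      show "ereal (g i (negv (d i) x)) = ereal (g i x)" using negv_negv[OF x] by (simp add: g_def add.commute)
    next
      fix x assume x: "x \<in> space (Emeas n d)"
      define x' where "x' = restrict (\<lambda>i. negv (d i) (x i)) {..<n}"
      have x': "x' \<in> space (Emeas n d)" by (auto simp: x'_def space_Emeas negv_space)
      have "quadform n d q x' = quadform n d q (\<lambda>i k. - x i k)"
        by (rule quadform_cong) (simp add: x'_def negv_def)
      then have "quadform n d q x \<le> (\<Sum>i<n. f i (x' i))" using fq[OF x'] by (simp add: quadform_uminus)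
      also have "\<dots> = (\<Sum>i<n. f i (negv (d i) (x i)))" by (simp add: x'_def)
      finally have "2 * quadform n d q x \<le> (\<Sum>i<n. f i (x i) + f i (negv (d i) (x i)))"
        using fq[OF x] by (simp add: sum.distrib)
      also have "\<dots> = 2 * (\<Sum>i<n. c i * g i (x i))"
        unfolding sum_distrib_left g_def by (intro sum.cong refl) (use c in \<open>force simp: field_simps\<close>)
      finally show "ereal (quadform n d q x) \<le> (\<Sum>i<n. ereal (c i) * ereal (g i (x i)))" by simp
    qed simp
    then have "(\<Prod>i<n. enn2real (\<integral>\<^sup>+ x. expneg (ereal (g i x)) \<partial>Leb (d i)) powr c i) \<le> exp (real_of_ereal (ereal D))"
      using A[unfolded condA_def, rule_format, of "\<lambda>i x. ereal (g i x)"] by auto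
    then show ?thesis by (simp add: Z_def ex)
  qed
  moreover have "(\<Prod>i<n. Z i powr c i) = exp (\<Sum>i<n. c i * ln (Z i))"
    unfolding exp_sum[OF finite_lessThan] using Zpos by (intro prod.cong) (auto simp: powr_def less_imp_neq[THEN not_sym])
  ultimately have ZD: "(\<Sum>i<n. c i * ln (Z i)) \<le> D" by simp
  have "(\<Sum>i<n. ereal (c i) * entropy_h (d i) (\<mu>s i)) \<le> (\<Sum>i<n. ereal (c i) * ereal ((\<integral>x. g i x \<partial>\<mu>s i) + ln (Z i)))"
    using c Zeq Zpos gm gi P by (intro sum_mono ereal_mult_left_mono entropy_h_le) (auto simp: less_imp_le)
  also have "\<dots> = ereal (\<Sum>i<n. c i * ((\<integral>x. g i x \<partial>\<mu>s i) + ln (Z i)))" by simp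
  also have "(\<Sum>i<n. c i * ((\<integral>x. g i x \<partial>\<mu>s i) + ln (Z i))) = (\<Sum>i<n. \<integral>x. f i x \<partial>\<mu>s i) + (\<Sum>i<n. c i * ln (Z i))"
    by (simp add: distrib_left sum.distrib gint)
  also have "ereal \<dots> \<le> ereal (r + \<epsilon> + D)" using fr ZD by simp
  finally show ?thesis .
qed

text \<open>What remains is extended-real bookkeeping for the supremum \<open>S\<close>. For
  infinite \<open>D\<close> the right side is infinite whatever \<open>S\<close> is, since adding
  infinity to minus infinity gives infinity in \<open>ereal\<close>.\<close>

lemma condA_imp_condB:
  assumes A: "condA n d c q D" and c: "\<forall>i<n. 0 < c i" and D: "D \<noteq> -\<infinity>"
  shows "condB n d c q D"
proof (cases "n = 0 \<or> D = \<infinity>")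
  case True
  then show ?thesis
    using condA_imp_condB_0[of d c q D] A D by (auto simp: condB_def condB_gen_def)
next
  case False
  with D obtain D' where D': "D = ereal D'" by (cases D) auto
  show ?thesis unfolding condB_def condB_gen_def
  proof (intro allI impI)
    fix \<mu>s
    assume H: "\<forall>i<n. Pspace (d i) (\<mu>s i) \<and> symmetric_measure (d i) (\<mu>s i) \<and> True"
    define S where "S = (SUP \<mu>\<in>couplings n d \<mu>s. ereal (\<integral>x. quadform n d q x \<partial>\<mu>))"
    define X where "X = (\<Sum>i<n. ereal (c i) * entropy_h (d i) (\<mu>s i))"
    have bound: "X \<le> ereal (r + \<epsilon> + D')" if S: "S \<le> ereal r" and "\<epsilon> > 0" for r \<epsilon>
      unfolding X_def
    proof (rule condA_entropy_bound)
      fix \<mu> assume "\<mu> \<in> couplings n d \<mu>s"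
      then have "ereal (\<integral>x. quadform n d q x \<partial>\<mu>) \<le> S" unfolding S_def by (rule SUP_upper)
      from order_trans[OF this S] have "ereal (\<integral>x. quadform n d q x \<partial>\<mu>) \<le> ereal r" .
      then show "(\<integral>x. quadform n d q x \<partial>\<mu>) \<le> r" by simp
    qed (use False A D' c H \<open>\<epsilon> > 0\<close> in auto)
    have "X \<le> S + D"
    proof (cases S)
      case (real s)
      have "X \<le> ereal (s + D') + ereal \<epsilon>" if "\<epsilon> > 0" for \<epsilon>
        using bound[of s \<epsilon>] real that by (simp add: add_ac)
      then have "X \<le> ereal (s + D')" by (rule ereal_le_epsilon2)
      then show ?thesis by (simp add: real D')
    next
      \<comment> \<open>Every real \<open>r\<close> is now an admissible upper bound for the
        couplings, so the entropy sum lies below every real number.\<close>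
      case MInf
      have "X \<le> ereal B" for B using bound[of "B - 1 - D'" 1] MInf by simp
      then have "X = -\<infinity>" by (rule ereal_bot)
      then show ?thesis by simp
    qed (simp add: D')
    then show "X \<le> S + D" .
  qed
qed

theorem theorem12:
  fixes n :: nat and d :: "nat \<Rightarrow> nat" and c :: "nat \<Rightarrow> real"
    and q :: "nat \<Rightarrow> nat \<Rightarrow> nat \<Rightarrow> nat \<Rightarrow> real"
  assumes dpos: "\<forall>i<n. 0 < d i"
    and cpos: "\<forall>i<n. 0 < c i"
    and Qsym: "\<forall>i<n. \<forall>k<d i. \<forall>j<n. \<forall>l<d j. q i k j l = q j l i k"
  shows "(\<forall>D::ereal. D \<noteq> -\<infinity> \<longrightarrow> (condA n d c q D \<longleftrightarrow> condB n d c q D))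
       \<and> Ds n d c q = Inf {D. D \<noteq> -\<infinity> \<and> condB_logconcave n d c q D}"
proof -
  have B_lc: "condB n d c q D \<Longrightarrow> condB_logconcave n d c q D" for D
    unfolding condB_def condB_logconcave_def condB_gen_def by auto
  have lc_A: "condB_logconcave n d c q D \<Longrightarrow> condA n d c q D"
    and A_B: "condA n d c q D \<Longrightarrow> condB n d c q D" if "D \<noteq> -\<infinity>" for D
    using condB_logconcave_imp_condA[OF _ cpos that] condA_imp_condB[OF _ cpos that] by auto
  \<comment> \<open>The cycle closes here: the log-concave condition implies the full one by way of
    (A), with the same constant.\<close>
  have "{D. D \<noteq> -\<infinity> \<and> condB n d c q D} = {D. D \<noteq> -\<infinity> \<and> condB_logconcave n d c q D}"
    using B_lc lc_A A_B by blast
  then show ?thesis unfolding Ds_def using B_lc lc_A A_B by metis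
qed

end
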